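(* Let $N\ge3$, $p\in(1,N)$, $q\in(p,p^* )$ with $p^*=\frac{Np}{N-p}$, and let $u\in W^{1,p}(\mathbb{R}^N)$ be a weak subsolution to $$-\Delta_pu\le u^{q-1}\qquad\text{in }\mathbb{R}^N$$ such that $u\ge0$ in $\mathbb{R}^N$. Then $u\in L^\infty(\mathbb{R}^N)$.
   Context: $\Delta_pu=\operatorname{div}(|\nabla u|^{p-2}\nabla u)$. That $u\ge0$ is a weak subsolution means $\int_{\mathbb{R}^N}|\nabla u|^{p-2}\nabla u\cdot\nabla v\,dx\le\int_{\mathbb{R}^N}u^{q-1}v\,dx$ for all nonnegative test functions $v\in C^\infty_c(\mathbb{R}^N)$. *)

theory Defs
  imports "HOL-Analysis.Analysis"
begin

section \<open>Test functions\<close>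

definition partial_deriv :: "'a::euclidean_space \<Rightarrow> ('a \<Rightarrow> real) \<Rightarrow> 'a \<Rightarrow> real" where
  "partial_deriv b f x = frechet_derivative f (at x) b"

definition grad :: "('a::euclidean_space \<Rightarrow> real) \<Rightarrow> 'a \<Rightarrow> 'a" where
  "grad f x = (\<Sum>b\<in>Basis. partial_deriv b f x *\<^sub>R b)"

lemma GDERIV_grad:
  assumes "f differentiable (at x)"
  shows "GDERIV f x :> grad f x"
proof -
  have D: "(f has_derivative frechet_derivative f (at x)) (at x)"
    using assms frechet_derivative_works by blast
  then have lin: "linear (frechet_derivative f (at x))"
    by (rule has_derivative_linear)
  have "frechet_derivative f (at x) h = h \<bullet> grad f x" for h
  proof -
    have "frechet_derivative f (at x) h
        = frechet_derivative f (at x) (\<Sum>b\<in>Basis. (h \<bullet> b) *\<^sub>R b)"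
      by (simp add: euclidean_representation)
    also have "\<dots> = (\<Sum>b\<in>Basis. (h \<bullet> b) * frechet_derivative f (at x) b)"
      using lin by (simp add: linear_sum linear_cmul)
    also have "\<dots> = h \<bullet> grad f x"
      by (simp add: grad_def partial_deriv_def inner_sum_right mult.commute)
    finally show ?thesis .
  qed
  then have "frechet_derivative f (at x) = (\<lambda>h. h \<bullet> grad f x)" by blast
  with D show ?thesis by (simp add: gderiv_def)
qed

primrec C_k :: "nat \<Rightarrow> ('a::euclidean_space \<Rightarrow> real) \<Rightarrow> bool" where
  "C_k 0 f \<longleftrightarrow> continuous_on UNIV f"
| "C_k (Suc k) f \<longleftrightarrow>
     (\<forall>x. f differentiable (at x)) \<and> (\<forall>b\<in>Basis. C_k k (partial_deriv b f))"

definition test_functions :: "('a::euclidean_space \<Rightarrow> real) set" where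
  "test_functions = {v. (\<forall>k. C_k k v) \<and> compact (closure {x. v x \<noteq> 0})}"

section \<open>Lebesgue and Sobolev spaces\<close>

text \<open>Elements of these spaces are represented by Lebesgue measurable functions; two
  representatives of the same class agree almost everywhere.\<close>

definition Lp_fun :: "real \<Rightarrow> ('a::euclidean_space \<Rightarrow> 'b::euclidean_space) set" where
  "Lp_fun p = {f. f \<in> borel_measurable lebesgue \<and> integrable lebesgue (\<lambda>x. norm (f x) powr p)}"

definition Linfty_fun :: "('a::euclidean_space \<Rightarrow> 'b::euclidean_space) set" where
  "Linfty_fun = {f. f \<in> borel_measurable lebesgue \<and> (\<exists>C. AE x in lebesgue. norm (f x) \<le> C)}"

definition L1_loc :: "('a::euclidean_space \<Rightarrow> 'b::euclidean_space) set" where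
  "L1_loc = {f. f \<in> borel_measurable lebesgue \<and>
     (\<forall>K. compact K \<longrightarrow> set_integrable lebesgue K f)}"

definition has_weak_grad :: "('a::euclidean_space \<Rightarrow> real) \<Rightarrow> ('a \<Rightarrow> 'a) \<Rightarrow> bool" where
  "has_weak_grad u G \<longleftrightarrow> u \<in> L1_loc \<and> G \<in> L1_loc \<and>
     (\<forall>v\<in>test_functions. \<forall>b\<in>Basis.
        integral\<^sup>L lebesgue (\<lambda>x. u x * partial_deriv b v x)
          = - integral\<^sup>L lebesgue (\<lambda>x. (G x \<bullet> b) * v x))"

definition weakly_differentiable :: "('a::euclidean_space \<Rightarrow> real) \<Rightarrow> bool" where
  "weakly_differentiable u \<longleftrightarrow> (\<exists>G. has_weak_grad u G)"

text \<open>The weak gradient is determined only up to null sets, so a representative is chosen.\<close>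

definition weak_grad :: "('a::euclidean_space \<Rightarrow> real) \<Rightarrow> 'a \<Rightarrow> 'a" where
  "weak_grad u = (SOME G. has_weak_grad u G)"

lemma has_weak_grad_weak_grad:
  "weakly_differentiable u \<Longrightarrow> has_weak_grad u (weak_grad u)"
  unfolding weakly_differentiable_def weak_grad_def by (rule someI_ex[of "has_weak_grad u"])

definition W1p :: "real \<Rightarrow> ('a::euclidean_space \<Rightarrow> real) set" where
  "W1p p = {u. u \<in> Lp_fun p \<and> weakly_differentiable u \<and> weak_grad u \<in> Lp_fun p}"

definition sobolev_exponent :: "real \<Rightarrow> real \<Rightarrow> real" where
  "sobolev_exponent N p = N * p / (N - p)"

section \<open>Weak subsolutions\<close>

text \<open>For \<open>u \<ge> 0\<close> in \<open>W1p p\<close> on a space of dimension \<open>N\<close>, with \<open>1 < p < N\<close> and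
  \<open>p < q < sobolev_exponent N p\<close>, both integrands below are integrable: the left one since
  \<open>weak_grad u \<in> Lp_fun p\<close>, the right one by the Sobolev embedding. The vector field
  \<open>norm \<xi> powr (p - 2) *\<^sub>R \<xi>\<close> takes the value \<open>0\<close> at \<open>\<xi> = 0\<close>, also for \<open>p < 2\<close>.\<close>

definition p_laplace_flux :: "real \<Rightarrow> ('a::euclidean_space \<Rightarrow> real) \<Rightarrow> 'a \<Rightarrow> 'a" where
  "p_laplace_flux p u x = norm (weak_grad u x) powr (p - 2) *\<^sub>R weak_grad u x"

definition weak_subsolution :: "real \<Rightarrow> real \<Rightarrow> ('a::euclidean_space \<Rightarrow> real) \<Rightarrow> bool" where
  "weak_subsolution p q u \<longleftrightarrow>
     (\<forall>v\<in>test_functions. (\<forall>x. 0 \<le> v x) \<longrightarrow>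
        integral\<^sup>L lebesgue (\<lambda>x. p_laplace_flux p u x \<bullet> grad v x)
          \<le> integral\<^sup>L lebesgue (\<lambda>x. u x powr (q - 1) * v x))"

end

theory Submission
  imports Defs
begin

text \<open>
  The proof is De Giorgi's iteration, run on the distribution function \<open>\<mu> t = |{u > t}|\<close> alone.
  For \<open>0 < h < l\<close> let \<open>\<phi>\<close> be a smooth nondecreasing truncation, \<open>0\<close> below \<open>h\<close> and constant above \<open>l\<close>,
  with \<open>0 \<le> \<phi>' \<le> 1\<close>. Around a point with \<open>u > l\<close>, the set \<open>u \<le> h\<close> fills at least half of a ball
  of measure \<open>2 * \<mu> h\<close>, so the translation estimate for \<open>\<phi> \<circ> u\<close> gives
  \<open>\<mu> l * (l - h) powr p \<le> C * \<mu> h powr (p / N) * E\<close> with \<open>E\<close> the integral of \<open>\<phi>' u * |\<nabla>u|^p\<close>. This plays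
  the part of the Sobolev inequality. Bounding \<open>E\<close> by the integral of \<open>|\<nabla>u|^p\<close> and iterating gives
  \<open>\<mu> t \<le> A * t powr - r\<close> for some \<open>r\<close> arbitrarily close to \<open>p*\<close>; testing the inequality with
  \<open>\<phi> \<circ> u\<close> bounds \<open>E\<close> by \<open>l - h\<close> times the integral of \<open>u^(q-1)\<close> over \<open>{u > h}\<close>. Since
  \<open>q < p*\<close>, the second bound improves the constant \<open>A\<close> superlinearly along the levels
  \<open>M * (2 - 2^-j)\<close>, and for large \<open>M\<close> it tends to \<open>0\<close>. Chain rules are only needed for mollifications
  of \<open>u\<close>, which vanish at infinity, so that their truncations are admissible test functions.
\<close>

section \<open>Smooth functions\<close>

text \<open>Where the exponents come from: a ball of measure of order \<mu> h has radius of order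
  (\<mu> h)^(1/N), and shifts of that length cost its p-th power, hence the exponent \<kappa> = p/N.
  A decay rate r thereby turns into p + \<kappa> r, and the fixed point p / (1 - \<kappa>) of this
  map is the Sobolev exponent. It is approached but never reached, which is harmless: the second
  phase needs r > q - 1, so that u^(q-1) is integrable over superlevel sets, and r > (q - p) /
  \<kappa>, and both thresholds lie below the fixed point since q is subcritical. The order of the
  phases is dictated by integrability. Passing to the limit in the tested inequality needs u^(q-1)
  to be integrable over {u > h}, which membership in L^p does not give when q - 1 > p. The first
  phase supplies it and therefore cannot rely on the inequality. In the tested inequality the flux
  stays that of u while the test function comes from a mollification. The two gradients meet only in
  the limit, which is why all approximation errors are kept under one integrable majorant.\<close>

lemma partial_deriv_eq:
  assumes "(f has_derivative f') (at x)"
  shows "partial_deriv b f x = f' b"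
  using frechet_derivative_at[OF assms] by (simp add: partial_deriv_def)

lemma frechet_derivative_worksI:
  "f differentiable (at x) \<Longrightarrow> (f has_derivative frechet_derivative f (at x)) (at x)"
  using frechet_derivative_works by blast

lemma has_derivative_grad:
  fixes f :: "'a::euclidean_space \<Rightarrow> real"
  assumes "f differentiable (at x)"
  shows "(f has_derivative (\<lambda>h. h \<bullet> grad f x)) (at x)"
  using GDERIV_grad[OF assms] by (simp add: gderiv_def)

lemma grad_inner_Basis: "b \<in> Basis \<Longrightarrow> grad f x \<bullet> b = partial_deriv b f x"
  by (simp add: grad_def inner_sum_left inner_Basis if_distrib cong: if_cong)

lemma grad_eq:
  fixes f :: "'a::euclidean_space \<Rightarrow> real"
  assumes "(f has_derivative (\<lambda>h. h \<bullet> v)) (at x)"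
  shows "grad f x = v"
  by (rule euclidean_eqI) (simp add: grad_inner_Basis partial_deriv_eq[OF assms] inner_commute[of v])

lemma C_k_imp_continuous: "C_k k f \<Longrightarrow> continuous_on UNIV f"
  by (cases k) (auto intro!: differentiable_imp_continuous_on simp: differentiable_on_def
      intro: differentiable_at_withinI)

lemma C_k_SucD: "C_k (Suc k) f \<Longrightarrow> C_k k f"
proof (induction k arbitrary: f)
  case 0
  then show ?case using C_k_imp_continuous by fastforce
next
  case (Suc k)
  then show ?case by (metis C_k.simps(2))
qed

lemma C_k_const: "C_k k (\<lambda>x::'a::euclidean_space. c)"
proof (induction k arbitrary: c)
  case (Suc k)
  have "partial_deriv b (\<lambda>x::'a. c) = (\<lambda>x. 0)" for b
    by (simp add: partial_deriv_def fun_eq_iff)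
  then show ?case using Suc by simp
qed simp

lemma C_k_add: "C_k k f \<Longrightarrow> C_k k g \<Longrightarrow> C_k k (\<lambda>x. f x + g x)"
proof (induction k arbitrary: f g)
  case (Suc k)
  have "partial_deriv b (\<lambda>x. f x + g x) = (\<lambda>x. partial_deriv b f x + partial_deriv b g x)" for b
  proof
    fix x
    have "f differentiable (at x)" "g differentiable (at x)" using Suc.prems by auto
    then have "((\<lambda>x. f x + g x) has_derivative
        (\<lambda>h. frechet_derivative f (at x) h + frechet_derivative g (at x) h)) (at x)"
      by (intro derivative_intros) (simp_all add: frechet_derivative_worksI)
    then show "partial_deriv b (\<lambda>x. f x + g x) x = partial_deriv b f x + partial_deriv b g x"
      by (simp add: partial_deriv_eq) (simp add: partial_deriv_def)
  qed
  then show ?case using Suc by simp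
qed (simp add: continuous_on_add)

lemma partial_deriv_mult:
  assumes "f differentiable (at x)" "g differentiable (at x)"
  shows "partial_deriv b (\<lambda>x. f x * g x) x = f x * partial_deriv b g x + partial_deriv b f x * g x"
proof -
  have "((\<lambda>x. f x * g x) has_derivative
      (\<lambda>h. f x * frechet_derivative g (at x) h + frechet_derivative f (at x) h * g x)) (at x)"
    by (intro derivative_intros) (simp_all add: frechet_derivative_worksI assms)
  then show ?thesis
    by (simp add: partial_deriv_eq) (simp add: partial_deriv_def)
qed

lemma C_k_mult: "C_k k f \<Longrightarrow> C_k k g \<Longrightarrow> C_k k (\<lambda>x. f x * g x)"
proof (induction k arbitrary: f g)
  case (Suc k)
  then have "partial_deriv b (\<lambda>x. f x * g x)
      = (\<lambda>x. f x * partial_deriv b g x + partial_deriv b f x * g x)" for b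
    by (simp add: partial_deriv_mult fun_eq_iff)
  moreover have "C_k k f" "C_k k g" using Suc.prems C_k_SucD by blast+
  ultimately show ?case using Suc by (auto intro!: C_k_add)
qed (simp add: continuous_on_mult)

lemma C_k_compose:
  fixes \<phi> :: "real \<Rightarrow> real"
  shows "C_k k \<phi> \<Longrightarrow> C_k k f \<Longrightarrow> C_k k (\<lambda>x. \<phi> (f x))"
proof (induction k arbitrary: f \<phi>)
  case 0
  then show ?case by (auto intro: continuous_on_compose2)
next
  case (Suc k)
  have *: "((\<lambda>x. \<phi> (f x)) has_derivative
        (\<lambda>h. frechet_derivative \<phi> (at (f x)) (frechet_derivative f (at x) h))) (at x)" for x
  proof -
    have "(f has_derivative frechet_derivative f (at x)) (at x)"
      "(\<phi> has_derivative frechet_derivative \<phi> (at (f x))) (at (f x))"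
      using Suc.prems by (auto simp: frechet_derivative_worksI)
    then show ?thesis by (rule has_derivative_compose)
  qed
  have "partial_deriv b (\<lambda>x. \<phi> (f x)) = (\<lambda>x. partial_deriv 1 \<phi> (f x) * partial_deriv b f x)" for b
  proof
    fix x
    have "linear (frechet_derivative \<phi> (at (f x)))"
      using Suc.prems by (simp add: linear_frechet_derivative)
    from linear_cmul[OF this, of "frechet_derivative f (at x) b" 1]
    show "partial_deriv b (\<lambda>x. \<phi> (f x)) x = partial_deriv 1 \<phi> (f x) * partial_deriv b f x"
      unfolding partial_deriv_eq[OF *] by (simp add: partial_deriv_def mult.commute)
  qed
  moreover have "C_k k f" using Suc.prems C_k_SucD by blast
  moreover have "C_k k (partial_deriv 1 \<phi>)" using Suc.prems by simp
  moreover have "C_k k (partial_deriv b f)" if "b \<in> Basis" for b using Suc.prems that by simp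
  ultimately have "C_k k (partial_deriv b (\<lambda>x. \<phi> (f x)))" if "b \<in> Basis" for b
    using that Suc.IH by (simp add: C_k_mult)
  moreover have "(\<lambda>x. \<phi> (f x)) differentiable (at x)" for x
    using * by (auto simp: differentiable_def)
  ultimately show ?case by simp
qed

lemma C_k_inner_const: "C_k k (\<lambda>x. x \<bullet> c)"
proof (cases k)
  case (Suc j)
  have *: "((\<lambda>x. x \<bullet> c) has_derivative (\<lambda>h. h \<bullet> c)) (at x)" for x
    by (auto intro!: derivative_eq_intros)
  have "partial_deriv b (\<lambda>x. x \<bullet> c) = (\<lambda>x. b \<bullet> c)" for b
    by (simp add: partial_deriv_eq[OF *] fun_eq_iff)
  then show ?thesis using Suc * by (auto simp: C_k_const differentiable_def)
qed (simp add: continuous_intros)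

lemma C_k_inner_self: "C_k k (\<lambda>x. x \<bullet> x)"
proof (cases k)
  case (Suc j)
  have *: "((\<lambda>x. x \<bullet> x) has_derivative (\<lambda>h. 2 * (h \<bullet> x))) (at x)" for x
    by (auto intro!: derivative_eq_intros simp: inner_commute)
  have "C_k j (partial_deriv b (\<lambda>x. x \<bullet> x))" for b
  proof -
    have "partial_deriv b (\<lambda>x. x \<bullet> x) = (\<lambda>x. x \<bullet> (2 *\<^sub>R b))"
      by (simp add: partial_deriv_eq[OF *] fun_eq_iff inner_commute)
    then show ?thesis by (simp only: C_k_inner_const)
  qed
  then show ?thesis using Suc * by (auto simp: differentiable_def)
qed (simp add: continuous_intros)

text \<open>The factor \<open>(1 / s) ^ n\<close> makes the family closed under differentiation.\<close>

definition flat_exp :: "nat \<Rightarrow> real \<Rightarrow> real" where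
  "flat_exp n s = (if s > 0 then (1 / s) ^ n * exp (- (1 / s)) else 0)"

text \<open>With t = 1/s the claim is that exp t outgrows every power of t.\<close>

lemma tendsto_flat_exp_right: "((\<lambda>s. flat_exp n s) \<longlongrightarrow> 0) (at_right 0)"
proof -
  have "((\<lambda>t. t ^ n / exp t) \<longlongrightarrow> 0) (at_top :: real filter)"
    by (rule tendsto_power_div_exp_0)
  then have "((\<lambda>s. (inverse s) ^ n / exp (inverse s)) \<longlongrightarrow> 0) (at_right (0::real))"
    by (rule filterlim_compose) (rule filterlim_inverse_at_top_right)
  then show ?thesis
    by (rule Lim_transform_eventually)
      (auto simp: flat_exp_def eventually_at_filter exp_minus field_simps)
qed

lemma tendsto_flat_exp_0: "(flat_exp n \<longlongrightarrow> 0) (at 0)"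
proof -
  have "(flat_exp n \<longlongrightarrow> 0) (at_left 0)"
    by (rule Lim_transform_eventually[OF tendsto_const])
      (auto simp: flat_exp_def eventually_at_filter)
  then show ?thesis using tendsto_flat_exp_right filterlim_split_at by blast
qed

lemma flat_exp_has_real_derivative:
  "(flat_exp n has_real_derivative flat_exp (n + 2) s - of_nat n * flat_exp (n + 1) s) (at s)"
proof (cases s "0::real" rule: linorder_cases)
  case less
  have "((\<lambda>s. 0) has_real_derivative 0) (at s)" by simp
  then have "(flat_exp n has_real_derivative 0) (at s)"
    by (rule has_field_derivative_transform_within_open[of _ _ _ "{..<0}"])
      (use less in \<open>auto simp: flat_exp_def\<close>)
  then show ?thesis using less by (simp add: flat_exp_def)
next
  case equal
  \<comment> \<open>At 0 the difference quotient of \<open>flat_exp n\<close> is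
    \<open>flat_exp (Suc n)\<close>: dividing by h adds one factor 1/h, and both sides vanish for h
    < 0.\<close>
  have "((\<lambda>h. (flat_exp n (0 + h) - flat_exp n 0) / h) \<longlongrightarrow> 0) (at 0)"
    by (rule Lim_transform_eventually[OF tendsto_flat_exp_0[of "Suc n"]])
      (auto simp: flat_exp_def eventually_at_filter)
  then show ?thesis using equal by (simp add: DERIV_def flat_exp_def)
next
  case greater
  have "((\<lambda>s. (1 / s) ^ n * exp (- (1 / s))) has_real_derivative
      flat_exp (n + 2) s - of_nat n * flat_exp (n + 1) s) (at s)"
  proof (cases n)
    case 0
    then show ?thesis using greater
      by (auto intro!: derivative_eq_intros simp: flat_exp_def field_simps power2_eq_square)
  next
    case (Suc m)
    have "((\<lambda>s. (1 / s) ^ n * exp (- (1 / s))) has_real_derivative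
        of_nat n * (1 / s) ^ (n - 1) * (- 1 / s\<^sup>2) * exp (- (1 / s))
          + (1 / s) ^ n * (exp (- (1 / s)) * (1 / s\<^sup>2))) (at s)"
      using greater by (auto intro!: derivative_eq_intros simp: power2_eq_square)
    also have "of_nat n * (1 / s) ^ (n - 1) * (- 1 / s\<^sup>2) * exp (- (1 / s))
          + (1 / s) ^ n * (exp (- (1 / s)) * (1 / s\<^sup>2))
        = flat_exp (n + 2) s - of_nat n * flat_exp (n + 1) s"
      using greater Suc by (simp add: flat_exp_def power2_eq_square field_simps)
    finally show ?thesis .
  qed
  then show ?thesis
    by (rule has_field_derivative_transform_within_open[of _ _ _ "{0<..}"])
      (use greater in \<open>auto simp: flat_exp_def\<close>)
qed

lemma C_k_flat_exp: "C_k k (flat_exp n)"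
proof (induction k arbitrary: n)
  case 0
  then show ?case
    using DERIV_isCont[OF flat_exp_has_real_derivative]
    by (auto intro!: continuous_at_imp_continuous_on)
next
  case (Suc k)
  have *: "(flat_exp n has_derivative
      (\<lambda>h. (flat_exp (n + 2) s - of_nat n * flat_exp (n + 1) s) * h)) (at s)" for s
    using flat_exp_has_real_derivative by (simp add: has_field_derivative_def)
  have "partial_deriv 1 (flat_exp n) = (\<lambda>s. flat_exp (n + 2) s + (- of_nat n) * flat_exp (n + 1) s)"
    by (simp add: partial_deriv_eq[OF *] fun_eq_iff)
  moreover have "C_k k (\<lambda>s. flat_exp (n + 2) s + (- of_nat n) * flat_exp (n + 1) s)"
    by (intro C_k_add C_k_mult C_k_const Suc)
  moreover have "flat_exp n differentiable (at s)" for s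
    using * by (auto simp: differentiable_def)
  ultimately show ?case by simp
qed

section \<open>Test functions and mollifiers\<close>

lemma compact_closure_support_iff:
  fixes v :: "'a::euclidean_space \<Rightarrow> real"
  shows "compact (closure {x. v x \<noteq> 0}) \<longleftrightarrow> (\<exists>R. \<forall>x. R < norm x \<longrightarrow> v x = 0)"
  by (simp add: compact_closure bounded_iff) (metis linorder_not_less)

lemma test_functions_iff:
  "v \<in> test_functions \<longleftrightarrow> (\<forall>k. C_k k v) \<and> (\<exists>R. \<forall>x. R < norm x \<longrightarrow> v x = 0)"
  unfolding test_functions_def mem_Collect_eq compact_closure_support_iff ..

lemma test_function_smooth: "v \<in> test_functions \<Longrightarrow> C_k k v"
  by (simp add: test_functions_iff)

lemma test_function_differentiable: "v \<in> test_functions \<Longrightarrow> v differentiable (at x)"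
  using test_function_smooth[of v 1] by simp

lemma test_function_continuous: "v \<in> test_functions \<Longrightarrow> continuous_on S v"
  using test_function_smooth[of v 0] continuous_on_subset by fastforce

lemma test_function_borel: "v \<in> test_functions \<Longrightarrow> v \<in> borel_measurable borel"
  by (intro borel_measurable_continuous_onI test_function_continuous)

lemma partial_deriv_test_function:
  assumes v: "v \<in> test_functions" and b: "b \<in> Basis"
  shows "partial_deriv b v \<in> test_functions"
proof -
  obtain R where R: "R < norm x \<Longrightarrow> v x = 0" for x
    using v by (auto simp: test_functions_iff)
  have "partial_deriv b v x = 0" if "R < norm x" for x
  proof -
    have "open {x::'a. R < norm x}" by (intro open_Collect_less continuous_intros)
    moreover have "((\<lambda>x. 0::real) has_derivative (\<lambda>h. 0)) (at x)" by simp
    ultimately have "(v has_derivative (\<lambda>h. 0)) (at x)"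
      using that R by (metis (mono_tags, lifting) has_derivative_transform_within_open mem_Collect_eq)
    then show ?thesis by (simp add: partial_deriv_eq)
  qed
  moreover have "C_k k (partial_deriv b v)" for k
    using test_function_smooth[OF v, of "Suc k"] b by simp
  ultimately show ?thesis unfolding test_functions_iff by blast
qed

lemma test_function_bounded:
  assumes "v \<in> test_functions"
  obtains B where "B > 0" "\<And>x. \<bar>v x\<bar> \<le> B"
proof -
  obtain R where R: "R < norm x \<Longrightarrow> v x = 0" for x
    using assms by (auto simp: test_functions_iff)
  have "compact (v ` cball 0 R)"
    by (intro compact_continuous_image test_function_continuous assms compact_cball)
  then obtain B where B: "B > 0" "\<And>x. x \<in> cball 0 R \<Longrightarrow> \<bar>v x\<bar> \<le> B"
    by (auto dest!: compact_imp_bounded simp: bounded_pos)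
  then have "\<bar>v x\<bar> \<le> B" for x
    using R[of x] by (cases "R < norm x") auto
  then show ?thesis using B that by blast
qed

lemma test_function_integrable:
  assumes "v \<in> test_functions"
  shows "integrable lborel v"
proof -
  obtain R where R: "R < norm x \<Longrightarrow> v x = 0" for x
    using assms by (auto simp: test_functions_iff)
  have "integrable lborel (\<lambda>x. indicat_real (cball 0 R) x *\<^sub>R v x)"
    by (intro borel_integrable_compact test_function_continuous assms compact_cball)
  moreover have "(\<lambda>x. indicat_real (cball 0 R) x *\<^sub>R v x) = v"
    using R by (auto simp: fun_eq_iff indicator_def)
  ultimately show ?thesis by simp
qed

lemma mollifier_exists:
  fixes \<epsilon> :: real
  assumes "\<epsilon> > 0"
  obtains \<eta> :: "'a::euclidean_space \<Rightarrow> real"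
  where "\<eta> \<in> test_functions" "\<And>x. 0 \<le> \<eta> x" "\<And>x. \<epsilon> \<le> norm x \<Longrightarrow> \<eta> x = 0"
    "integral\<^sup>L lborel \<eta> = 1"
proof -
  \<comment> \<open>The squared norm, unlike the norm, is smooth at the origin. The spelling with
    \<open>- 1 *\<close> gives the shape to which \<open>C_k_add\<close> and \<open>C_k_mult\<close>
    apply.\<close>
  define \<zeta> :: "'a \<Rightarrow> real" where "\<zeta> = (\<lambda>x. flat_exp 0 (\<epsilon>\<^sup>2 + - 1 * (x \<bullet> x)))"
  have z0: "\<zeta> x = 0" if "\<epsilon> \<le> norm x" for x
  proof -
    have "\<epsilon>\<^sup>2 \<le> (norm x)\<^sup>2" using that assms by (intro power_mono) auto
    then show ?thesis by (simp add: \<zeta>_def flat_exp_def dot_square_norm)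
  qed
  have nn: "0 \<le> \<zeta> x" for x by (simp add: \<zeta>_def flat_exp_def)
  have sm: "C_k k \<zeta>" for k
    unfolding \<zeta>_def
    by (rule C_k_compose[OF C_k_flat_exp C_k_add[OF C_k_const C_k_mult[OF C_k_const C_k_inner_self]]])
  have test: "\<zeta> \<in> test_functions"
    unfolding test_functions_iff using sm z0 by (meson less_imp_le)
  have pos: "\<zeta> x > 0" if "x \<in> ball 0 \<epsilon>" for x
  proof -
    have "x \<bullet> x < \<epsilon>\<^sup>2"
      using that assms by (simp add: dot_square_norm power_strict_mono)
    then show ?thesis by (simp add: \<zeta>_def flat_exp_def)
  qed
  have "integral\<^sup>L lborel \<zeta> \<noteq> 0"
  proof
    assume "integral\<^sup>L lborel \<zeta> = 0"
    then have "AE x in lborel. \<zeta> x = 0"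
      using integral_nonneg_eq_0_iff_AE[OF test_function_integrable[OF test]] nn by simp
    then have "AE x in lborel. x \<notin> ball (0::'a) \<epsilon>"
      by eventually_elim (use pos in force)
    then have "emeasure lborel (ball (0::'a) \<epsilon>) = 0"
      by (subst (asm) AE_iff_measurable[OF _ refl]) (auto simp: ball_def)
    then have "measure lborel (ball (0::'a) \<epsilon>) = 0" by (simp add: measure_def)
    then show False using assms content_ball_gt_0_iff[of "0::'a" \<epsilon>] by simp
  qed
  then have I: "integral\<^sup>L lborel \<zeta> > 0"
    using nn by (simp add: less_le)
  show ?thesis
  proof
    have "C_k k (\<lambda>x. (1 / integral\<^sup>L lborel \<zeta>) * \<zeta> x)" for k
      by (intro C_k_mult C_k_const sm)
    moreover have "\<epsilon> < norm x \<Longrightarrow> (1 / integral\<^sup>L lborel \<zeta>) * \<zeta> x = 0" for x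
      using z0[of x] by simp
    ultimately show "(\<lambda>x. (1 / integral\<^sup>L lborel \<zeta>) * \<zeta> x) \<in> test_functions"
      unfolding test_functions_iff by blast
  qed (use I nn z0 in auto)
qed

section \<open>Mollification\<close>

lemma nn_integral_lborel_translate:
  fixes c :: "'a::euclidean_space"
  assumes "f \<in> borel_measurable borel"
  shows "(\<integral>\<^sup>+x. f (c + x) \<partial>lborel) = (\<integral>\<^sup>+x. f x \<partial>lborel)"
  by (subst (2) lborel_distr_plus[symmetric, of c]) (simp add: nn_integral_distr assms)

lemma integral_lborel_translate:
  fixes c :: "'a::euclidean_space" and f :: "'a \<Rightarrow> real"
  assumes "f \<in> borel_measurable borel"
  shows "(\<integral>x. f (c + x) \<partial>lborel) = (\<integral>x. f x \<partial>lborel)"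
  by (subst (2) lborel_distr_plus[symmetric, of c]) (simp add: integral_distr assms)

text \<open>The correlation \<open>\<integral> u y * \<eta> (y - x)\<close> takes the place of the convolution: it needs
  only translations and no reflection.\<close>

definition corr :: "('a::euclidean_space \<Rightarrow> real) \<Rightarrow> ('a \<Rightarrow> real) \<Rightarrow> 'a \<Rightarrow> real" where
  "corr u \<eta> x = (\<integral>y. u y * \<eta> (y - x) \<partial>lborel)"

text \<open>Measurability is Borel here, in contrast to \<open>L1_loc\<close>, so that composition
  with translations and Fubini over \<open>lborel\<close> stay measurable. Balls suffice because
  compact sets are bounded.\<close>

definition loc_integrable :: "('a::euclidean_space \<Rightarrow> real) \<Rightarrow> bool" where
  "loc_integrable u \<longleftrightarrow> u \<in> borel_measurable borel \<and> (\<forall>R. set_integrable lborel (cball 0 R) u)"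

lemma loc_integrableD: "loc_integrable u \<Longrightarrow> u \<in> borel_measurable borel"
  by (simp add: loc_integrable_def)

lemma loc_integrable_mult:
  assumes u: "loc_integrable u" and v: "v \<in> borel_measurable borel"
    and B: "\<And>x. \<bar>v x\<bar> \<le> B" and R: "\<And>x. R < norm x \<Longrightarrow> v x = 0"
  shows "integrable lborel (\<lambda>x. u x * v x)"
proof (rule Bochner_Integration.integrable_bound)
  show "integrable lborel (\<lambda>x. B * (indicator (cball 0 R) x *\<^sub>R u x))"
    using u by (auto simp: loc_integrable_def set_integrable_def)
  show "(\<lambda>x. u x * v x) \<in> borel_measurable lborel"
    using loc_integrableD[OF u] v by simp
  have "0 \<le> B" using B[of 0] by simp
  then show "AE x in lborel. norm (u x * v x) \<le> norm (B * (indicator (cball 0 R) x *\<^sub>R u x))"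
    using B R by (auto simp: abs_mult indicator_def mult.commute[of _ "\<bar>v _\<bar>"] intro!: mult_right_mono)
qed

lemma test_function_translate:
  fixes \<eta> :: "'a::euclidean_space \<Rightarrow> real"
  assumes "\<eta> \<in> test_functions"
  shows "(\<lambda>y. \<eta> (y - x)) \<in> test_functions"
    and "partial_deriv b (\<lambda>y. \<eta> (y - x)) y = partial_deriv b \<eta> (y - x)"
proof -
  have D: "((\<lambda>y. f (y - x)) has_derivative frechet_derivative f (at (y - x))) (at y)"
    if "f differentiable (at (y - x))" for f :: "'a \<Rightarrow> real" and y
  proof -
    have "((\<lambda>y. y - x) has_derivative (\<lambda>h. h)) (at y)" by (auto intro!: derivative_eq_intros)
    from has_derivative_compose[OF this frechet_derivative_worksI[OF that]] show ?thesis by simp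
  qed
  then have pd: "partial_deriv b (\<lambda>y. f (y - x)) = (\<lambda>y. partial_deriv b f (y - x))"
    if "\<forall>x. f differentiable (at x)" for f :: "'a \<Rightarrow> real" and b
    using that by (simp add: fun_eq_iff partial_deriv_eq[OF D]) (simp add: partial_deriv_def)
  show "partial_deriv b (\<lambda>y. \<eta> (y - x)) y = partial_deriv b \<eta> (y - x)"
    using pd[of \<eta>] assms by (simp add: test_function_differentiable)
  have "C_k k f \<Longrightarrow> C_k k (\<lambda>y. f (y - x))" for k and f :: "'a \<Rightarrow> real"
  proof (induction k arbitrary: f)
    case 0
    then show ?case by (auto intro!: continuous_on_compose2[of UNIV f] continuous_intros)
  next
    case (Suc k)
    then have "(\<lambda>y. f (y - x)) differentiable (at y)" for y
      using D[of f y] by (auto simp: differentiable_def[of "\<lambda>y. f (y - x)"])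
    then show ?case using Suc pd[of f] by simp
  qed
  moreover obtain R where R: "\<And>y. R < norm y \<Longrightarrow> \<eta> y = 0"
    using assms by (auto simp: test_functions_iff)
  moreover have "\<eta> (y - x) = 0" if "R + norm x < norm y" for y
    using R[of "y - x"] norm_triangle_ineq2[of y x] that by linarith
  ultimately show "(\<lambda>y. \<eta> (y - x)) \<in> test_functions"
    using assms unfolding test_functions_iff by blast
qed

text \<open>The uniform constant is what dominates the difference quotients when \<open>corr\<close>
  is differentiated under the integral.\<close>

lemma test_function_lipschitz:
  fixes \<eta> :: "'a::euclidean_space \<Rightarrow> real"
  assumes "\<eta> \<in> test_functions"
  obtains K where "K \<ge> 0" "\<And>x h. \<bar>h \<bullet> grad \<eta> x\<bar> \<le> K * norm h"
    "\<And>x y. \<bar>\<eta> x - \<eta> y\<bar> \<le> K * norm (x - y)"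
proof -
  have "\<exists>B>0. \<forall>x. \<bar>partial_deriv b \<eta> x\<bar> \<le> B" if "b \<in> Basis" for b
    using test_function_bounded[OF partial_deriv_test_function[OF assms that]] by metis
  then obtain B where B: "\<And>b. b \<in> Basis \<Longrightarrow> B b > 0 \<and> (\<forall>x. \<bar>partial_deriv b \<eta> x\<bar> \<le> B b)"
    by metis
  define K where "K = (\<Sum>b\<in>Basis. B b)"
  have K0: "K \<ge> 0" unfolding K_def using B by (intro sum_nonneg) (auto intro: less_imp_le)
  have 1: "\<bar>h \<bullet> grad \<eta> x\<bar> \<le> K * norm h" for x h
  proof -
    have "\<bar>h \<bullet> grad \<eta> x\<bar> \<le> norm h * norm (grad \<eta> x)" by (rule Cauchy_Schwarz_ineq2)
    also have "norm (grad \<eta> x) \<le> (\<Sum>b\<in>Basis. \<bar>grad \<eta> x \<bullet> b\<bar>)" by (rule norm_le_l1)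
    also have "\<dots> \<le> K"
      unfolding K_def using B by (intro sum_mono) (auto simp: grad_inner_Basis)
    finally show ?thesis by (simp add: mult.commute[of K] mult_left_mono)
  qed
  have "\<bar>\<eta> x - \<eta> y\<bar> \<le> K * norm (x - y)" for x y
  proof -
    have "norm (\<eta> x - \<eta> y) \<le> K * norm (x - y)"
    proof (rule differentiable_bound)
      show "(\<eta> has_derivative (\<lambda>h. h \<bullet> grad \<eta> z)) (at z within UNIV)" for z
        using has_derivative_grad[OF test_function_differentiable[OF assms]] by simp
      show "onorm (\<lambda>h. h \<bullet> grad \<eta> z) \<le> K" for z
        using 1 by (intro onorm_le) simp
    qed auto
    then show ?thesis by simp
  qed
  with K0 1 that show thesis by blast
qed

lemma integrable_corr:
  assumes u: "loc_integrable u" and \<eta>: "\<eta> \<in> test_functions"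
  shows "integrable lborel (\<lambda>y. u y * \<eta> (y - x))"
proof -
  note t = test_function_translate(1)[OF \<eta>, of x]
  obtain R where R: "\<And>y. R < norm y \<Longrightarrow> \<eta> (y - x) = 0"
    using t by (auto simp: test_functions_iff)
  obtain B where B: "\<And>y. \<bar>\<eta> (y - x)\<bar> \<le> B"
    using test_function_bounded[OF t] by metis
  show ?thesis
    by (rule loc_integrable_mult[OF u test_function_borel[OF t] B R])
qed

lemma integrable_corr_grad:
  fixes \<eta> :: "'a::euclidean_space \<Rightarrow> real"
  assumes u: "loc_integrable u" and \<eta>: "\<eta> \<in> test_functions"
  shows "integrable lborel (\<lambda>y. u y * (h \<bullet> grad \<eta> (y - x)))"
    and "(\<integral>y. u y * (h \<bullet> grad \<eta> (y - x)) \<partial>lborel)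
      = h \<bullet> (\<Sum>b\<in>Basis. corr u (partial_deriv b \<eta>) x *\<^sub>R b)"
proof -
  have eq: "u y * (h \<bullet> grad \<eta> (y - x))
      = (\<Sum>b\<in>Basis. (h \<bullet> b) * (u y * partial_deriv b \<eta> (y - x)))" for y
    by (simp add: grad_def inner_sum_right sum_distrib_left algebra_simps)
  have i: "integrable lborel (\<lambda>y. (h \<bullet> b) * (u y * partial_deriv b \<eta> (y - x)))"
    if "b \<in> Basis" for b
    by (intro integrable_mult_right integrable_corr u partial_deriv_test_function \<eta> that)
  show "integrable lborel (\<lambda>y. u y * (h \<bullet> grad \<eta> (y - x)))"
    unfolding eq by (intro Bochner_Integration.integrable_sum i)
  show "(\<integral>y. u y * (h \<bullet> grad \<eta> (y - x)) \<partial>lborel)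
      = h \<bullet> (\<Sum>b\<in>Basis. corr u (partial_deriv b \<eta>) x *\<^sub>R b)"
    unfolding eq using i
    by (subst Bochner_Integration.integral_sum) (auto simp: corr_def inner_sum_right mult.commute intro!: sum.cong)
qed

text \<open>Differentiation under the integral by dominated convergence. The minus sign stems from
  the argument y - x of the kernel.\<close>

lemma corr_has_derivative:
  fixes u :: "'a::euclidean_space \<Rightarrow> real"
  assumes u: "loc_integrable u" and \<eta>: "\<eta> \<in> test_functions"
  shows "(corr u \<eta> has_derivative
    (\<lambda>h. h \<bullet> - (\<Sum>b\<in>Basis. corr u (partial_deriv b \<eta>) x *\<^sub>R b))) (at x)"
proof -
  define D where "D h = h \<bullet> - (\<Sum>b\<in>Basis. corr u (partial_deriv b \<eta>) x *\<^sub>R b)" for h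
  obtain K where K: "K \<ge> 0" "\<And>x h. \<bar>h \<bullet> grad \<eta> x\<bar> \<le> K * norm h"
    "\<And>x y. \<bar>\<eta> x - \<eta> y\<bar> \<le> K * norm (x - y)"
    using test_function_lipschitz[OF \<eta>] by blast
  obtain R where R: "\<And>y. R < norm y \<Longrightarrow> \<eta> y = 0"
    using \<eta> by (auto simp: test_functions_iff)
  have R': "h \<bullet> grad \<eta> y = 0" if "max R 0 + 1 < norm y" for y h
  proof -
    have "open {x::'a. R < norm x}" by (intro open_Collect_less continuous_intros)
    moreover have "((\<lambda>x. 0::real) has_derivative (\<lambda>h. 0)) (at y)" by simp
    ultimately have "(\<eta> has_derivative (\<lambda>h. h \<bullet> 0)) (at y)"
      using that R has_derivative_transform_within_open[of "\<lambda>x. 0" "\<lambda>h. 0" y UNIV "{x. R < norm x}" \<eta>]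
      by auto
    then show ?thesis using grad_eq by fastforce
  qed
  \<comment> \<open>This is the first-order Taylor remainder of \<eta> at y - x for the increment
    -h, divided by |h|: bounded by twice the Lipschitz constant and tending to 0 with h. At h = 0
    division by zero gives 0, so \<open>eq\<close> holds there as well.\<close>
  define r where "r h y = (\<eta> (y - (x + h)) - \<eta> (y - x) + h \<bullet> grad \<eta> (y - x)) / norm h" for h y
  have eq: "(corr u \<eta> (x + h) - corr u \<eta> x - D h) / norm h = (\<integral>y. u y * r h y \<partial>lborel)" for h
  proof -
    have "corr u \<eta> (x + h) - corr u \<eta> x - D h
        = (\<integral>y. u y * \<eta> (y - (x + h)) - u y * \<eta> (y - x) + u y * (h \<bullet> grad \<eta> (y - x)) \<partial>lborel)"
      using integrable_corr[OF u \<eta>] integrable_corr_grad[OF u \<eta>]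
      by (simp add: corr_def[of u \<eta>] D_def)
    also have "\<dots> = (\<integral>y. norm h * (u y * r h y) \<partial>lborel)"
    proof (rule Bochner_Integration.integral_cong)
      fix y
      have "norm h * r h y = \<eta> (y - (x + h)) - \<eta> (y - x) + h \<bullet> grad \<eta> (y - x)"
        by (simp add: r_def)
      then have "norm h * (u y * r h y) = u y * (\<eta> (y - (x + h)) - \<eta> (y - x) + h \<bullet> grad \<eta> (y - x))"
        by (simp add: mult.left_commute)
      then show "u y * \<eta> (y - (x + h)) - u y * \<eta> (y - x) + u y * (h \<bullet> grad \<eta> (y - x))
          = norm h * (u y * r h y)"
        by (simp add: algebra_simps)
    qed simp
    finally show ?thesis by (cases "h = 0") (auto simp: r_def)
  qed
  have lim: "((\<lambda>h. \<integral>y. u y * r h y \<partial>lborel) \<longlongrightarrow> 0) (at 0)"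
    unfolding tendsto_at_iff_sequentially
  proof (intro allI impI)
    fix X assume X: "\<forall>i. X i \<in> UNIV - {0::'a}" "X \<longlonglongrightarrow> 0"
    \<comment> \<open>Increments shorter than 1 keep all remainders supported in one fixed ball,
      over which u is integrable.\<close>
    from X(2) obtain n0 where n0: "\<And>n. n \<ge> n0 \<Longrightarrow> norm (X n) < 1"
      using LIMSEQ_iff[of X 0] by (metis diff_zero zero_less_one)
    have "(\<lambda>n. \<integral>y. u y * r (X (n + n0)) y \<partial>lborel) \<longlonglongrightarrow> (\<integral>y. 0 \<partial>(lborel :: 'a measure))"
    proof (rule integral_dominated_convergence)
      let ?w = "\<lambda>y. 2 * K * \<bar>indicator (cball 0 (max R 0 + norm x + 1)) y *\<^sub>R u y\<bar>"
      show "integrable lborel ?w"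
        using u by (intro integrable_mult_right integrable_abs) (auto simp: loc_integrable_def set_integrable_def)
      have b: "(\<lambda>y. u y * r (X (n + n0)) y) = (\<lambda>y. (u y * \<eta> (y - (x + X (n + n0)))
           - u y * \<eta> (y - x) + u y * (X (n + n0) \<bullet> grad \<eta> (y - x))) / norm (X (n + n0)))" for n
        by (auto simp: r_def fun_eq_iff field_simps)
      show "(\<lambda>y. u y * r (X (n + n0)) y) \<in> borel_measurable lborel" for n
        unfolding b
        by (intro borel_measurable_divide borel_measurable_add borel_measurable_diff
            borel_measurable_integrable[OF integrable_corr[OF u \<eta>]]
            borel_measurable_integrable[OF integrable_corr_grad(1)[OF u \<eta>]] borel_measurable_const)
      show "AE y in lborel. norm (u y * r (X (n + n0)) y) \<le> ?w y" for n
      proof (intro AE_I2)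
        fix y
        let ?h = "X (n + n0)"
        have h: "?h \<noteq> 0" "norm ?h < 1" using X n0 by auto
        show "norm (u y * r ?h y) \<le> ?w y"
        proof (cases "norm y \<le> max R 0 + norm x + 1")
          case True
          have "\<bar>\<eta> (y - (x + ?h)) - \<eta> (y - x) + ?h \<bullet> grad \<eta> (y - x)\<bar> \<le> 2 * K * norm ?h"
            using K(3)[of "y - (x + ?h)" "y - x"] K(2)[of ?h "y - x"] by (simp add: norm_minus_commute)
          then have "\<bar>r ?h y\<bar> \<le> 2 * K" using h by (simp add: r_def field_simps)
          from mult_left_mono[OF this, of "\<bar>u y\<bar>"] True show ?thesis by (simp add: abs_mult mult_ac)
        next
          case False
          have "R < norm (y - (x + ?h))" "R < norm (y - x)" "max R 0 + 1 < norm (y - x)"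
            using False h norm_triangle_ineq2[of y "x + ?h"] norm_triangle_ineq2[of y x]
              norm_triangle_ineq[of x ?h] by linarith+
          then show ?thesis using R R' by (simp add: r_def K)
        qed
      qed
      have "(\<lambda>n. r (X (n + n0)) y) \<longlonglongrightarrow> 0" for y
      proof -
        have "((\<lambda>h. norm (\<eta> ((y - x) + h) - \<eta> (y - x) - h \<bullet> grad \<eta> (y - x)) / norm h) \<longlongrightarrow> 0) (at 0)"
          using has_derivative_grad[OF test_function_differentiable[OF \<eta>]]
          unfolding has_derivative_at by blast
        moreover have "filterlim (\<lambda>n. - X (n + n0)) (at 0) sequentially"
          using X LIMSEQ_ignore_initial_segment[OF X(2), of n0] tendsto_minus
          by (auto simp: filterlim_at) force
        ultimately have "(\<lambda>n. norm (\<eta> ((y - x) + - X (n + n0)) - \<eta> (y - x) - (- X (n + n0)) \<bullet> grad \<eta> (y - x))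
            / norm (- X (n + n0))) \<longlonglongrightarrow> 0"
          by (rule filterlim_compose)
        then have "(\<lambda>n. \<bar>r (X (n + n0)) y\<bar>) \<longlonglongrightarrow> 0"
          by (simp add: r_def algebra_simps)
        then show ?thesis by (simp add: tendsto_rabs_zero_iff)
      qed
      then show "AE y in lborel. (\<lambda>n. u y * r (X (n + n0)) y) \<longlonglongrightarrow> 0"
        by (intro AE_I2 tendsto_mult_right_zero)
    qed simp
    then have "(\<lambda>n. \<integral>y. u y * r (X (n + n0)) y \<partial>lborel) \<longlonglongrightarrow> 0" by simp
    from LIMSEQ_offset[OF this]
    show "((\<lambda>h. \<integral>y. u y * r h y \<partial>lborel) \<circ> X) \<longlonglongrightarrow> 0" by (simp add: o_def)
  qed
  have "(corr u \<eta> has_derivative D) (at x)"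
    unfolding has_derivative_at
  proof
    show "bounded_linear D" unfolding D_def by (rule bounded_linear_inner_left)
    show "((\<lambda>h. norm (corr u \<eta> (x + h) - corr u \<eta> x - D h) / norm h) \<longlongrightarrow> 0) (at 0)"
      using tendsto_norm_zero[OF lim] unfolding eq[symmetric] by (simp add: norm_divide)
  qed
  then show ?thesis by (simp add: D_def[abs_def])
qed

lemma partial_deriv_corr:
  assumes "loc_integrable u" "\<eta> \<in> test_functions" "b \<in> Basis"
  shows "partial_deriv b (corr u \<eta>) x = - corr u (partial_deriv b \<eta>) x"
  using assms(3)
  by (simp add: partial_deriv_eq[OF corr_has_derivative[OF assms(1,2)]] inner_sum_right inner_Basis
      if_distrib cong: if_cong)

text \<open>All derivatives fall on the kernel, and a partial derivative of a test function is again
  a test function; hence the induction over arbitrary \<eta>.\<close>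

lemma C_k_corr:
  assumes "loc_integrable u" "\<eta> \<in> test_functions"
  shows "C_k k (corr u \<eta>)"
  using assms(2)
proof (induction k arbitrary: \<eta>)
  case 0
  have "isCont (corr u \<eta>) x" for x
    using corr_has_derivative[OF assms(1) 0] has_derivative_continuous by blast
  then show ?case by (simp add: continuous_at_imp_continuous_on)
next
  case (Suc k)
  have "C_k k (partial_deriv b (corr u \<eta>))" if "b \<in> Basis" for b
  proof -
    have "partial_deriv b (corr u \<eta>) = (\<lambda>x. - 1 * corr u (partial_deriv b \<eta>) x)"
      using partial_deriv_corr[OF assms(1) Suc.prems that] by auto
    moreover have "C_k k (\<lambda>x. - 1 * corr u (partial_deriv b \<eta>) x)"
      by (intro C_k_mult[OF C_k_const] Suc.IH partial_deriv_test_function Suc.prems that)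
    ultimately show ?thesis by simp
  qed
  then show ?case
    using corr_has_derivative[OF assms(1) Suc.prems] by (auto simp: differentiable_def)
qed

lemma corr_alt:
  assumes "u \<in> borel_measurable borel" "\<eta> \<in> borel_measurable borel"
  shows "corr u \<eta> x = (\<integral>y. u (x + y) * \<eta> y \<partial>lborel)"
proof -
  have "corr u \<eta> x = (\<integral>y. u (x + y) * \<eta> (x + y - x) \<partial>lborel)"
    unfolding corr_def
    by (intro integral_lborel_translate[symmetric] borel_measurable_times assms(1)
        measurable_compose[OF _ assms(2)]) simp
  then show ?thesis by simp
qed

section \<open>Averages and translations in L^p\<close>

text \<open>Either a is at most \<tau>, or a^(p-1) exceeds \<tau>^(p-1). With the free parameter
  \<tau> this does the work of Hoelder's inequality below: a small multiple of the weight plus a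
  large multiple of the p-th power.\<close>

lemma powr_Young:
  fixes a \<tau> p :: real
  assumes "a \<ge> 0" "\<tau> > 0" "p \<ge> 1"
  shows "a \<le> \<tau> + \<tau> powr (1 - p) * a powr p"
proof (cases "a \<le> \<tau>")
  case False
  then have "\<tau> powr (p - 1) \<le> a powr (p - 1)" using assms by (intro powr_mono2) auto
  then have "\<tau> powr (1 - p) * \<tau> powr (p - 1) * a \<le> \<tau> powr (1 - p) * a powr (p - 1) * a"
    using assms by (intro mult_right_mono mult_left_mono) auto
  moreover have "a powr (p - 1) * a = a powr p"
    using False assms powr_add[of a "p - 1" 1] by simp
  moreover have "\<tau> powr (1 - p) * \<tau> powr (p - 1) = 1"
    using assms by (simp flip: powr_add)
  ultimately show ?thesis using assms by (simp add: mult.assoc)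
qed (use assms in \<open>simp add: add_increasing2\<close>)

lemma Lp_loc_integrable:
  fixes f :: "'a::euclidean_space \<Rightarrow> real"
  assumes "f \<in> borel_measurable borel" "integrable lborel (\<lambda>x. \<bar>f x\<bar> powr p)" "p \<ge> 1"
  shows "loc_integrable f"
  unfolding loc_integrable_def set_integrable_def
proof (intro conjI allI assms(1))
  fix R
  show "integrable lborel (\<lambda>x. indicat_real (cball 0 R) x *\<^sub>R f x)"
  proof (rule Bochner_Integration.integrable_bound)
    have "integrable lborel (indicat_real (cball (0::'a) R))"
      using emeasure_bounded_finite[of "cball (0::'a) R"]
      by (simp add: integrable_indicator_iff less_top)
    then show "integrable lborel (\<lambda>x. indicat_real (cball 0 R) x + \<bar>f x\<bar> powr p)"
      using assms by simp
    show "AE x in lborel. norm (indicat_real (cball 0 R) x *\<^sub>R f x)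
        \<le> norm (indicat_real (cball 0 R) x + \<bar>f x\<bar> powr p)"
      using powr_Young[of "\<bar>f _\<bar>" 1 p] assms(3) by (auto simp: indicator_def)
  qed (use assms(1) in \<open>auto intro!: borel_measurable_times borel_measurable_indicator borel_closed\<close>)
qed

text \<open>This is what gives truncated mollifications compact support. The kernel centred at a
  distant x only sees points y outside a large ball; there |f| is split by \<open>powr_Young\<close>
  into a small constant and a multiple of |f|^p, whose tail integral is small.\<close>

lemma corr_vanishes_at_infinity:
  fixes f :: "'a::euclidean_space \<Rightarrow> real"
  assumes f: "f \<in> borel_measurable borel" "integrable lborel (\<lambda>x. \<bar>f x\<bar> powr p)" "p \<ge> 1"
    and \<eta>: "\<eta> \<in> test_functions" and e: "e > 0"
  obtains R where "\<And>x. R < norm x \<Longrightarrow> \<bar>corr f \<eta> x\<bar> < e"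
proof -
  obtain B where B: "B > 0" "\<And>x. \<bar>\<eta> x\<bar> \<le> B" using test_function_bounded[OF \<eta>] by blast
  obtain S where S: "\<And>x. S < norm x \<Longrightarrow> \<eta> x = 0" using \<eta> by (auto simp: test_functions_iff)
  define I where "I = (\<integral>y. \<bar>\<eta> y\<bar> \<partial>lborel)"
  have I0: "I \<ge> 0" unfolding I_def by simp
  \<comment> \<open>Makes \<tau> * I at most e/2; I + 1 instead of I covers the zero kernel.\<close>
  define \<tau> where "\<tau> = e / (2 * (I + 1))"
  have \<tau>: "\<tau> > 0" using I0 e by (simp add: \<tau>_def)
  have "(\<lambda>n. \<integral>y. indicator {y. real n < norm y} y * \<bar>f y\<bar> powr p \<partial>lborel) \<longlonglongrightarrow> (\<integral>y. 0 \<partial>(lborel::'a measure))"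
  proof (rule integral_dominated_convergence[OF _ _ f(2)])
    show "AE y in lborel. (\<lambda>n. indicator {y. real n < norm y} y * \<bar>f y\<bar> powr p) \<longlonglongrightarrow> 0"
    proof (intro AE_I2)
      fix y :: 'a
      obtain m where m: "norm y \<le> real m" using real_arch_simple by blast
      show "(\<lambda>n. indicator {y. real n < norm y} y * \<bar>f y\<bar> powr p) \<longlonglongrightarrow> 0"
        by (rule tendsto_eventually, rule eventually_sequentiallyI[of m]) (use m in auto)
    qed
  qed (use f in \<open>auto simp: indicator_def\<close>)
  moreover have "(\<integral>y. 0 \<partial>(lborel::'a measure)) < e / (2 * (\<tau> powr (1 - p) * B))"
    using e B \<tau> by simp
  ultimately have "\<forall>\<^sub>F n in sequentially. (\<integral>y. indicator {y. real n < norm y} y * \<bar>f y\<bar> powr p \<partial>lborel)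
      < e / (2 * (\<tau> powr (1 - p) * B))"
    by (rule order_tendstoD(2))
  then obtain n where n: "(\<integral>y. indicator {y. real n < norm y} y * \<bar>f y\<bar> powr p \<partial>lborel)
      < e / (2 * (\<tau> powr (1 - p) * B))"
    using eventually_happens by fastforce
  have "\<bar>corr f \<eta> x\<bar> < e" if x: "S + real n < norm x" for x
  proof -
    have \<eta>': "integrable lborel (\<lambda>y. \<bar>\<eta> (y - x)\<bar>)"
      using test_function_integrable[OF test_function_translate(1)[OF \<eta>]] by simp
    have if': "integrable lborel (\<lambda>y. indicator {y. real n < norm y} y * \<bar>f y\<bar> powr p)"
      by (rule Bochner_Integration.integrable_bound[OF f(2)]) (use f(1) in \<open>auto simp: indicator_def\<close>)
    have "\<bar>corr f \<eta> x\<bar> \<le> (\<integral>y. \<bar>f y * \<eta> (y - x)\<bar> \<partial>lborel)"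
      unfolding corr_def by (rule integral_abs_bound)
    also have "\<dots> \<le> (\<integral>y. \<tau> * \<bar>\<eta> (y - x)\<bar>
        + (\<tau> powr (1 - p) * B) * (indicator {y. real n < norm y} y * \<bar>f y\<bar> powr p) \<partial>lborel)"
    proof (rule integral_mono)
      show "integrable lborel (\<lambda>y. \<bar>f y * \<eta> (y - x)\<bar>)"
        by (intro integrable_abs integrable_corr Lp_loc_integrable[OF f] \<eta>)
      show "integrable lborel (\<lambda>y. \<tau> * \<bar>\<eta> (y - x)\<bar>
        + (\<tau> powr (1 - p) * B) * (indicator {y. real n < norm y} y * \<bar>f y\<bar> powr p))"
        using \<eta>' if' by simp
      fix y
      show "\<bar>f y * \<eta> (y - x)\<bar> \<le> \<tau> * \<bar>\<eta> (y - x)\<bar>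
        + (\<tau> powr (1 - p) * B) * (indicator {y. real n < norm y} y * \<bar>f y\<bar> powr p)"
      proof (cases "S < norm (y - x)")
        case True
        then show ?thesis using S B \<tau> by simp
      next
        case False
        then have n: "real n < norm y" using x norm_triangle_ineq2[of x y] by (simp add: norm_minus_commute)
        have "\<bar>f y * \<eta> (y - x)\<bar> \<le> (\<tau> + \<tau> powr (1 - p) * \<bar>f y\<bar> powr p) * \<bar>\<eta> (y - x)\<bar>"
          unfolding abs_mult using \<tau> f by (intro mult_right_mono powr_Young) auto
        also have "\<dots> \<le> \<tau> * \<bar>\<eta> (y - x)\<bar> + \<tau> powr (1 - p) * \<bar>f y\<bar> powr p * B"
          unfolding distrib_right using B by (intro add_left_mono mult_left_mono) auto
        finally show ?thesis using n by (simp add: mult_ac)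
      qed
    qed
    also have "\<dots> = \<tau> * (\<integral>y. \<bar>\<eta> (y - x)\<bar> \<partial>lborel)
        + (\<tau> powr (1 - p) * B) * (\<integral>y. indicator {y. real n < norm y} y * \<bar>f y\<bar> powr p \<partial>lborel)"
      using \<eta>' if' by simp
    also have "(\<integral>y. \<bar>\<eta> (y - x)\<bar> \<partial>lborel) = I"
      using integral_lborel_translate[of "\<lambda>y. \<bar>\<eta> y\<bar>" "- x"] test_function_borel[OF \<eta>]
      by (simp add: I_def)
    also have "(\<tau> powr (1 - p) * B) * (\<integral>y. indicator {y. real n < norm y} y * \<bar>f y\<bar> powr p \<partial>lborel)
        < e / 2"
      using n B \<tau> by (simp add: field_simps)
    also have "\<tau> * I \<le> e / 2" using I0 e by (simp add: \<tau>_def field_simps)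
    finally show ?thesis by simp
  qed
  with that show thesis by blast
qed

lemma powr_add_le:
  fixes a b p :: real
  assumes "a \<ge> 0" "b \<ge> 0" "p \<ge> 0"
  shows "(a + b) powr p \<le> 2 powr p * (a powr p + b powr p)"
proof -
  have "(a + b) powr p \<le> (2 * max a b) powr p" using assms by (intro powr_mono2) auto
  also have "\<dots> = 2 powr p * max a b powr p" using assms by (simp add: powr_mult)
  also have "max a b powr p \<le> a powr p + b powr p" by (simp add: max_def)
  finally show ?thesis by simp
qed

text \<open>f is truncated in value and in space to \<open>T n\<close>. By the definition of
  \<open>measurable_on\<close>, \<open>T n\<close> is an a.e. limit of continuous functions, and
  dominated convergence turns this into closeness in L^p once these have a common bound and a common
  support.\<close>

lemma Lp_density:
  fixes f :: "'a::euclidean_space \<Rightarrow> real"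
  assumes f: "f \<in> borel_measurable borel" "integrable lborel (\<lambda>x. \<bar>f x\<bar> powr p)" and p: "p \<ge> 1"
    and e: "e > 0"
  obtains g R where "continuous_on UNIV g" "\<And>x. R < norm x \<Longrightarrow> g x = 0"
    "(\<integral>\<^sup>+x. ennreal (\<bar>f x - g x\<bar> powr p) \<partial>lborel) < ennreal e"
proof -
  define T where "T n x = (if norm x \<le> real n then max (- real n) (min (real n) (f x)) else 0)"
    for n :: nat and x :: 'a
  have Tm: "T n \<in> borel_measurable borel" for n
    unfolding T_def using f(1) by measurable
  have "(\<lambda>n. \<integral>x. \<bar>f x - T n x\<bar> powr p \<partial>lborel) \<longlonglongrightarrow> (\<integral>x. 0 \<partial>(lborel::'a measure))"
  proof (rule integral_dominated_convergence[OF _ _ f(2)])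
    show "AE x in lborel. (\<lambda>n. \<bar>f x - T n x\<bar> powr p) \<longlonglongrightarrow> 0"
    proof (intro AE_I2)
      fix x :: 'a
      obtain m where m: "max (norm x) \<bar>f x\<bar> \<le> real m" using real_arch_simple by blast
      show "(\<lambda>n. \<bar>f x - T n x\<bar> powr p) \<longlonglongrightarrow> 0"
        by (rule tendsto_eventually, rule eventually_sequentiallyI[of m]) (use m p in \<open>auto simp: T_def\<close>)
    qed
    show "AE x in lborel. norm (\<bar>f x - T n x\<bar> powr p) \<le> \<bar>f x\<bar> powr p" for n
      using p by (intro AE_I2) (auto simp: T_def intro!: powr_mono2)
  qed (use f(1) Tm in measurable)
  moreover have "(\<integral>x. 0 \<partial>(lborel::'a measure)) < e / (2 * 2 powr p)" using e by simp
  ultimately have "\<forall>\<^sub>F n in sequentially. (\<integral>x. \<bar>f x - T n x\<bar> powr p \<partial>lborel) < e / (2 * 2 powr p)"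
    by (rule order_tendstoD(2))
  then obtain n where n: "(\<integral>x. \<bar>f x - T n x\<bar> powr p \<partial>lborel) < e / (2 * 2 powr p)"
    using eventually_happens by fastforce
  have i1: "integrable lborel (\<lambda>x. \<bar>f x - T n x\<bar> powr p)"
    by (rule Bochner_Integration.integrable_bound[OF f(2)])
      (use f(1) Tm p in \<open>auto simp: T_def intro!: powr_mono2 AE_I2\<close>)
  have "T n \<in> borel_measurable (lebesgue_on UNIV)"
    using measurable_completion[of "T n" lborel borel] Tm[of n] by simp
  then have "T n measurable_on UNIV"
    by (subst measurable_on_iff_borel_measurable) auto
  then obtain N g where N: "negligible N" and g: "\<And>m. continuous_on UNIV (g m)"
    and lim: "\<And>x. x \<notin> N \<Longrightarrow> (\<lambda>m. g m x) \<longlonglongrightarrow> T n x"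
    unfolding measurable_on_def by auto
  \<comment> \<open>Clamping gives the common bound n, the continuous cutoff the common support.
    Neither affects the limit: \<open>T n\<close> has values in [-n, n] and vanishes for |x| > n,
    while the cutoff is 1 for |x| \<le> n.\<close>
  define G where "G m x = max (- real n) (min (real n) (g m x)) * max 0 (min 1 (real n + 1 - norm x))"
    for m x
  have Gc: "continuous_on UNIV (G m)" for m
    unfolding G_def by (intro continuous_intros g)
  have G0: "G m x = 0" if "real n + 1 < norm x" for m x
    using that by (simp add: G_def)
  have Gb: "\<bar>G m x\<bar> \<le> real n" for m x
  proof -
    have "\<bar>G m x\<bar> \<le> real n * 1" unfolding G_def abs_mult by (intro mult_mono) auto
    then show ?thesis by simp
  qed
  have AEN: "AE x in lborel. x \<notin> N"
    using AE_not_in[of N lebesgue] N by (simp add: negligible_iff_null_sets AE_completion_iff)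
  have dom: "\<bar>T n x - G m x\<bar> powr p \<le> (2 * real n) powr p * indicator (cball 0 (real n + 1)) x" for m x
    using G0[of x m] Gb[of m x] p
    by (cases "norm x \<le> real n + 1") (auto simp: T_def intro!: powr_mono2)
  have idom: "integrable lborel (\<lambda>x::'a. (2 * real n) powr p * indicator (cball 0 (real n + 1)) x)"
    using emeasure_bounded_finite[of "cball (0::'a) (real n + 1)"]
    by (intro integrable_mult_right) (simp add: integrable_indicator_iff less_top)
  have meas: "(\<lambda>x. \<bar>T n x - G m x\<bar> powr p) \<in> borel_measurable lborel" for m
    using Tm[of n] borel_measurable_continuous_onI[OF Gc[of m]] by measurable
  have "(\<lambda>m. \<integral>x. \<bar>T n x - G m x\<bar> powr p \<partial>lborel) \<longlonglongrightarrow> (\<integral>x. 0 \<partial>(lborel::'a measure))"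
  proof (rule integral_dominated_convergence[OF _ _ idom])
    show "AE x in lborel. (\<lambda>m. \<bar>T n x - G m x\<bar> powr p) \<longlonglongrightarrow> 0"
      using AEN
    proof eventually_elim
      case (elim x)
      have "(\<lambda>m. G m x) \<longlonglongrightarrow> max (- real n) (min (real n) (T n x)) * max 0 (min 1 (real n + 1 - norm x))"
        unfolding G_def using lim[OF elim] by (intro tendsto_intros)
      also have "max (- real n) (min (real n) (T n x)) * max 0 (min 1 (real n + 1 - norm x)) = T n x"
        by (auto simp: T_def)
      finally have "(\<lambda>m. \<bar>T n x - G m x\<bar> powr p) \<longlonglongrightarrow> \<bar>T n x - T n x\<bar> powr p"
        using p by (intro tendsto_powr' tendsto_intros) auto
      then show ?case by simp
    qed
  qed (use meas dom in \<open>auto intro!: AE_I2\<close>)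
  moreover have "(\<integral>x. 0 \<partial>(lborel::'a measure)) < e / (2 * 2 powr p)" using e by simp
  ultimately have "\<forall>\<^sub>F m in sequentially. (\<integral>x. \<bar>T n x - G m x\<bar> powr p \<partial>lborel) < e / (2 * 2 powr p)"
    by (rule order_tendstoD(2))
  then obtain m where m: "(\<integral>x. \<bar>T n x - G m x\<bar> powr p \<partial>lborel) < e / (2 * 2 powr p)"
    using eventually_happens by fastforce
  have i2: "integrable lborel (\<lambda>x. \<bar>T n x - G m x\<bar> powr p)"
    by (rule Bochner_Integration.integrable_bound[OF idom meas]) (use dom in \<open>auto intro!: AE_I2\<close>)
  have le: "\<bar>f x - G m x\<bar> powr p \<le> 2 powr p * (\<bar>f x - T n x\<bar> powr p + \<bar>T n x - G m x\<bar> powr p)" for x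
  proof -
    have "\<bar>f x - G m x\<bar> powr p \<le> (\<bar>f x - T n x\<bar> + \<bar>T n x - G m x\<bar>) powr p"
      using p by (intro powr_mono2) auto
    also have "\<dots> \<le> 2 powr p * (\<bar>f x - T n x\<bar> powr p + \<bar>T n x - G m x\<bar> powr p)"
      using p by (intro powr_add_le) auto
    finally show ?thesis .
  qed
  have "(\<integral>\<^sup>+x. ennreal (\<bar>f x - G m x\<bar> powr p) \<partial>lborel)
      \<le> (\<integral>\<^sup>+x. ennreal (2 powr p * (\<bar>f x - T n x\<bar> powr p + \<bar>T n x - G m x\<bar> powr p)) \<partial>lborel)"
    by (intro nn_integral_mono ennreal_leI le)
  also have "\<dots> = ennreal (\<integral>x. 2 powr p * (\<bar>f x - T n x\<bar> powr p + \<bar>T n x - G m x\<bar> powr p) \<partial>lborel)"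
    using i1 i2 by (intro nn_integral_eq_integral) (auto intro!: AE_I2)
  also have "\<dots> < ennreal e"
    using i1 i2 n m e by (intro ennreal_lessI) (auto simp: field_simps)
  finally show thesis using that[OF Gc[of m] G0[of _ m]] by blast
qed

text \<open>Replace f by a continuous g of compact support: the error of f - g is the same before
  and after the shift, and g moves little by uniform continuity on a ball.\<close>

lemma Lp_translation_continuous:
  fixes f :: "'a::euclidean_space \<Rightarrow> real"
  assumes f: "f \<in> borel_measurable borel" "integrable lborel (\<lambda>x. \<bar>f x\<bar> powr p)" and p: "p \<ge> 1"
    and e: "e > 0"
  obtains d where "d > 0"
    "\<And>h. norm h < d \<Longrightarrow> (\<integral>\<^sup>+x. ennreal (\<bar>f (x + h) - f x\<bar> powr p) \<partial>lborel) \<le> ennreal e"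
proof -
  \<comment> \<open>Applying \<open>powr_add_le\<close> twice weights the three errors by 2^p, 4^p
    and 4^p, in total at most 3 * 4^p * e1, which is below e.\<close>
  define e1 where "e1 = e / (4 * (2 powr p * 2 powr p))"
  have e1: "e1 > 0" using e by (simp add: e1_def)
  obtain g R where g: "continuous_on UNIV g" "\<And>x. R < norm x \<Longrightarrow> g x = 0"
    and fg: "(\<integral>\<^sup>+x. ennreal (\<bar>f x - g x\<bar> powr p) \<partial>lborel) < ennreal e1"
    using Lp_density[OF f p e1] by blast
  define V where "V = measure lborel (cball (0::'a) (\<bar>R\<bar> + 1))"
  have V0: "V \<ge> 0" by (simp add: V_def)
  \<comment> \<open>Shifts shorter than 1 change g only inside the ball of measure V, so s^p * V
    \<le> e1 is the requirement on s.\<close>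
  define s where "s = (e1 / (V + 1)) powr (1 / p)"
  have s: "s > 0" using e1 V0 by (simp add: s_def)
  have sp: "s powr p = e1 / (V + 1)" using e1 V0 p by (simp add: s_def powr_powr)
  have "uniformly_continuous_on (cball 0 (\<bar>R\<bar> + 2)) g"
    by (intro compact_uniformly_continuous continuous_on_subset[OF g(1)]) auto
  then obtain d where d: "d > 0" "\<And>x y. x \<in> cball 0 (\<bar>R\<bar> + 2) \<Longrightarrow> y \<in> cball 0 (\<bar>R\<bar> + 2) \<Longrightarrow>
      norm (y - x) < d \<Longrightarrow> \<bar>g y - g x\<bar> < s"
    unfolding uniformly_continuous_on_def dist_real_def dist_norm using s by metis
  have [measurable]: "f \<in> borel_measurable borel" "g \<in> borel_measurable borel"
    using f(1) borel_measurable_continuous_onI[OF g(1)] by auto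
  have main: "(\<integral>\<^sup>+x. ennreal (\<bar>f (x + h) - f x\<bar> powr p) \<partial>lborel) \<le> ennreal e"
    if h: "norm h < min d 1" for h
  proof -
    have gd: "\<bar>g (x + h) - g x\<bar> powr p \<le> s powr p * indicator (cball 0 (\<bar>R\<bar> + 1)) x" for x
    proof (cases "norm x \<le> \<bar>R\<bar> + 1")
      case True
      then have "\<bar>g (x + h) - g x\<bar> < s"
        using h norm_triangle_ineq[of x h] by (intro d(2)) auto
      then show ?thesis using True p by (auto intro!: powr_mono2)
    next
      case False
      then have "g x = 0" "g (x + h) = 0"
        using h norm_triangle_ineq2[of x "- h"] by (auto intro!: g(2))
      then show ?thesis by simp
    qed
    have "(\<integral>\<^sup>+x. ennreal (\<bar>g (x + h) - g x\<bar> powr p) \<partial>lborel)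
        \<le> (\<integral>\<^sup>+x. ennreal (s powr p) * indicator (cball (0::'a) (\<bar>R\<bar> + 1)) x \<partial>lborel)"
    proof (rule nn_integral_mono)
      fix x
      show "ennreal (\<bar>g (x + h) - g x\<bar> powr p)
          \<le> ennreal (s powr p) * indicator (cball 0 (\<bar>R\<bar> + 1)) x"
        using ennreal_leI[OF gd[of x]] by (cases "x \<in> cball 0 (\<bar>R\<bar> + 1)") (auto simp: indicator_def)
    qed
    also have "\<dots> = ennreal (s powr p * V)"
      using emeasure_bounded_finite[of "cball (0::'a) (\<bar>R\<bar> + 1)"]
      by (subst nn_integral_cmult_indicator) (auto simp: V_def ennreal_mult emeasure_eq_ennreal_measure less_top)
    also have "\<dots> \<le> ennreal e1"
      using V0 e1 by (intro ennreal_leI) (simp add: sp field_simps)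
    finally have G: "(\<integral>\<^sup>+x. ennreal (\<bar>g (x + h) - g x\<bar> powr p) \<partial>lborel) \<le> ennreal e1" .
    have sh: "(\<integral>\<^sup>+x. ennreal (\<bar>f (x + h) - g (x + h)\<bar> powr p) \<partial>lborel)
        = (\<integral>\<^sup>+x. ennreal (\<bar>f x - g x\<bar> powr p) \<partial>lborel)"
      using nn_integral_lborel_translate[of "\<lambda>x. ennreal (\<bar>f x - g x\<bar> powr p)" h]
      by (simp add: add.commute)
    have "(\<integral>\<^sup>+x. ennreal (\<bar>f (x + h) - f x\<bar> powr p) \<partial>lborel)
      \<le> (\<integral>\<^sup>+x. ennreal (2 powr p) * ennreal (\<bar>f (x + h) - g (x + h)\<bar> powr p)
          + ennreal (2 powr p * 2 powr p) * (ennreal (\<bar>g (x + h) - g x\<bar> powr p)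
          + ennreal (\<bar>f x - g x\<bar> powr p)) \<partial>lborel)"
    proof (intro nn_integral_mono)
      fix x
      have "\<bar>f (x + h) - f x\<bar> powr p
          \<le> (\<bar>f (x + h) - g (x + h)\<bar> + (\<bar>g (x + h) - g x\<bar> + \<bar>f x - g x\<bar>)) powr p"
        using p by (intro powr_mono2) auto
      also have "\<dots> \<le> 2 powr p * (\<bar>f (x + h) - g (x + h)\<bar> powr p + (\<bar>g (x + h) - g x\<bar> + \<bar>f x - g x\<bar>) powr p)"
        using p by (intro powr_add_le) auto
      also have "\<dots> \<le> 2 powr p * (\<bar>f (x + h) - g (x + h)\<bar> powr p
          + 2 powr p * (\<bar>g (x + h) - g x\<bar> powr p + \<bar>f x - g x\<bar> powr p))"
        using p by (intro mult_left_mono add_left_mono powr_add_le) auto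
      finally have "ennreal (\<bar>f (x + h) - f x\<bar> powr p) \<le> ennreal (2 powr p * \<bar>f (x + h) - g (x + h)\<bar> powr p
          + (2 powr p * 2 powr p) * (\<bar>g (x + h) - g x\<bar> powr p + \<bar>f x - g x\<bar> powr p))"
        by (intro ennreal_leI) (simp add: algebra_simps)
      then show "ennreal (\<bar>f (x + h) - f x\<bar> powr p)
          \<le> ennreal (2 powr p) * ennreal (\<bar>f (x + h) - g (x + h)\<bar> powr p)
          + ennreal (2 powr p * 2 powr p) * (ennreal (\<bar>g (x + h) - g x\<bar> powr p)
          + ennreal (\<bar>f x - g x\<bar> powr p))"
        by (simp add: ennreal_mult ennreal_plus del: ennreal_plus[symmetric])
    qed
    also have "\<dots> = ennreal (2 powr p) * (\<integral>\<^sup>+x. ennreal (\<bar>f (x + h) - g (x + h)\<bar> powr p) \<partial>lborel)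
          + ennreal (2 powr p * 2 powr p) * ((\<integral>\<^sup>+x. ennreal (\<bar>g (x + h) - g x\<bar> powr p) \<partial>lborel)
          + (\<integral>\<^sup>+x. ennreal (\<bar>f x - g x\<bar> powr p) \<partial>lborel))"
      by (simp add: nn_integral_add nn_integral_cmult)
    also have "\<dots> \<le> ennreal (2 powr p) * ennreal e1
          + ennreal (2 powr p * 2 powr p) * (ennreal e1 + ennreal e1)"
      unfolding sh using fg G by (intro add_mono mult_left_mono) (auto intro: less_imp_le)
    also have "\<dots> = ennreal (2 powr p * e1 + 2 powr p * 2 powr p * (e1 + e1))"
      using e1 by (simp flip: ennreal_mult ennreal_plus)
    also have "\<dots> \<le> ennreal e"
    proof (rule ennreal_leI)
      have "2 powr p * e1 \<le> 2 powr p * 2 powr p * e1"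
        using e1 p by (intro mult_right_mono) (auto simp: ge_one_powr_ge_zero)
      then show "2 powr p * e1 + 2 powr p * 2 powr p * (e1 + e1) \<le> e"
        using e by (simp add: e1_def field_simps)
    qed
    finally show ?thesis .
  qed
  show thesis by (rule that[of "min d 1"]) (use d main in auto)
qed

text \<open>Jensen's inequality up to the factor 2^p, obtained by integrating
  \<open>powr_Young\<close> against the weight and then choosing \<tau>. With a nonnegative integral
  on the right, the case of infinite right-hand side is included.\<close>

lemma weighted_mean_powr:
  fixes a \<eta> :: "'b \<Rightarrow> real"
  assumes a: "a \<in> borel_measurable M" "\<And>y. 0 \<le> a y"
    and \<eta>: "integrable M \<eta>" "\<And>y. 0 \<le> \<eta> y" "integral\<^sup>L M \<eta> = 1" and p: "p \<ge> 1"
  shows "ennreal ((\<integral>y. a y * \<eta> y \<partial>M) powr p) \<le> ennreal (2 powr p) * (\<integral>\<^sup>+y. ennreal (a y powr p * \<eta> y) \<partial>M)"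
proof (cases "integrable M (\<lambda>y. a y powr p * \<eta> y)")
  case False
  have "(\<integral>\<^sup>+y. ennreal (a y powr p * \<eta> y) \<partial>M) = \<infinity>"
  proof (rule ccontr)
    assume "(\<integral>\<^sup>+y. ennreal (a y powr p * \<eta> y) \<partial>M) \<noteq> \<infinity>"
    then have "integrable M (\<lambda>y. a y powr p * \<eta> y)"
      using a \<eta> by (intro integrableI_nonneg) (auto simp: less_top)
    with False show False by simp
  qed
  then show ?thesis by (simp add: ennreal_mult_top)
next
  case True
  define I where "I = (\<integral>y. a y powr p * \<eta> y \<partial>M)"
  define J where "J = (\<integral>y. a y * \<eta> y \<partial>M)"
  have I0: "I \<ge> 0" unfolding I_def using \<eta> by (intro integral_nonneg_AE) (auto intro!: AE_I2)
  have J0: "J \<ge> 0" unfolding J_def using a \<eta> by (intro integral_nonneg_AE) (auto intro!: AE_I2)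
  have pw: "a y * \<eta> y \<le> \<tau> * \<eta> y + \<tau> powr (1 - p) * (a y powr p * \<eta> y)" if "\<tau> > 0" for \<tau> y
    using mult_right_mono[OF powr_Young[OF a(2)[of y] that p] \<eta>(2)[of y]] by (simp add: algebra_simps)
  have int: "integrable M (\<lambda>y. \<tau> * \<eta> y + \<tau> powr (1 - p) * (a y powr p * \<eta> y))" for \<tau>
    using True \<eta> by simp
  have ai: "integrable M (\<lambda>y. a y * \<eta> y)"
    by (rule Bochner_Integration.integrable_bound[OF int[of 1]])
      (use a \<eta> pw[of 1] in \<open>auto intro!: AE_I2 simp: abs_of_nonneg\<close>)
  have J: "J \<le> \<tau> + \<tau> powr (1 - p) * I" if "\<tau> > 0" for \<tau>
  proof -
    have "J \<le> (\<integral>y. \<tau> * \<eta> y + \<tau> powr (1 - p) * (a y powr p * \<eta> y) \<partial>M)"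
      unfolding J_def by (intro integral_mono ai int pw that)
    also have "\<dots> = \<tau> + \<tau> powr (1 - p) * I" using True \<eta> by (simp add: I_def)
    finally show ?thesis .
  qed
  have "J powr p \<le> 2 powr p * I"
  proof (cases "I = 0")
    case True
    then have "J \<le> \<tau>" if "\<tau> > 0" for \<tau> using J[OF that] by simp
    then have "J = 0" using J0 field_le_epsilon[of J 0] by simp
    then show ?thesis using I0 by simp
  next
    case False
    then have I: "I > 0" using I0 by simp
    \<comment> \<open>This value makes the two terms of \<open>J\<close> equal, each being \<tau>,
      so that J \<le> 2 \<tau>.\<close>
    define \<tau> where "\<tau> = I powr (1 / p)"
    have \<tau>: "\<tau> > 0" "\<tau> powr p = I" using I p by (auto simp: \<tau>_def powr_powr)
    have "\<tau> powr (1 - p) * I = \<tau> powr (1 - p) * \<tau> powr p" using \<tau> by simp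
    also have "\<dots> = \<tau>" using \<tau>(1) by (simp flip: powr_add)
    finally have "J \<le> 2 * \<tau>" using J[OF \<tau>(1)] by simp
    then have "J powr p \<le> (2 * \<tau>) powr p" using J0 p by (intro powr_mono2) auto
    then show ?thesis using \<tau> by (simp add: powr_mult)
  qed
  moreover have "(\<integral>\<^sup>+y. ennreal (a y powr p * \<eta> y) \<partial>M) = ennreal I"
    unfolding I_def using True \<eta> by (intro nn_integral_eq_integral) (auto intro!: AE_I2)
  ultimately show ?thesis
    using I0 by (simp add: J_def ennreal_leI flip: ennreal_mult)
qed

text \<open>corr f \<eta> - f is the \<eta>-weighted mean of the differences f(x + y) - f(x).
  \<open>weighted_mean_powr\<close> and Fubini reduce its norm to those of single translations with
  |y| < d.\<close>

lemma corr_Lp_close: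
  fixes f :: "'a::euclidean_space \<Rightarrow> real"
  assumes f: "loc_integrable f" and p: "p \<ge> 1"
    and \<eta>: "\<eta> \<in> test_functions" "\<And>x. 0 \<le> \<eta> x" "\<And>x. d \<le> norm x \<Longrightarrow> \<eta> x = 0" "integral\<^sup>L lborel \<eta> = 1"
    and e: "e \<ge> 0" "\<And>h. norm h < d \<Longrightarrow> (\<integral>\<^sup>+x. ennreal (\<bar>f (x + h) - f x\<bar> powr p) \<partial>lborel) \<le> ennreal e"
  shows "(\<integral>\<^sup>+x. ennreal (\<bar>corr f \<eta> x - f x\<bar> powr p) \<partial>lborel) \<le> ennreal (2 powr p * e)"
proof -
  note [measurable] = loc_integrableD[OF f] test_function_borel[OF \<eta>(1)]
  note i\<eta> = test_function_integrable[OF \<eta>(1)]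
  have pt: "ennreal (\<bar>corr f \<eta> x - f x\<bar> powr p)
      \<le> ennreal (2 powr p) * (\<integral>\<^sup>+y. ennreal (\<bar>f (x + y) - f x\<bar> powr p * \<eta> y) \<partial>lborel)" for x
  proof -
    have "integrable lborel (\<lambda>y. f (x + y) * \<eta> y)"
    proof -
      have "integrable lborel (\<lambda>y. f y * \<eta> (y - x))" by (rule integrable_corr[OF f \<eta>(1)])
      then have "integrable (distr lborel borel ((+) x)) (\<lambda>y. f y * \<eta> (y - x))"
        by (simp add: lborel_distr_plus)
      then show ?thesis by (subst (asm) integrable_distr_eq) auto
    qed
    then have "corr f \<eta> x - f x = (\<integral>y. (f (x + y) - f x) * \<eta> y \<partial>lborel)"
      using i\<eta> by (simp add: corr_alt left_diff_distrib \<eta>(4))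
    also have "\<bar>\<dots>\<bar> \<le> (\<integral>y. \<bar>f (x + y) - f x\<bar> * \<eta> y \<partial>lborel)"
      using integral_abs_bound[of lborel "\<lambda>y. (f (x + y) - f x) * \<eta> y"] \<eta>(2) by (simp add: abs_mult)
    finally have "ennreal (\<bar>corr f \<eta> x - f x\<bar> powr p) \<le> ennreal ((\<integral>y. \<bar>f (x + y) - f x\<bar> * \<eta> y \<partial>lborel) powr p)"
      using p by (intro ennreal_leI powr_mono2) auto
    also have "\<dots> \<le> ennreal (2 powr p) * (\<integral>\<^sup>+y. ennreal (\<bar>f (x + y) - f x\<bar> powr p * \<eta> y) \<partial>lborel)"
      by (rule weighted_mean_powr) (use i\<eta> \<eta> p in auto)
    finally show ?thesis .
  qed
  have "(\<integral>\<^sup>+x. ennreal (\<bar>corr f \<eta> x - f x\<bar> powr p) \<partial>lborel)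
      \<le> (\<integral>\<^sup>+x. ennreal (2 powr p) * (\<integral>\<^sup>+y. ennreal (\<bar>f (x + y) - f x\<bar> powr p * \<eta> y) \<partial>lborel) \<partial>lborel)"
    by (intro nn_integral_mono pt)
  also have "\<dots> = ennreal (2 powr p) * (\<integral>\<^sup>+x. (\<integral>\<^sup>+y. ennreal (\<bar>f (x + y) - f x\<bar> powr p * \<eta> y) \<partial>lborel) \<partial>lborel)"
    by (rule nn_integral_cmult) measurable
  also have "(\<integral>\<^sup>+x. (\<integral>\<^sup>+y. ennreal (\<bar>f (x + y) - f x\<bar> powr p * \<eta> y) \<partial>lborel) \<partial>lborel)
      = (\<integral>\<^sup>+y. (\<integral>\<^sup>+x. ennreal (\<bar>f (x + y) - f x\<bar> powr p * \<eta> y) \<partial>lborel) \<partial>lborel)"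
    by (rule lborel_pair.Fubini') measurable
  also have "\<dots> \<le> (\<integral>\<^sup>+y. ennreal e * ennreal (\<eta> y) \<partial>lborel)"
  proof (rule nn_integral_mono)
    fix y
    have "(\<integral>\<^sup>+x. ennreal (\<bar>f (x + y) - f x\<bar> powr p * \<eta> y) \<partial>lborel)
        = (\<integral>\<^sup>+x. ennreal (\<bar>f (x + y) - f x\<bar> powr p) \<partial>lborel) * ennreal (\<eta> y)"
      using \<eta>(2) by (subst nn_integral_multc[symmetric]) (auto simp: ennreal_mult)
    also have "\<dots> \<le> ennreal e * ennreal (\<eta> y)"
      using e(2)[of y] \<eta>(3)[of y] by (cases "norm y < d") (auto intro: mult_right_mono)
    finally show "(\<integral>\<^sup>+x. ennreal (\<bar>f (x + y) - f x\<bar> powr p * \<eta> y) \<partial>lborel) \<le> ennreal e * ennreal (\<eta> y)" .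
  qed
  also have "\<dots> = ennreal e"
    using \<eta> nn_integral_eq_integral[OF i\<eta>] by (simp add: nn_integral_cmult)
  finally show ?thesis
    using e(1) by (simp add: ennreal_mult mult_left_mono)
qed

section \<open>Smooth approximation of Sobolev functions\<close>

text \<open>Borel representatives of a Sobolev function and of its weak gradient. Since G enters
  only through integration by parts, the choice made by \<open>weak_grad\<close> is left behind; p >
  1 and the sign of u enter only with the subsolution inequality.\<close>

locale sobolev_pair =
  fixes p :: real and u :: "'a::euclidean_space \<Rightarrow> real" and G :: "'a \<Rightarrow> 'a"
  assumes p: "1 \<le> p"
    and u_borel [measurable]: "u \<in> borel_measurable borel"
    and G_borel [measurable]: "G \<in> borel_measurable borel"
    and u_Lp: "integrable lborel (\<lambda>x. \<bar>u x\<bar> powr p)"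
    and G_Lp: "integrable lborel (\<lambda>x. norm (G x) powr p)"
    and weak_gradient: "\<And>v b. v \<in> test_functions \<Longrightarrow> b \<in> Basis \<Longrightarrow>
      (\<integral>x. u x * partial_deriv b v x \<partial>lborel) = - (\<integral>x. (G x \<bullet> b) * v x \<partial>lborel)"
begin

lemma u_loc: "loc_integrable u"
  by (rule Lp_loc_integrable[OF u_borel u_Lp p])

lemma G_component_Lp:
  assumes "b \<in> Basis"
  shows "integrable lborel (\<lambda>x. \<bar>G x \<bullet> b\<bar> powr p)"
proof (rule Bochner_Integration.integrable_bound[OF G_Lp])
  show "AE x in lborel. norm (\<bar>G x \<bullet> b\<bar> powr p) \<le> norm (norm (G x) powr p)"
    using p Basis_le_norm[OF assms] by (auto intro!: AE_I2 powr_mono2)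
qed measurable

lemma G_component_loc: "b \<in> Basis \<Longrightarrow> loc_integrable (\<lambda>x. G x \<bullet> b)"
  by (rule Lp_loc_integrable[OF _ G_component_Lp p]) auto

text \<open>Mollification commutes with the weak gradient: the translated kernel is a test function,
  and the sign from differentiating in x cancels the one from integrating by parts.\<close>

lemma grad_corr:
  assumes "\<eta> \<in> test_functions" "b \<in> Basis"
  shows "grad (corr u \<eta>) x \<bullet> b = corr (\<lambda>x. G x \<bullet> b) \<eta> x"
proof -
  have "grad (corr u \<eta>) x \<bullet> b = - (\<integral>y. u y * partial_deriv b (\<lambda>y. \<eta> (y - x)) y \<partial>lborel)"
    using assms u_loc
    by (simp add: grad_inner_Basis partial_deriv_corr test_function_translate(2)) (simp add: corr_def)
  also have "\<dots> = corr (\<lambda>x. G x \<bullet> b) \<eta> x"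
    using assms by (subst weak_gradient) (auto intro: test_function_translate(1) simp: corr_def)
  finally show ?thesis .
qed

lemma mollification_close:
  assumes "e > 0"
  obtains \<eta> where "\<eta> \<in> test_functions"
    "(\<integral>\<^sup>+x. ennreal (\<bar>corr u \<eta> x - u x\<bar> powr p) \<partial>lborel) \<le> ennreal e"
    "\<And>b. b \<in> Basis \<Longrightarrow> (\<integral>\<^sup>+x. ennreal (\<bar>(grad (corr u \<eta>) x - G x) \<bullet> b\<bar> powr p) \<partial>lborel) \<le> ennreal e"
proof -
  define e' where "e' = e / 2 powr p"
  have e': "e' > 0" "2 powr p * e' = e" using assms by (auto simp: e'_def)
  obtain d0 where d0: "d0 > 0"
    "\<And>h. norm h < d0 \<Longrightarrow> (\<integral>\<^sup>+x. ennreal (\<bar>u (x + h) - u x\<bar> powr p) \<partial>lborel) \<le> ennreal e'"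
    using Lp_translation_continuous[OF u_borel u_Lp p e'(1)] by blast
  have "\<exists>d>0. \<forall>h. norm h < d \<longrightarrow>
      (\<integral>\<^sup>+x. ennreal (\<bar>G (x + h) \<bullet> b - G x \<bullet> b\<bar> powr p) \<partial>lborel) \<le> ennreal e'" if b: "b \<in> Basis" for b
  proof -
    have "(\<lambda>x. G x \<bullet> b) \<in> borel_measurable borel" by simp
    from Lp_translation_continuous[OF this G_component_Lp[OF b] p e'(1)]
    obtain d where "d > 0" "\<And>h. norm h < d \<Longrightarrow>
        (\<integral>\<^sup>+x. ennreal (\<bar>G (x + h) \<bullet> b - G x \<bullet> b\<bar> powr p) \<partial>lborel) \<le> ennreal e'"
      by blast
    then show ?thesis by blast
  qed
  then have "\<forall>b\<in>Basis. \<exists>d>0. \<forall>h. norm h < d \<longrightarrow>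
      (\<integral>\<^sup>+x. ennreal (\<bar>G (x + h) \<bullet> b - G x \<bullet> b\<bar> powr p) \<partial>lborel) \<le> ennreal e'"
    by (rule ballI)
  from bchoice[OF this] obtain d where all: "\<forall>b\<in>Basis. 0 < d b \<and> (\<forall>h. norm h < d b \<longrightarrow>
      (\<integral>\<^sup>+x. ennreal (\<bar>G (x + h) \<bullet> b - G x \<bullet> b\<bar> powr p) \<partial>lborel) \<le> ennreal e')"
    by (elim exE)
  have d: "b \<in> Basis \<Longrightarrow> d b > 0"
    "b \<in> Basis \<Longrightarrow> norm h < d b \<Longrightarrow>
      (\<integral>\<^sup>+x. ennreal (\<bar>G (x + h) \<bullet> b - G x \<bullet> b\<bar> powr p) \<partial>lborel) \<le> ennreal e'" for b h
    using all by blast+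
  \<comment> \<open>The smallest of finitely many moduli, so that one kernel serves u and every
    component of G.\<close>
  define \<delta> where "\<delta> = Min (insert d0 (d ` Basis))"
  have \<delta>: "\<delta> > 0" "\<delta> \<le> d0"
    using d0 d by (auto simp: \<delta>_def)
  have \<delta>': "\<delta> \<le> d b" if "b \<in> Basis" for b
    unfolding \<delta>_def using that by (intro Min_le) auto
  obtain \<eta> :: "'a \<Rightarrow> real" where \<eta>: "\<eta> \<in> test_functions" "\<And>x. 0 \<le> \<eta> x"
    "\<And>x. \<delta> \<le> norm x \<Longrightarrow> \<eta> x = 0" "integral\<^sup>L lborel \<eta> = 1"
    using mollifier_exists[OF \<delta>(1)] by blast
  show thesis
  proof
    show "\<eta> \<in> test_functions" by fact
    show "(\<integral>\<^sup>+x. ennreal (\<bar>corr u \<eta> x - u x\<bar> powr p) \<partial>lborel) \<le> ennreal e"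
    proof -
      have "(\<integral>\<^sup>+x. ennreal (\<bar>corr u \<eta> x - u x\<bar> powr p) \<partial>lborel) \<le> ennreal (2 powr p * e')"
      proof (rule corr_Lp_close[OF u_loc p \<eta>])
        show "(\<integral>\<^sup>+x. ennreal (\<bar>u (x + h) - u x\<bar> powr p) \<partial>lborel) \<le> ennreal e'" if "norm h < \<delta>" for h
          using that \<delta>(2) by (intro d0(2)) linarith
      qed (use e'(1) in auto)
      then show ?thesis by (simp only: e'(2))
    qed
    show "(\<integral>\<^sup>+x. ennreal (\<bar>(grad (corr u \<eta>) x - G x) \<bullet> b\<bar> powr p) \<partial>lborel) \<le> ennreal e"
      if b: "b \<in> Basis" for b
    proof -
      have "(\<integral>\<^sup>+x. ennreal (\<bar>corr (\<lambda>x. G x \<bullet> b) \<eta> x - G x \<bullet> b\<bar> powr p) \<partial>lborel) \<le> ennreal (2 powr p * e')"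
      proof (rule corr_Lp_close[OF G_component_loc[OF b] p \<eta>])
        show "(\<integral>\<^sup>+x. ennreal (\<bar>G (x + h) \<bullet> b - G x \<bullet> b\<bar> powr p) \<partial>lborel) \<le> ennreal e'"
          if "norm h < \<delta>" for h
          using that \<delta>'[OF b] by (intro d(2)[OF b]) linarith
      qed (use e'(1) in auto)
      then show ?thesis by (simp only: e'(2) inner_diff_left grad_corr[OF \<eta>(1) b])
    qed
  qed
qed

text \<open>Errors of size (1/2)^n in L^1 of the p-th powers are summable. Their pointwise sum is
  therefore integrable and serves as the common majorant D; it is finite a.e., which also yields
  convergence a.e. without extracting a subsequence.\<close>

lemma approximating_sequence:
  obtains U :: "nat \<Rightarrow> 'a \<Rightarrow> real" and D :: "'a \<Rightarrow> real"
  where "\<And>n k. C_k k (U n)"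
    "\<And>n e. e > 0 \<Longrightarrow> \<exists>R. \<forall>x. R < norm x \<longrightarrow> \<bar>U n x\<bar> < e"
    "integrable lborel D" "\<And>x. D x \<ge> 0"
    "\<And>n. AE x in lborel. \<bar>U n x - u x\<bar> powr p \<le> D x"
    "\<And>n. AE x in lborel. norm (grad (U n) x - G x) powr p \<le> D x"
    "AE x in lborel. (\<lambda>n. U n x) \<longlonglongrightarrow> u x"
    "AE x in lborel. (\<lambda>n. grad (U n) x) \<longlonglongrightarrow> G x"
proof -
  have "\<exists>\<eta>. \<eta> \<in> test_functions \<and>
    (\<integral>\<^sup>+x. ennreal (\<bar>corr u \<eta> x - u x\<bar> powr p) \<partial>lborel) \<le> ennreal ((1/2)^n) \<and>
    (\<forall>b\<in>Basis. (\<integral>\<^sup>+x. ennreal (\<bar>(grad (corr u \<eta>) x - G x) \<bullet> b\<bar> powr p) \<partial>lborel) \<le> ennreal ((1/2)^n))" for n :: nat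
    by (rule mollification_close[of "(1/2)^n"]) auto
  then have "\<forall>n::nat. \<exists>\<eta>. \<eta> \<in> test_functions \<and>
    (\<integral>\<^sup>+x. ennreal (\<bar>corr u \<eta> x - u x\<bar> powr p) \<partial>lborel) \<le> ennreal ((1/2)^n) \<and>
    (\<forall>b\<in>Basis. (\<integral>\<^sup>+x. ennreal (\<bar>(grad (corr u \<eta>) x - G x) \<bullet> b\<bar> powr p) \<partial>lborel) \<le> ennreal ((1/2)^n))"
    by (rule allI)
  from choice[OF this] obtain \<eta> where all: "\<forall>n::nat. \<eta> n \<in> test_functions \<and>
    (\<integral>\<^sup>+x. ennreal (\<bar>corr u (\<eta> n) x - u x\<bar> powr p) \<partial>lborel) \<le> ennreal ((1/2)^n) \<and>
    (\<forall>b\<in>Basis. (\<integral>\<^sup>+x. ennreal (\<bar>(grad (corr u (\<eta> n)) x - G x) \<bullet> b\<bar> powr p) \<partial>lborel) \<le> ennreal ((1/2)^n))"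
    by (elim exE)
  have \<eta>: "\<eta> n \<in> test_functions"
    and close: "(\<integral>\<^sup>+x. ennreal (\<bar>corr u (\<eta> n) x - u x\<bar> powr p) \<partial>lborel) \<le> ennreal ((1/2)^n)"
    "b \<in> Basis \<Longrightarrow> (\<integral>\<^sup>+x. ennreal (\<bar>(grad (corr u (\<eta> n)) x - G x) \<bullet> b\<bar> powr p) \<partial>lborel) \<le> ennreal ((1/2)^n)"
    for n b
    using all by blast+
  define U where "U n = corr u (\<eta> n)" for n
  have sm: "C_k k (U n)" for n k unfolding U_def by (rule C_k_corr[OF u_loc \<eta>])
  have [measurable]: "U n \<in> borel_measurable borel" for n
    using sm[of 0 n] by (simp add: borel_measurable_continuous_onI)
  have gm: "(\<lambda>x. \<bar>(grad (U n) x - G x) \<bullet> b\<bar> powr p) \<in> borel_measurable borel" if "b \<in> Basis" for n b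
  proof -
    have [measurable]: "(\<lambda>x. grad (U n) x \<bullet> b) \<in> borel_measurable borel"
      using sm[of 1 n] that by (simp add: grad_inner_Basis borel_measurable_continuous_onI)
    show ?thesis unfolding inner_diff_left by measurable
  qed
  define t where "t n x = \<bar>U n x - u x\<bar> powr p + (\<Sum>b\<in>Basis. \<bar>(grad (U n) x - G x) \<bullet> b\<bar> powr p)" for n x
  have t0: "t n x \<ge> 0" for n x unfolding t_def by (intro add_nonneg_nonneg sum_nonneg) auto
  have [measurable]: "t n \<in> borel_measurable borel" for n
  proof -
    have [measurable]: "(\<lambda>x. \<Sum>b\<in>Basis. \<bar>(grad (U n) x - G x) \<bullet> b\<bar> powr p) \<in> borel_measurable borel"
      by (rule borel_measurable_sum) (rule gm)
    show ?thesis unfolding t_def[abs_def] by measurable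
  qed
  define D' where "D' x = (\<Sum>n. ennreal (t n x))" for x
  have [measurable]: "D' \<in> borel_measurable borel" unfolding D'_def[abs_def] by measurable
  have tint: "(\<integral>\<^sup>+x. ennreal (t n x) \<partial>lborel) \<le> ennreal ((1 + real DIM('a)) * (1/2)^n)" for n
  proof -
    have "(\<integral>\<^sup>+x. ennreal (t n x) \<partial>lborel) = (\<integral>\<^sup>+x. ennreal (\<bar>U n x - u x\<bar> powr p)
        + (\<Sum>b\<in>Basis. ennreal (\<bar>(grad (U n) x - G x) \<bullet> b\<bar> powr p)) \<partial>lborel)"
      by (intro nn_integral_cong) (simp add: t_def ennreal_plus sum_nonneg)
    also have "\<dots> = (\<integral>\<^sup>+x. ennreal (\<bar>U n x - u x\<bar> powr p) \<partial>lborel)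
        + (\<Sum>b\<in>Basis. (\<integral>\<^sup>+x. ennreal (\<bar>(grad (U n) x - G x) \<bullet> b\<bar> powr p) \<partial>lborel))"
      using gm by (simp add: nn_integral_add nn_integral_sum borel_measurable_sum del: sum_ennreal)
    also have "\<dots> \<le> ennreal ((1/2)^n) + (\<Sum>b\<in>(Basis :: 'a set). ennreal ((1/2)^n))"
      unfolding U_def by (intro add_mono sum_mono close)
    also have "\<dots> = ennreal ((1 + real DIM('a)) * (1/2)^n)"
      by (subst sum_ennreal) (auto simp: distrib_right simp flip: ennreal_plus)
    finally show ?thesis .
  qed
  have "(\<integral>\<^sup>+x. D' x \<partial>lborel) = (\<Sum>n. \<integral>\<^sup>+x. ennreal (t n x) \<partial>lborel)"
    unfolding D'_def by (rule nn_integral_suminf) measurable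
  also have "\<dots> \<le> (\<Sum>n. ennreal ((1 + real DIM('a)) * (1/2)^n))"
    by (intro suminf_le tint) auto
  also have "\<dots> < \<infinity>"
  proof -
    have "summable (\<lambda>n. (1 + real DIM('a)) * (1/2)^n)"
      by (intro summable_mult summable_geometric) simp
    then show ?thesis by (subst suminf_ennreal2) auto
  qed
  finally have fin: "(\<integral>\<^sup>+x. D' x \<partial>lborel) < \<infinity>" .
  then have AEfin: "AE x in lborel. D' x \<noteq> \<infinity>"
    by (intro nn_integral_noteq_infinite) auto
  \<comment> \<open>The norm is at most the sum of \<open>DIM('a)\<close> components, each bounded
    by the p-th root of the sum of their p-th powers; raising to the power p gives this constant.
    Being at least 1, it also serves for U n - u.\<close>
  define c where "c = real DIM('a) powr p"
  have c1: "c \<ge> 1" unfolding c_def using p DIM_positive[where 'a='a] by (intro ge_one_powr_ge_zero) auto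
  \<comment> \<open>\<open>enn2real\<close> sends infinity to 0, which keeps the integral bound and
    matters only on the null set excluded by \<open>AEfin\<close>.\<close>
  have D'int: "integrable lborel (\<lambda>x. enn2real (D' x))"
  proof (rule integrableI_nonneg)
    have "(\<integral>\<^sup>+x. ennreal (enn2real (D' x)) \<partial>lborel) \<le> (\<integral>\<^sup>+x. D' x \<partial>lborel)"
      by (intro nn_integral_mono) (auto simp: ennreal_enn2real_if)
    then show "(\<integral>\<^sup>+x. ennreal (enn2real (D' x)) \<partial>lborel) < \<infinity>" using fin by simp
  qed auto
  have main: "AE x in lborel. summable (\<lambda>n. t n x) \<and> (\<forall>n. t n x \<le> enn2real (D' x))"
    using AEfin
  proof eventually_elim
    case (elim x)
    then have s: "summable (\<lambda>n. t n x)"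
      unfolding D'_def using t0 by (intro summable_suminf_not_top) auto
    then have "D' x = ennreal (\<Sum>n. t n x)"
      unfolding D'_def using t0 by (intro suminf_ennreal2) auto
    then have "enn2real (D' x) = (\<Sum>n. t n x)" using t0 s by (simp add: suminf_nonneg)
    moreover have "t n x \<le> (\<Sum>n. t n x)" for n
      using sum_le_suminf[OF s, of "{n}"] t0 by simp
    ultimately show ?case using s by simp
  qed
  have gradle: "norm (grad (U n) x - G x) powr p \<le> c * t n x" for n x
  proof -
    let ?S = "\<Sum>b\<in>Basis. \<bar>(grad (U n) x - G x) \<bullet> b\<bar> powr p"
    have S0: "?S \<ge> 0" by (intro sum_nonneg) auto
    have "\<bar>(grad (U n) x - G x) \<bullet> b\<bar> \<le> ?S powr (1 / p)" if "b \<in> Basis" for b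
    proof -
      have "\<bar>(grad (U n) x - G x) \<bullet> b\<bar> = (\<bar>(grad (U n) x - G x) \<bullet> b\<bar> powr p) powr (1 / p)"
        using p by (simp add: powr_powr)
      also have "\<dots> \<le> ?S powr (1 / p)"
        using p that by (intro powr_mono2 member_le_sum) auto
      finally show ?thesis .
    qed
    then have "(\<Sum>b\<in>Basis. \<bar>(grad (U n) x - G x) \<bullet> b\<bar>) \<le> real DIM('a) * ?S powr (1 / p)"
      by (rule sum_bounded_above)
    then have "norm (grad (U n) x - G x) \<le> real DIM('a) * ?S powr (1 / p)"
      using norm_le_l1 order_trans by blast
    then have "norm (grad (U n) x - G x) powr p \<le> (real DIM('a) * ?S powr (1 / p)) powr p"
      using p by (intro powr_mono2) auto
    also have "\<dots> = c * ?S" using p S0 by (simp add: c_def powr_mult powr_powr)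
    also have "\<dots> \<le> c * t n x" using c1 by (intro mult_left_mono) (auto simp: t_def)
    finally show ?thesis .
  qed
  have ule: "\<bar>U n x - u x\<bar> powr p \<le> c * t n x" for n x
  proof -
    have "\<bar>U n x - u x\<bar> powr p \<le> 1 * t n x" by (simp add: t_def sum_nonneg)
    also have "\<dots> \<le> c * t n x" using c1 t0 by (intro mult_right_mono)
    finally show ?thesis .
  qed
  have conv0: "(\<lambda>n. a n) \<longlonglongrightarrow> 0"
    if "\<And>n. (a n) powr p \<le> c * t n x" "\<And>n. a n \<ge> 0" "summable (\<lambda>n. t n x)" for a :: "nat \<Rightarrow> real" and x
  proof -
    have "(\<lambda>n. c * t n x) \<longlonglongrightarrow> 0"
      using summable_LIMSEQ_zero[OF that(3)] by (intro tendsto_mult_right_zero)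
    then have "(\<lambda>n. (c * t n x) powr (1 / p)) \<longlonglongrightarrow> 0 powr (1 / p)"
      using p c1 t0 by (intro tendsto_powr') auto
    then have "(\<lambda>n. (c * t n x) powr (1 / p)) \<longlonglongrightarrow> 0" by simp
    moreover have "\<forall>n. norm (a n) \<le> (c * t n x) powr (1 / p)"
    proof
      fix n
      have "a n = (a n powr p) powr (1 / p)" using that(2)[of n] p by (simp add: powr_powr)
      also have "\<dots> \<le> (c * t n x) powr (1 / p)" using that(1)[of n] p by (intro powr_mono2) auto
      finally show "norm (a n) \<le> (c * t n x) powr (1 / p)" using that(2)[of n] by simp
    qed
    ultimately show ?thesis
      using Lim_null_comparison[OF always_eventually, of a "\<lambda>n. (c * t n x) powr (1 / p)"] by blast
  qed
  show thesis
  proof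
    show "C_k k (U n)" for n k by (rule sm)
    show "\<exists>R. \<forall>x. R < norm x \<longrightarrow> \<bar>U n x\<bar> < e" if e: "e > 0" for n e
    proof -
      obtain R where "\<And>x. R < norm x \<Longrightarrow> \<bar>corr u (\<eta> n) x\<bar> < e"
        using corr_vanishes_at_infinity[OF u_borel u_Lp p \<eta>[of n] e] by blast
      then show ?thesis unfolding U_def by blast
    qed
    show "integrable lborel (\<lambda>x. c * enn2real (D' x))" using D'int by simp
    show "0 \<le> c * enn2real (D' x)" for x using c1 by simp
    show "AE x in lborel. \<bar>U n x - u x\<bar> powr p \<le> c * enn2real (D' x)" for n
      using main
    proof eventually_elim
      case (elim x)
      then have "c * t n x \<le> c * enn2real (D' x)" using c1 by (intro mult_left_mono) auto
      then show ?case using ule[of n x] by linarith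
    qed
    show "AE x in lborel. norm (grad (U n) x - G x) powr p \<le> c * enn2real (D' x)" for n
      using main
    proof eventually_elim
      case (elim x)
      then have "c * t n x \<le> c * enn2real (D' x)" using c1 by (intro mult_left_mono) auto
      then show ?case using gradle[of n x] by linarith
    qed
    show "AE x in lborel. (\<lambda>n. U n x) \<longlonglongrightarrow> u x"
      using main
    proof eventually_elim
      case (elim x)
      then have "(\<lambda>n. \<bar>U n x - u x\<bar>) \<longlonglongrightarrow> 0" using ule by (intro conv0[of _ x]) auto
      then show ?case by (simp add: tendsto_rabs_zero_iff LIM_zero_iff)
    qed
    show "AE x in lborel. (\<lambda>n. grad (U n) x) \<longlonglongrightarrow> G x"
      using main
    proof eventually_elim
      case (elim x)
      then have "(\<lambda>n. norm (grad (U n) x - G x)) \<longlonglongrightarrow> 0" using gradle by (intro conv0[of _ x]) auto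
      then show ?case by (simp add: tendsto_norm_zero_iff LIM_zero_iff)
    qed
  qed
qed

end

section \<open>Truncations and the translation estimate for smooth functions\<close>

text \<open>With \<delta> a quarter of l - h, the ramp g rises with slope 1 from h + \<delta> to h +
  3 \<delta>; a kernel of radius \<delta> smooths it without touching the levels below h and above
  l. Both \<phi> and t - \<phi> t inherit monotonicity from g, which bounds the derivative from both
  sides.\<close>

lemma smooth_truncation:
  fixes h l :: real
  assumes "h < l"
  obtains \<phi> :: "real \<Rightarrow> real" where "\<And>k. C_k k \<phi>"
    "\<And>t. 0 \<le> \<phi> t" "\<And>t. \<phi> t \<le> (l - h) / 2" "\<And>t. t \<le> h \<Longrightarrow> \<phi> t = 0"
    "\<And>t. l \<le> t \<Longrightarrow> \<phi> t = (l - h) / 2"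
    "\<And>t. 0 \<le> partial_deriv 1 \<phi> t" "\<And>t. partial_deriv 1 \<phi> t \<le> 1"
proof -
  define \<delta> where "\<delta> = (l - h) / 4"
  define g where "g t = max 0 (min (2 * \<delta>) (t - (h + \<delta>)))" for t
  have \<delta>: "\<delta> > 0" using assms by (simp add: \<delta>_def)
  obtain \<eta> :: "real \<Rightarrow> real" where \<eta>: "\<eta> \<in> test_functions" "\<And>x. 0 \<le> \<eta> x"
    "\<And>x. \<delta> \<le> norm x \<Longrightarrow> \<eta> x = 0" "integral\<^sup>L lborel \<eta> = 1"
    using mollifier_exists[OF \<delta>] by blast
  have gc: "continuous_on S g" for S unfolding g_def by (intro continuous_intros)
  have gm: "g \<in> borel_measurable borel" by (rule borel_measurable_continuous_onI[OF gc])
  have gl: "loc_integrable g"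
    unfolding loc_integrable_def set_integrable_def
    using gm borel_integrable_compact[OF compact_cball gc] by blast
  define \<phi> where "\<phi> = corr g \<eta>"
  note i\<eta> = test_function_integrable[OF \<eta>(1)]
  have ig: "integrable lborel (\<lambda>s. g (t + s) * \<eta> s)" for t
  proof (rule Bochner_Integration.integrable_bound)
    show "integrable lborel (\<lambda>s. 2 * \<delta> * \<eta> s)" using i\<eta> by simp
    show "AE s in lborel. norm (g (t + s) * \<eta> s) \<le> norm (2 * \<delta> * \<eta> s)"
      using \<delta> \<eta>(2) by (auto simp: g_def abs_mult intro!: AE_I2 mult_right_mono)
    show "(\<lambda>s. g (t + s) * \<eta> s) \<in> borel_measurable lborel"
      using gm test_function_borel[OF \<eta>(1)] by measurable
  qed
  have phi: "\<phi> t = (\<integral>s. g (t + s) * \<eta> s \<partial>lborel)" for t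
    unfolding \<phi>_def by (rule corr_alt[OF gm test_function_borel[OF \<eta>(1)]])
  have sm: "C_k k \<phi>" for k unfolding \<phi>_def by (rule C_k_corr[OF gl \<eta>(1)])
  have der: "(\<phi> has_real_derivative partial_deriv 1 \<phi> t) (at t)" for t
  proof -
    have "\<phi> differentiable (at t)" using sm[of 1] by simp
    then obtain d where d: "(\<phi> has_real_derivative d) (at t)"
      using real_differentiableE by blast
    then have "partial_deriv 1 \<phi> t = d"
      by (simp add: has_field_derivative_def partial_deriv_eq)
    with d show ?thesis by simp
  qed
  have const: "(\<integral>s. c * \<eta> s \<partial>lborel) = c" for c using \<eta>(4) by simp
  have mono: "\<phi> s \<le> \<phi> t" "\<phi> t - \<phi> s \<le> t - s" if "s \<le> t" for s t
  proof -
    show "\<phi> s \<le> \<phi> t" unfolding phi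
      using that \<eta>(2) by (intro integral_mono ig mult_right_mono) (auto simp: g_def)
    have "\<phi> t - \<phi> s = (\<integral>r. g (t + r) * \<eta> r - g (s + r) * \<eta> r \<partial>lborel)"
      unfolding phi using ig by simp
    also have "\<dots> \<le> (\<integral>r. (t - s) * \<eta> r \<partial>lborel)"
      unfolding left_diff_distrib[symmetric] using ig i\<eta> \<eta>(2) that
      by (intro integral_mono mult_right_mono) (auto simp: g_def left_diff_distrib)
    finally show "\<phi> t - \<phi> s \<le> t - s" by (simp only: const)
  qed
  show thesis
  proof
    show "C_k k \<phi>" for k by (rule sm)
    show "0 \<le> \<phi> t" for t
      unfolding phi using \<eta>(2) by (intro integral_nonneg_AE AE_I2) (auto simp: g_def)
    have "\<phi> t \<le> (\<integral>s. 2 * \<delta> * \<eta> s \<partial>lborel)" for t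
      unfolding phi using \<eta>(2) i\<eta> \<delta> by (intro integral_mono ig mult_right_mono) (auto simp: g_def)
    then have "\<phi> t \<le> 2 * \<delta>" for t by (simp only: const)
    moreover have "2 * \<delta> = (l - h) / 2" by (simp add: \<delta>_def)
    ultimately show "\<phi> t \<le> (l - h) / 2" for t by metis
    show "\<phi> t = 0" if "t \<le> h" for t
    proof -
      have "g (t + s) * \<eta> s = 0" for s
        using that \<eta>(3)[of s] by (cases "\<delta> \<le> norm s") (auto simp: g_def)
      then have "(\<lambda>s. g (t + s) * \<eta> s) = (\<lambda>s. 0)" by (rule ext)
      then show ?thesis by (simp add: phi)
    qed
    show "\<phi> t = (l - h) / 2" if "l \<le> t" for t
    proof -
      have "g (t + s) * \<eta> s = (2 * \<delta>) * \<eta> s" for s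
      proof (cases "\<delta> \<le> norm s")
        case False
        moreover have "l = h + 4 * \<delta>" by (simp add: \<delta>_def field_simps)
        ultimately have "2 * \<delta> \<le> t + s - (h + \<delta>)" using that by auto
        then show ?thesis using \<delta> by (simp add: g_def)
      qed (use \<eta>(3)[of s] in simp)
      then show ?thesis by (simp only: phi const) (simp add: \<delta>_def)
    qed
    show "0 \<le> partial_deriv 1 \<phi> t" for t
      by (rule mono_on_imp_deriv_nonneg[OF _ der, of UNIV]) (auto intro!: mono_onI mono)
    have "0 \<le> 1 - partial_deriv 1 \<phi> t" for t
    proof (rule mono_on_imp_deriv_nonneg[of UNIV "\<lambda>t. t - \<phi> t"])
      show "((\<lambda>t. t - \<phi> t) has_real_derivative 1 - partial_deriv 1 \<phi> t) (at t)"
        by (intro derivative_intros der)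
      show "mono_on UNIV (\<lambda>t. t - \<phi> t)"
        using mono(2) by (intro mono_onI) (simp add: algebra_simps)
    qed auto
    then show "partial_deriv 1 \<phi> t \<le> 1" for t by simp
  qed
qed

lemma continuous_grad:
  assumes "C_k 1 f"
  shows "continuous_on S (grad f)"
proof -
  have "continuous_on UNIV (grad f)"
    unfolding grad_def[abs_def] using assms by (intro continuous_on_sum continuous_intros) auto
  then show ?thesis using continuous_on_subset by blast
qed

lemma grad_compose:
  fixes \<phi> :: "real \<Rightarrow> real"
  assumes "C_k 1 \<phi>" "C_k 1 f"
  shows "grad (\<lambda>x. \<phi> (f x)) x = partial_deriv 1 \<phi> (f x) *\<^sub>R grad f x"
proof (rule grad_eq)
  have "(f has_derivative (\<lambda>h. h \<bullet> grad f x)) (at x)"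
    using assms by (intro has_derivative_grad) auto
  moreover have "(\<phi> has_derivative (\<lambda>h. h \<bullet> grad \<phi> (f x))) (at (f x))"
    using assms by (intro has_derivative_grad) auto
  ultimately have "((\<lambda>x. \<phi> (f x)) has_derivative (\<lambda>h. (h \<bullet> grad f x) \<bullet> grad \<phi> (f x))) (at x)"
    by (rule has_derivative_compose)
  then show "((\<lambda>x. \<phi> (f x)) has_derivative (\<lambda>h. h \<bullet> partial_deriv 1 \<phi> (f x) *\<^sub>R grad f x)) (at x)"
    by (simp add: grad_def[of \<phi>] mult.commute)
qed

text \<open>v(x + y) - v(x) is the integral of the derivative along the segment.
  \<open>weighted_mean_powr\<close> with the uniform weight on [0, 1] moves the power inside, and
  after Fubini each point of the segment contributes the same energy by translation invariance. The
  factor 2 is the loss against Jensen's inequality.\<close>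

lemma translation_difference_le:
  fixes v :: "'a::euclidean_space \<Rightarrow> real"
  assumes v: "C_k 1 v" and p: "p \<ge> 1"
  shows "(\<integral>\<^sup>+x. ennreal (\<bar>v (x + y) - v x\<bar> powr p) \<partial>lborel)
    \<le> ennreal ((2 * norm y) powr p) * (\<integral>\<^sup>+x. ennreal (norm (grad v x) powr p) \<partial>lborel)"
proof -
  have vc: "continuous_on UNIV v" using v C_k_imp_continuous by blast
  note gc = continuous_grad[OF v]
  have [measurable]: "v \<in> borel_measurable borel" "grad v \<in> borel_measurable borel"
    using vc gc by (auto intro: borel_measurable_continuous_onI)
  let ?I = "indicator {0..1::real} :: real \<Rightarrow> real"
  have \<eta>: "integrable lborel ?I" "integral\<^sup>L lborel ?I = 1" by (simp_all add: integrable_indicator_iff)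
  have pt: "ennreal (\<bar>v (x + y) - v x\<bar> powr p)
      \<le> ennreal (2 powr p) * (\<integral>\<^sup>+s. ennreal ((norm y * norm (grad v (x + s *\<^sub>R y))) powr p * ?I s) \<partial>lborel)" for x
  proof -
    have D: "((\<lambda>s. v (x + s *\<^sub>R y)) has_vector_derivative y \<bullet> grad v (x + s *\<^sub>R y)) (at s within {0..1})" for s
    proof -
      have "((\<lambda>s. x + s *\<^sub>R y) has_derivative (\<lambda>h. h *\<^sub>R y)) (at s within {0..1})"
        by (auto intro!: derivative_eq_intros)
      moreover have "(v has_derivative (\<lambda>h. h \<bullet> grad v (x + s *\<^sub>R y))) (at (x + s *\<^sub>R y))"
        using v by (intro has_derivative_grad) auto
      ultimately have "((\<lambda>s. v (x + s *\<^sub>R y)) has_derivative (\<lambda>h. (h *\<^sub>R y) \<bullet> grad v (x + s *\<^sub>R y))) (at s within {0..1})"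
        by (rule has_derivative_compose)
      then show ?thesis by (simp add: has_vector_derivative_def)
    qed
    have cont: "continuous_on {0..1} (\<lambda>s. y \<bullet> grad v (x + s *\<^sub>R y))"
      by (intro continuous_intros continuous_on_compose2[OF gc[of UNIV]]) auto
    have bi: "has_bochner_integral lborel (\<lambda>s. ?I s *\<^sub>R (y \<bullet> grad v (x + s *\<^sub>R y)))
        (v (x + 1 *\<^sub>R y) - v (x + 0 *\<^sub>R y))"
      by (rule has_bochner_integral_FTC_Icc[OF _ D cont]) simp
    have "\<bar>v (x + y) - v x\<bar> = \<bar>\<integral>s. ?I s *\<^sub>R (y \<bullet> grad v (x + s *\<^sub>R y)) \<partial>lborel\<bar>"
      using has_bochner_integral_integral_eq[OF bi] by simp
    also have "\<dots> \<le> (\<integral>s. \<bar>?I s *\<^sub>R (y \<bullet> grad v (x + s *\<^sub>R y))\<bar> \<partial>lborel)"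
      by (rule integral_abs_bound)
    also have "\<dots> \<le> (\<integral>s. (norm y * norm (grad v (x + s *\<^sub>R y))) * ?I s \<partial>lborel)"
    proof (rule integral_mono)
      show "integrable lborel (\<lambda>s. \<bar>?I s *\<^sub>R (y \<bullet> grad v (x + s *\<^sub>R y))\<bar>)"
        using integrable.intros[OF bi] by (rule integrable_abs)
      have "continuous_on {0..1} (\<lambda>s. norm y * norm (grad v (x + s *\<^sub>R y)))"
        by (intro continuous_intros continuous_on_compose2[OF gc[of UNIV]]) auto
      then show "integrable lborel (\<lambda>s. (norm y * norm (grad v (x + s *\<^sub>R y))) * ?I s)"
        using borel_integrable_compact[of "{0..1::real}" "\<lambda>s. norm y * norm (grad v (x + s *\<^sub>R y))"]
        by (simp add: mult.commute)
      show "\<bar>?I s *\<^sub>R (y \<bullet> grad v (x + s *\<^sub>R y))\<bar> \<le> (norm y * norm (grad v (x + s *\<^sub>R y))) * ?I s" for s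
        using Cauchy_Schwarz_ineq2[of y "grad v (x + s *\<^sub>R y)"] by (auto simp: indicator_def)
    qed
    finally have "ennreal (\<bar>v (x + y) - v x\<bar> powr p)
        \<le> ennreal ((\<integral>s. (norm y * norm (grad v (x + s *\<^sub>R y))) * ?I s \<partial>lborel) powr p)"
      using p by (intro ennreal_leI powr_mono2) auto
    also have "\<dots> \<le> ennreal (2 powr p) * (\<integral>\<^sup>+s. ennreal ((norm y * norm (grad v (x + s *\<^sub>R y))) powr p * ?I s) \<partial>lborel)"
      by (rule weighted_mean_powr) (use \<eta> p in auto)
    finally show ?thesis .
  qed
  let ?E = "\<integral>\<^sup>+x. ennreal (norm (grad v x) powr p) \<partial>lborel"
  have "(\<integral>\<^sup>+x. ennreal (\<bar>v (x + y) - v x\<bar> powr p) \<partial>lborel)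
      \<le> (\<integral>\<^sup>+x. ennreal (2 powr p) * (\<integral>\<^sup>+s. ennreal ((norm y * norm (grad v (x + s *\<^sub>R y))) powr p * ?I s) \<partial>lborel) \<partial>lborel)"
    by (intro nn_integral_mono pt)
  also have "\<dots> = ennreal (2 powr p) * (\<integral>\<^sup>+x. (\<integral>\<^sup>+s. ennreal ((norm y * norm (grad v (x + s *\<^sub>R y))) powr p * ?I s) \<partial>lborel) \<partial>lborel)"
    by (rule nn_integral_cmult) measurable
  also have "(\<integral>\<^sup>+x. (\<integral>\<^sup>+s. ennreal ((norm y * norm (grad v (x + s *\<^sub>R y))) powr p * ?I s) \<partial>lborel) \<partial>lborel)
      = (\<integral>\<^sup>+s. (\<integral>\<^sup>+x. ennreal ((norm y * norm (grad v (x + s *\<^sub>R y))) powr p * ?I s) \<partial>lborel) \<partial>lborel)"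
    by (rule lborel_pair.Fubini') measurable
  also have "\<dots> = (\<integral>\<^sup>+s. ennreal (norm y powr p) * ?E * ennreal (?I s) \<partial>lborel)"
  proof (rule nn_integral_cong)
    fix s :: real
    have "(\<integral>\<^sup>+x. ennreal ((norm y * norm (grad v (x + s *\<^sub>R y))) powr p * ?I s) \<partial>lborel)
        = (\<integral>\<^sup>+x. ennreal (norm y powr p * ?I s) * ennreal (norm (grad v (s *\<^sub>R y + x)) powr p) \<partial>lborel)"
      by (intro nn_integral_cong) (simp add: powr_mult mult_ac add.commute flip: ennreal_mult)
    also have "\<dots> = ennreal (norm y powr p * ?I s) * ?E"
      using nn_integral_lborel_translate[of "\<lambda>x. ennreal (norm (grad v x) powr p)" "s *\<^sub>R y"]
      by (simp add: nn_integral_cmult)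
    finally show "(\<integral>\<^sup>+x. ennreal ((norm y * norm (grad v (x + s *\<^sub>R y))) powr p * ?I s) \<partial>lborel)
        = ennreal (norm y powr p) * ?E * ennreal (?I s)"
      by (simp add: ennreal_mult mult_ac)
  qed
  also have "\<dots> = ennreal (norm y powr p) * ?E"
    by (subst nn_integral_cmult) (auto simp: ennreal_indicator)
  finally show ?thesis
    by (simp add: powr_mult ennreal_mult mult.assoc)
qed

section \<open>Energy estimates for the superlevel sets\<close>

lemma AE_lborel_translate:
  fixes c :: "'a::euclidean_space"
  assumes "AE x in lborel. P x"
  shows "AE x in lborel. P (c + x)"
proof -
  obtain N where N: "N \<in> null_sets lborel" "{x. \<not> P x} \<subseteq> N"
    using assms by (auto simp: eventually_ae_filter)
  have "emeasure lborel ((+) c -` N) = emeasure (distr lborel borel ((+) c)) N"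
    using N by (subst emeasure_distr) (auto simp: null_sets_def)
  also have "\<dots> = 0" using N by (simp add: lborel_distr_plus null_sets_def)
  finally have "(+) c -` N \<in> null_sets lborel"
    using N by (auto simp: null_sets_def intro!: measurable_sets_borel)
  moreover have "{x. \<not> P (c + x)} \<subseteq> (+) c -` N" using N by auto
  ultimately show ?thesis unfolding eventually_ae_filter by auto
qed

context sobolev_pair
begin

text \<open>\<open>measure\<close> is 0 on sets of infinite measure, which may occur for t \<le> 0;
  the levels are therefore positive throughout.\<close>

definition \<mu> :: "real \<Rightarrow> real" where "\<mu> t = measure lborel {x. t < u x}"

lemma superlevel_borel [measurable]: "{x. t < u x} \<in> sets borel"
  by measurable

text \<open>Chebyshev's inequality. Its second part starts the bootstrap with decay rate p.\<close>

lemma superlevel_finite: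
  assumes "t > 0"
  shows "emeasure lborel {x. t < u x} \<noteq> \<infinity>"
    and "\<mu> t \<le> (\<integral>x. \<bar>u x\<bar> powr p \<partial>lborel) * t powr - p"
proof -
  have le: "indicator {x. t < u x} x \<le> t powr - p * \<bar>u x\<bar> powr p" for x
  proof (cases "t < u x")
    case True
    then have "t powr p \<le> \<bar>u x\<bar> powr p" using assms p by (intro powr_mono2) auto
    then show ?thesis using assms True by (simp add: powr_minus field_simps)
  qed simp
  have int: "integrable lborel (\<lambda>x. t powr - p * \<bar>u x\<bar> powr p)" using u_Lp by simp
  have i: "integrable lborel (indicat_real {x. t < u x})"
    by (rule Bochner_Integration.integrable_bound[OF int]) (use le in \<open>auto intro!: AE_I2 simp: abs_of_nonneg\<close>)
  then show "emeasure lborel {x. t < u x} \<noteq> \<infinity>"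
    by (simp add: integrable_indicator_iff less_top)
  have "\<mu> t = (\<integral>x. indicat_real {x. t < u x} x \<partial>lborel)"
    by (simp add: \<mu>_def)
  also have "\<dots> \<le> (\<integral>x. t powr - p * \<bar>u x\<bar> powr p \<partial>lborel)"
    by (rule integral_mono[OF i int le])
  finally show "\<mu> t \<le> (\<integral>x. \<bar>u x\<bar> powr p \<partial>lborel) * t powr - p" by (simp add: mult.commute)
qed

lemma emeasure_superlevel: "t > 0 \<Longrightarrow> emeasure lborel {x. t < u x} = ennreal (\<mu> t)"
  using superlevel_finite by (simp add: \<mu>_def emeasure_eq_ennreal_measure)

lemma \<mu>_nonneg: "0 \<le> \<mu> t"
  by (simp add: \<mu>_def)

lemma \<mu>_antimono: "0 < s \<Longrightarrow> s \<le> t \<Longrightarrow> \<mu> t \<le> \<mu> s"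
  unfolding \<mu>_def using superlevel_finite(1)[of s]
  by (intro measure_mono_fmeasurable) (auto simp: fmeasurable_def less_top)

text \<open>The derivative appears to the first power because this is what testing with \<phi> o u
  produces. The translation estimate produces its p-th power, which is smaller as the derivative
  lies in [0, 1].\<close>

definition energy :: "(real \<Rightarrow> real) \<Rightarrow> real" where
  "energy \<phi> = (\<integral>x. partial_deriv 1 \<phi> (u x) * norm (G x) powr p \<partial>lborel)"

lemma norm_powr_le_difference: "norm g powr p \<le> 2 powr p * (norm (g - G x) powr p + norm (G x) powr p)"
proof -
  have "norm g powr p \<le> (norm (g - G x) + norm (G x)) powr p"
    using p norm_triangle_ineq[of "g - G x" "G x"] by (intro powr_mono2) auto
  also have "\<dots> \<le> 2 powr p * (norm (g - G x) powr p + norm (G x) powr p)"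
    using p by (intro powr_add_le) auto
  finally show ?thesis .
qed

text \<open>\<open>translation_difference_le\<close> is applied to \<phi> o U n, where the chain
  rule is classical. Fatou's lemma on the left, using convergence at x and at x + y, and dominated
  convergence on the right transfer it to u.\<close>

lemma translation_energy:
  assumes sm: "\<And>k. C_k k \<phi>" and d: "\<And>t. 0 \<le> partial_deriv 1 \<phi> t" "\<And>t. partial_deriv 1 \<phi> t \<le> 1"
  shows "(\<integral>\<^sup>+x. ennreal (\<bar>\<phi> (u (x + y)) - \<phi> (u x)\<bar> powr p) \<partial>lborel)
    \<le> ennreal ((2 * norm y) powr p * energy \<phi>)"
proof -
  obtain U D where U: "\<And>n k. C_k k (U n)"
    and "\<And>n e. e > 0 \<Longrightarrow> \<exists>R. \<forall>x. R < norm x \<longrightarrow> \<bar>U n x\<bar> < e"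
    and D: "integrable lborel D" "\<And>x. D x \<ge> 0"
    and "\<And>n. AE x in lborel. \<bar>U n x - u x\<bar> powr p \<le> D x"
    and gD: "\<And>n::nat. AE x in lborel. norm (grad (U n) x - G x) powr p \<le> D x"
    and Ulim: "AE x in lborel. (\<lambda>n. U n x) \<longlonglongrightarrow> u x"
    and glim: "AE x in lborel. (\<lambda>n. grad (U n) x) \<longlonglongrightarrow> G x"
    using approximating_sequence by blast
  let ?\<phi>' = "partial_deriv 1 \<phi>"
  have \<phi>c: "continuous_on UNIV \<phi>" "continuous_on UNIV ?\<phi>'" using sm[of 0] sm[of 1] by auto
  have [measurable]: "\<phi> \<in> borel_measurable borel" "?\<phi>' \<in> borel_measurable borel"
    "U n \<in> borel_measurable borel" "grad (U n) \<in> borel_measurable borel" for n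
    using \<phi>c U[of 0 n] continuous_grad[OF U[of 1 n]] by (auto intro: borel_measurable_continuous_onI)
  let ?f = "\<lambda>n x. (?\<phi>' (U n x)) powr p * norm (grad (U n) x) powr p"
  let ?g = "\<lambda>x. (?\<phi>' (u x)) powr p * norm (G x) powr p"
  have d1: "(?\<phi>' t) powr p \<le> 1" for t
    using powr_mono2[of p "?\<phi>' t" 1] d p by simp
  have gv: "norm (grad (\<lambda>x. \<phi> (U n x)) x) powr p = ?f n x" for n x
    using d by (simp add: grad_compose[OF sm U] powr_mult abs_of_nonneg)
  have dom: "AE x in lborel. norm (?f n x) \<le> 2 powr p * (D x + norm (G x) powr p)" for n
    using gD[of n]
  proof eventually_elim
    case (elim x)
    have "?f n x \<le> 1 * norm (grad (U n) x) powr p" using d1 by (intro mult_right_mono) auto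
    also have "\<dots> \<le> 2 powr p * (norm (grad (U n) x - G x) powr p + norm (G x) powr p)"
      using norm_powr_le_difference[of "grad (U n) x" x] by simp
    also have "\<dots> \<le> 2 powr p * (D x + norm (G x) powr p)" using elim by simp
    finally show ?case by simp
  qed
  have idom: "integrable lborel (\<lambda>x. 2 powr p * (D x + norm (G x) powr p))" using D(1) G_Lp by simp
  have flim: "AE x in lborel. (\<lambda>n. ?f n x) \<longlonglongrightarrow> ?g x"
    using Ulim glim
  proof eventually_elim
    case (elim x)
    have "(\<lambda>n. ?\<phi>' (U n x)) \<longlonglongrightarrow> ?\<phi>' (u x)"
      using \<phi>c(2) elim(1) by (auto intro: continuous_on_tendsto_compose)
    moreover have "(\<lambda>n. norm (grad (U n) x)) \<longlonglongrightarrow> norm (G x)" using elim(2) by (rule tendsto_norm)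
    ultimately show ?case using p d by (intro tendsto_mult tendsto_powr') auto
  qed
  have fi: "integrable lborel (?f n)" for n
    by (rule Bochner_Integration.integrable_bound[OF idom]) (use dom[of n] in \<open>auto elim: eventually_mono\<close>)
  have conv: "(\<lambda>n. integral\<^sup>L lborel (?f n)) \<longlonglongrightarrow> integral\<^sup>L lborel ?g"
    by (rule integral_dominated_convergence[OF _ _ idom flim dom]) measurable
  have gE: "integral\<^sup>L lborel ?g \<le> energy \<phi>"
    unfolding energy_def
  proof (rule integral_mono)
    have le: "?g x \<le> ?\<phi>' (u x) * norm (G x) powr p" "?\<phi>' (u x) * norm (G x) powr p \<le> norm (G x) powr p" for x
    proof -
      have "?\<phi>' (u x) powr p \<le> ?\<phi>' (u x) powr 1" if "?\<phi>' (u x) > 0"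
        using d p that by (intro powr_mono') auto
      then have "?\<phi>' (u x) powr p \<le> ?\<phi>' (u x)" using d(1)[of "u x"] by (cases "?\<phi>' (u x) = 0") auto
      then show "?g x \<le> ?\<phi>' (u x) * norm (G x) powr p" by (intro mult_right_mono) auto
      show "?\<phi>' (u x) * norm (G x) powr p \<le> norm (G x) powr p"
        using d mult_right_mono[OF d(2)[of "u x"], of "norm (G x) powr p"] by simp
    qed
    show "?g x \<le> ?\<phi>' (u x) * norm (G x) powr p" for x by (rule le)
    show i: "integrable lborel (\<lambda>x. ?\<phi>' (u x) * norm (G x) powr p)"
      by (rule Bochner_Integration.integrable_bound[OF G_Lp]) (use d le(2) in \<open>auto intro!: AE_I2 simp: abs_mult\<close>)
    show "integrable lborel ?g"
      by (rule Bochner_Integration.integrable_bound[OF i]) (use d le(1) in \<open>auto intro!: AE_I2 simp: abs_mult\<close>)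
  qed
  have trans: "(\<integral>\<^sup>+x. ennreal (\<bar>\<phi> (U n (x + y)) - \<phi> (U n x)\<bar> powr p) \<partial>lborel)
      \<le> ennreal ((2 * norm y) powr p * integral\<^sup>L lborel (?f n))" for n
  proof -
    have "(\<integral>\<^sup>+x. ennreal (\<bar>\<phi> (U n (x + y)) - \<phi> (U n x)\<bar> powr p) \<partial>lborel)
        \<le> ennreal ((2 * norm y) powr p) * (\<integral>\<^sup>+x. ennreal (?f n x) \<partial>lborel)"
      using translation_difference_le[OF C_k_compose[OF sm U] p] by (simp only: gv)
    also have "(\<integral>\<^sup>+x. ennreal (?f n x) \<partial>lborel) = ennreal (integral\<^sup>L lborel (?f n))"
      by (rule nn_integral_eq_integral[OF fi]) auto
    finally show ?thesis by (simp add: ennreal_mult)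
  qed
  have AElim: "AE x in lborel. ennreal (\<bar>\<phi> (u (x + y)) - \<phi> (u x)\<bar> powr p)
      = liminf (\<lambda>n. ennreal (\<bar>\<phi> (U n (x + y)) - \<phi> (U n x)\<bar> powr p))"
    using Ulim AE_lborel_translate[OF Ulim, of y]
  proof eventually_elim
    case (elim x)
    have "(\<lambda>n. \<phi> (U n x)) \<longlonglongrightarrow> \<phi> (u x)" "(\<lambda>n. \<phi> (U n (x + y))) \<longlonglongrightarrow> \<phi> (u (x + y))"
      using \<phi>c(1) elim by (auto intro: continuous_on_tendsto_compose simp: add.commute)
    then have "(\<lambda>n. ennreal (\<bar>\<phi> (U n (x + y)) - \<phi> (U n x)\<bar> powr p))
        \<longlonglongrightarrow> ennreal (\<bar>\<phi> (u (x + y)) - \<phi> (u x)\<bar> powr p)"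
      using p by (intro tendsto_ennrealI tendsto_powr' tendsto_intros) auto
    then show ?case by (rule lim_imp_Liminf[OF sequentially_bot, symmetric])
  qed
  have "(\<integral>\<^sup>+x. ennreal (\<bar>\<phi> (u (x + y)) - \<phi> (u x)\<bar> powr p) \<partial>lborel)
      = (\<integral>\<^sup>+x. liminf (\<lambda>n. ennreal (\<bar>\<phi> (U n (x + y)) - \<phi> (U n x)\<bar> powr p)) \<partial>lborel)"
    by (rule nn_integral_cong_AE[OF AElim])
  also have "\<dots> \<le> liminf (\<lambda>n. \<integral>\<^sup>+x. ennreal (\<bar>\<phi> (U n (x + y)) - \<phi> (U n x)\<bar> powr p) \<partial>lborel)"
    by (rule nn_integral_liminf) measurable
  also have "\<dots> \<le> liminf (\<lambda>n. ennreal ((2 * norm y) powr p * integral\<^sup>L lborel (?f n)))"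
    by (intro Liminf_mono always_eventually allI trans)
  also have "\<dots> = ennreal ((2 * norm y) powr p * integral\<^sup>L lborel ?g)"
    by (intro lim_imp_Liminf tendsto_ennrealI tendsto_mult tendsto_const conv) simp
  also have "\<dots> \<le> ennreal ((2 * norm y) powr p * energy \<phi>)"
    using gE by (intro ennreal_leI mult_left_mono) auto
  finally show ?thesis .
qed

text \<open>A point with \<open>u > l\<close> sees the set \<open>u \<le> h\<close> in at least half of a ball of measure
  \<open>2 * \<mu> h\<close> around it, and there the truncation \<open>\<phi> \<circ> u\<close> drops by its full height.
  This replaces the Sobolev inequality.\<close>

lemma superlevel_energy:
  assumes h: "0 < h" "h < l" and sm: "\<And>k. C_k k \<phi>"
    and d: "\<And>t. 0 \<le> partial_deriv 1 \<phi> t" "\<And>t. partial_deriv 1 \<phi> t \<le> 1"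
    and \<phi>0: "\<And>t. t \<le> h \<Longrightarrow> \<phi> t = 0" and \<phi>1: "\<And>t. l \<le> t \<Longrightarrow> \<phi> t = (l - h) / 2"
  shows "\<mu> l * (l - h) powr p
    \<le> 2 * 4 powr p * (2 / unit_ball_vol DIM('a)) powr (p / DIM('a)) * \<mu> h powr (p / DIM('a)) * energy \<phi>"
proof (cases "\<mu> h = 0")
  case True
  then have "\<mu> l = 0" using \<mu>_antimono[of h l] \<mu>_nonneg[of l] h by simp
  then show ?thesis using True by simp
next
  case False
  define m where "m = \<mu> h"
  have m: "m > 0" using False \<mu>_nonneg[of h] by (simp add: m_def)
  define V where "V = unit_ball_vol (real DIM('a))"
  have V: "V > 0" by (simp add: V_def)
  \<comment> \<open>The radius of a ball of measure 2 m. Its p-th power is the source of the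
    exponent p / N of \<mu> h.\<close>
  define \<epsilon> where "\<epsilon> = (2 * m / V) powr (1 / DIM('a))"
  have \<epsilon>: "\<epsilon> > 0" using m V by (simp add: \<epsilon>_def)
  have "\<epsilon> ^ DIM('a) = 2 * m / V"
    using m V \<epsilon> by (simp add: \<epsilon>_def powr_powr flip: powr_realpow)
  then have ball: "emeasure lborel (ball (0::'a) \<epsilon>) = ennreal (2 * m)"
    using V \<epsilon> by (simp add: emeasure_ball flip: V_def)
  have [measurable]: "ball (0::'a) \<epsilon> \<in> sets borel" by simp
  have \<epsilon>p: "\<epsilon> powr p = (2 / V) powr (p / DIM('a)) * m powr (p / DIM('a))"
    using m V by (simp add: \<epsilon>_def powr_powr powr_mult[symmetric])
  let ?L = "((l - h) / 2) powr p"
  have E0: "energy \<phi> \<ge> 0"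
    unfolding energy_def using d by (intro integral_nonneg_AE AE_I2) auto
  have \<phi>c: "continuous_on UNIV \<phi>" using sm[of 0] by auto
  have [measurable]: "\<phi> \<in> borel_measurable borel" using \<phi>c by (rule borel_measurable_continuous_onI)
  have inner: "ennreal (?L * m) \<le> (\<integral>\<^sup>+y. ennreal (\<bar>\<phi> (u (x + y)) - \<phi> (u x)\<bar> powr p) * indicator (ball 0 \<epsilon>) y \<partial>lborel)"
    if x: "l < u x" for x
  proof -
    let ?B = "{y. h < u (x + y)}"
    have B: "emeasure lborel ?B = ennreal m"
    proof -
      have "emeasure lborel ?B = emeasure (distr lborel borel ((+) x)) {y. h < u y}"
        by (subst emeasure_distr) (auto simp: vimage_def)
      then show ?thesis using h by (simp add: lborel_distr_plus m_def emeasure_superlevel)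
    qed
    have "ennreal m = ennreal (2 * m) - ennreal m"
      using m by (subst ennreal_minus) auto
    also have "\<dots> \<le> emeasure lborel (ball 0 \<epsilon> - ?B)"
    proof -
      have "ennreal (2 * m) - ennreal m = emeasure lborel (ball (0::'a) \<epsilon>) - emeasure lborel ?B"
        by (simp only: ball B)
      also have "\<dots> \<le> emeasure lborel (ball (0::'a) \<epsilon>) - emeasure lborel (ball 0 \<epsilon> \<inter> ?B)"
        by (intro ennreal_mono_minus emeasure_mono) auto
      also have "\<dots> = emeasure lborel (ball 0 \<epsilon> - ?B)"
      proof -
        have fin: "emeasure lborel (ball 0 \<epsilon> \<inter> ?B) \<noteq> \<infinity>"
          using emeasure_mono[of "ball 0 \<epsilon> \<inter> ?B" "ball 0 \<epsilon>" lborel] by (auto simp: ball top_unique)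
        have "emeasure lborel (ball 0 \<epsilon> - ball 0 \<epsilon> \<inter> ?B)
            = emeasure lborel (ball (0::'a) \<epsilon>) - emeasure lborel (ball 0 \<epsilon> \<inter> ?B)"
          by (rule emeasure_Diff[OF fin]) auto
        moreover have "ball 0 \<epsilon> - ball 0 \<epsilon> \<inter> ?B = ball (0::'a) \<epsilon> - ?B" by auto
        ultimately show ?thesis by simp
      qed
      finally show ?thesis .
    qed
    finally have "ennreal (?L * m) \<le> ennreal ?L * emeasure lborel (ball 0 \<epsilon> - ?B)"
      using m by (simp add: ennreal_mult mult_left_mono)
    also have "\<dots> = (\<integral>\<^sup>+y. ennreal ?L * indicator (ball 0 \<epsilon> - ?B) y \<partial>lborel)"
      by (rule nn_integral_cmult_indicator[symmetric]) measurable
    also have "\<dots> \<le> (\<integral>\<^sup>+y. ennreal (\<bar>\<phi> (u (x + y)) - \<phi> (u x)\<bar> powr p) * indicator (ball 0 \<epsilon>) y \<partial>lborel)"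
    proof (rule nn_integral_mono)
      fix y
      show "ennreal ?L * indicator (ball 0 \<epsilon> - ?B) y
          \<le> ennreal (\<bar>\<phi> (u (x + y)) - \<phi> (u x)\<bar> powr p) * indicator (ball 0 \<epsilon>) y"
      proof (cases "y \<in> ball 0 \<epsilon> - ?B")
        case True
        then have drop: "\<bar>\<phi> (u (x + y)) - \<phi> (u x)\<bar> = (l - h) / 2"
          using \<phi>0[of "u (x + y)"] \<phi>1[of "u x"] x h by auto
        show ?thesis unfolding drop using True by simp
      qed simp
    qed
    finally show ?thesis .
  qed
  have "ennreal (\<mu> l * (?L * m)) = (\<integral>\<^sup>+x. ennreal (?L * m) * indicator {x. l < u x} x \<partial>lborel)"
    using h \<mu>_nonneg[of l] m
    by (subst nn_integral_cmult_indicator) (auto simp: emeasure_superlevel ennreal_mult[symmetric] mult.commute)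
  also have "\<dots> \<le> (\<integral>\<^sup>+x. (\<integral>\<^sup>+y. ennreal (\<bar>\<phi> (u (x + y)) - \<phi> (u x)\<bar> powr p) * indicator (ball 0 \<epsilon>) y \<partial>lborel) \<partial>lborel)"
    using inner by (intro nn_integral_mono) (auto simp: indicator_def)
  \<comment> \<open>After the exchange the shift y is fixed, so \<open>translation_energy\<close>
    applies with norm y < \<epsilon>.\<close>
  also have "\<dots> = (\<integral>\<^sup>+y. (\<integral>\<^sup>+x. ennreal (\<bar>\<phi> (u (x + y)) - \<phi> (u x)\<bar> powr p) * indicator (ball 0 \<epsilon>) y \<partial>lborel) \<partial>lborel)"
    by (rule lborel_pair.Fubini') measurable
  also have "\<dots> \<le> (\<integral>\<^sup>+y. ennreal ((2 * \<epsilon>) powr p * energy \<phi>) * indicator (ball 0 \<epsilon>) y \<partial>(lborel :: 'a measure))"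
  proof (rule nn_integral_mono)
    fix y :: 'a
    have "(\<integral>\<^sup>+x. ennreal (\<bar>\<phi> (u (x + y)) - \<phi> (u x)\<bar> powr p) * indicator (ball 0 \<epsilon>) y \<partial>lborel)
        = (\<integral>\<^sup>+x. ennreal (\<bar>\<phi> (u (x + y)) - \<phi> (u x)\<bar> powr p) \<partial>lborel) * indicator (ball 0 \<epsilon>) y"
      by (rule nn_integral_multc) measurable
    also have "\<dots> \<le> ennreal ((2 * \<epsilon>) powr p * energy \<phi>) * indicator (ball 0 \<epsilon>) y"
    proof (cases "y \<in> ball 0 \<epsilon>")
      case True
      have "(\<integral>\<^sup>+x. ennreal (\<bar>\<phi> (u (x + y)) - \<phi> (u x)\<bar> powr p) \<partial>lborel) \<le> ennreal ((2 * norm y) powr p * energy \<phi>)"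
        by (rule translation_energy[OF sm d])
      also have "\<dots> \<le> ennreal ((2 * \<epsilon>) powr p * energy \<phi>)"
        using True p E0 by (intro ennreal_leI mult_right_mono powr_mono2) auto
      finally show ?thesis using True by simp
    qed simp
    finally show "(\<integral>\<^sup>+x. ennreal (\<bar>\<phi> (u (x + y)) - \<phi> (u x)\<bar> powr p) * indicator (ball 0 \<epsilon>) y \<partial>lborel)
        \<le> ennreal ((2 * \<epsilon>) powr p * energy \<phi>) * indicator (ball 0 \<epsilon>) y" .
  qed
  also have "\<dots> = ennreal (((2 * \<epsilon>) powr p * energy \<phi>) * (2 * m))"
    using E0 m by (subst nn_integral_cmult_indicator) (auto simp: ball ennreal_mult)
  \<comment> \<open>The measure m of the favourable half of the ball cancels against the measure 2 m
    of all shifts. The constant 4^p in the claim collects 2^p from 2 \<epsilon> and 2^p from the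
    height (l - h) / 2.\<close>
  finally have "\<mu> l * (?L * m) \<le> ((2 * \<epsilon>) powr p * energy \<phi>) * (2 * m)"
    using E0 m by (subst (asm) ennreal_le_iff) auto
  then have "\<mu> l * ?L \<le> 2 * (2 * \<epsilon>) powr p * energy \<phi>"
    using m by (simp add: field_simps)
  then have "2 powr p * (\<mu> l * ?L) \<le> 2 powr p * (2 * (2 * \<epsilon>) powr p * energy \<phi>)"
    by (intro mult_left_mono) auto
  moreover have "2 powr p * ?L = (l - h) powr p"
  proof -
    have "2 powr p * ?L = (2 * ((l - h) / 2)) powr p"
      by (rule powr_mult[symmetric])
    also have "2 * ((l - h) / 2) = l - h" by simp
    finally show ?thesis .
  qed
  moreover have "2 powr p * (2 * \<epsilon>) powr p = 4 powr p * \<epsilon> powr p"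
    using \<epsilon> by (simp add: powr_mult[symmetric])
  ultimately show ?thesis
    by (simp add: \<epsilon>p m_def V_def mult_ac)
qed

text \<open>Bounding the derivative of the truncation by 1 makes the energy independent of the
  levels. This holds for every Sobolev function and feeds the bootstrap.\<close>

lemma superlevel_decay:
  obtains C where "C > 0" "\<And>h l. 0 < h \<Longrightarrow> h < l \<Longrightarrow>
    \<mu> l * (l - h) powr p \<le> C * \<mu> h powr (p / DIM('a))"
proof -
  define K where "K = 2 * 4 powr p * (2 / unit_ball_vol DIM('a)) powr (p / DIM('a))"
  define I where "I = (\<integral>x. norm (G x) powr p \<partial>lborel)"
  have K: "K \<ge> 0" by (simp add: K_def)
  have I: "I \<ge> 0" unfolding I_def by (intro integral_nonneg_AE) auto
  \<comment> \<open>The summand 1 only makes the constant positive when the gradient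
    vanishes.\<close>
  have main: "\<mu> l * (l - h) powr p \<le> (K * I + 1) * \<mu> h powr (p / DIM('a))" if h: "0 < h" "h < l" for h l
  proof -
    obtain \<phi> :: "real \<Rightarrow> real" where sm: "\<And>k. C_k k \<phi>"
      and "\<And>t. 0 \<le> \<phi> t" "\<And>t. \<phi> t \<le> (l - h) / 2" and \<phi>0: "\<And>t. t \<le> h \<Longrightarrow> \<phi> t = 0"
      and \<phi>1: "\<And>t. l \<le> t \<Longrightarrow> \<phi> t = (l - h) / 2"
      and d: "\<And>t. 0 \<le> partial_deriv 1 \<phi> t" "\<And>t. partial_deriv 1 \<phi> t \<le> 1"
      using smooth_truncation[OF h(2)] by blast
    have "partial_deriv 1 \<phi> \<in> borel_measurable borel"
      using sm[of 1] by (simp add: borel_measurable_continuous_onI)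
    note [measurable] = this
    have le: "partial_deriv 1 \<phi> (u x) * norm (G x) powr p \<le> norm (G x) powr p" for x
      using d mult_right_mono[OF d(2)[of "u x"], of "norm (G x) powr p"] by simp
    have "integrable lborel (\<lambda>x. partial_deriv 1 \<phi> (u x) * norm (G x) powr p)"
      by (rule Bochner_Integration.integrable_bound[OF G_Lp])
        (use d le in \<open>auto intro!: AE_I2 simp: abs_mult\<close>)
    then have E: "energy \<phi> \<le> I"
      unfolding energy_def I_def by (intro integral_mono G_Lp le)
    have "\<mu> l * (l - h) powr p \<le> K * \<mu> h powr (p / DIM('a)) * energy \<phi>"
      unfolding K_def by (rule superlevel_energy[OF h sm d \<phi>0 \<phi>1])
    also have "\<dots> \<le> K * \<mu> h powr (p / DIM('a)) * I"
      using E K by (intro mult_left_mono) auto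
    also have "\<dots> \<le> (K * I + 1) * \<mu> h powr (p / DIM('a))" by (simp add: algebra_simps)
    finally show ?thesis .
  qed
  show thesis by (rule that[OF _ main]) (use K I in \<open>auto intro: add_nonneg_pos\<close>)
qed

text \<open>Testing with \<phi> o U n and letting n tend to infinity bounds the energy by the
  integral of u^(q-1) * \<phi>(u). As \<phi> is at most (l - h) / 2 and vanishes below h, this gains
  over \<open>superlevel_decay\<close> one factor l - h and an integral that decays in h.\<close>

lemma superlevel_decay_subsolution:
  assumes p1: "1 < p" and q: "1 \<le> q" and u0: "\<And>x. 0 \<le> u x"
    and sub: "\<And>v. v \<in> test_functions \<Longrightarrow> (\<And>x. 0 \<le> v x) \<Longrightarrow>
      (\<integral>x. (norm (G x) powr (p - 2) *\<^sub>R G x) \<bullet> grad v x \<partial>lborel) \<le> (\<integral>x. u x powr (q - 1) * v x \<partial>lborel)"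
    and int: "\<And>t. t > 0 \<Longrightarrow> integrable lborel (\<lambda>x. u x powr (q - 1) * indicator {x. t < u x} x)"
  obtains C where "C > 0" "\<And>h l. 0 < h \<Longrightarrow> h < l \<Longrightarrow> \<mu> l * (l - h) powr p
    \<le> C * (l - h) * \<mu> h powr (p / DIM('a)) * (\<integral>x. u x powr (q - 1) * indicator {x. h < u x} x \<partial>lborel)"
proof -
  define K where "K = 2 * 4 powr p * (2 / unit_ball_vol DIM('a)) powr (p / DIM('a))"
  have "unit_ball_vol (real DIM('a)) \<noteq> 0" by (rule less_imp_neq[THEN not_sym]) simp
  then have K: "K > 0" unfolding K_def by (intro mult_pos_pos) auto
  obtain U D where U: "\<And>n k. C_k k (U n)"
    and Uinf: "\<And>n e. e > 0 \<Longrightarrow> \<exists>R. \<forall>x. R < norm x \<longrightarrow> \<bar>U n x\<bar> < e"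
    and D: "integrable lborel D" "\<And>x. D x \<ge> 0"
    and UD: "\<And>n. AE x in lborel. \<bar>U n x - u x\<bar> powr p \<le> D x"
    and gD: "\<And>n::nat. AE x in lborel. norm (grad (U n) x - G x) powr p \<le> D x"
    and Ulim: "AE x in lborel. (\<lambda>n. U n x) \<longlonglongrightarrow> u x"
    and glim: "AE x in lborel. (\<lambda>n. grad (U n) x) \<longlonglongrightarrow> G x"
    using approximating_sequence by blast
  have main: "\<mu> l * (l - h) powr p
    \<le> K * (l - h) * \<mu> h powr (p / DIM('a)) * (\<integral>x. u x powr (q - 1) * indicator {x. h < u x} x \<partial>lborel)"
    (is "_ \<le> _ * ?I")
    if h: "0 < h" "h < l" for h l
  proof -
    obtain \<phi> :: "real \<Rightarrow> real" where sm: "\<And>k. C_k k \<phi>"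
      and b: "\<And>t. 0 \<le> \<phi> t" "\<And>t. \<phi> t \<le> (l - h) / 2" and \<phi>0: "\<And>t. t \<le> h \<Longrightarrow> \<phi> t = 0"
      and \<phi>1: "\<And>t. l \<le> t \<Longrightarrow> \<phi> t = (l - h) / 2"
      and d: "\<And>t. 0 \<le> partial_deriv 1 \<phi> t" "\<And>t. partial_deriv 1 \<phi> t \<le> 1"
      using smooth_truncation[OF h(2)] by blast
    let ?\<phi>' = "partial_deriv 1 \<phi>" and ?L = "(l - h) / 2"
    have \<phi>c: "continuous_on UNIV \<phi>" "continuous_on UNIV ?\<phi>'" using sm[of 0] sm[of 1] by auto
    have [measurable]: "\<phi> \<in> borel_measurable borel" "?\<phi>' \<in> borel_measurable borel"
      "U n \<in> borel_measurable borel" "grad (U n) \<in> borel_measurable borel" for n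
      using \<phi>c U[of 0 n] continuous_grad[OF U[of 1 n]] by (auto intro: borel_measurable_continuous_onI)
    define F where "F x = norm (G x) powr (p - 2) *\<^sub>R G x" for x
    have [measurable]: "F \<in> borel_measurable borel" unfolding F_def[abs_def] by measurable
    \<comment> \<open>Where G x = 0 both sides vanish because \<open>0 powr a\<close> is 0 for every
      a, also when p < 2.\<close>
    have Fn: "norm (F x) = norm (G x) powr (p - 1)" for x
      using p1 powr_add[of "norm (G x)" "p - 2" 1] by (cases "G x = 0") (auto simp: F_def)
    have FG: "F x \<bullet> G x = norm (G x) powr p" for x
      using powr_add[of "norm (G x)" "p - 2" 2]
      by (cases "G x = 0") (auto simp: F_def dot_square_norm)
    have vt: "(\<lambda>x. \<phi> (U n x)) \<in> test_functions" for n
    proof -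
      obtain R where "\<forall>x. R < norm x \<longrightarrow> \<bar>U n x\<bar> < h" using Uinf[OF h(1)] by blast
      then have "\<forall>x. R < norm x \<longrightarrow> \<phi> (U n x) = 0" using \<phi>0 by (auto simp: abs_less_iff)
      then show ?thesis unfolding test_functions_iff using C_k_compose[OF sm U] by blast
    qed
    let ?f = "\<lambda>n x. F x \<bullet> grad (\<lambda>x. \<phi> (U n x)) x"
    have f_eq: "?f n x = ?\<phi>' (U n x) * (F x \<bullet> grad (U n) x)" for n x
      by (simp add: grad_compose[OF sm U])
    have lim1: "(\<lambda>n. integral\<^sup>L lborel (?f n)) \<longlonglongrightarrow> energy \<phi>"
      unfolding energy_def f_eq
    proof (rule integral_dominated_convergence)
      show "integrable lborel (\<lambda>x. norm (G x) powr p + 2 powr p * (D x + norm (G x) powr p))"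
        using D(1) G_Lp by simp
      show "AE x in lborel. (\<lambda>n. ?\<phi>' (U n x) * (F x \<bullet> grad (U n) x)) \<longlonglongrightarrow> ?\<phi>' (u x) * norm (G x) powr p"
        using Ulim glim
      proof eventually_elim
        case (elim x)
        have "(\<lambda>n. ?\<phi>' (U n x)) \<longlonglongrightarrow> ?\<phi>' (u x)"
          using \<phi>c(2) elim(1) by (auto intro: continuous_on_tendsto_compose)
        moreover have "(\<lambda>n. F x \<bullet> grad (U n) x) \<longlonglongrightarrow> F x \<bullet> G x"
          using elim(2) by (intro tendsto_inner tendsto_const)
        ultimately show ?case unfolding FG[symmetric] by (rule tendsto_mult)
      qed
      show "AE x in lborel. norm (?\<phi>' (U n x) * (F x \<bullet> grad (U n) x))
          \<le> norm (G x) powr p + 2 powr p * (D x + norm (G x) powr p)" for n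
        using gD[of n]
      proof eventually_elim
        case (elim x)
        let ?g = "norm (grad (U n) x)" and ?G = "norm (G x)"
        have "norm (?\<phi>' (U n x) * (F x \<bullet> grad (U n) x)) \<le> 1 * (?G powr (p - 1) * ?g)"
          unfolding norm_mult using d Fn[of x] Cauchy_Schwarz_ineq2[of "F x" "grad (U n) x"]
          by (intro mult_mono) auto
        \<comment> \<open>In place of Young's inequality for products, both factors are estimated by
          the larger of the two norms.\<close>
        also have "\<dots> \<le> ?G powr p + ?g powr p"
        proof (cases "?g \<le> ?G")
          case True
          then have "?G powr (p - 1) * ?g \<le> ?G powr (p - 1) * ?G" by (intro mult_left_mono) auto
          also have "\<dots> = ?G powr p" using powr_add[of ?G "p - 1" 1] by simp
          finally show ?thesis by (simp add: add_increasing2)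
        next
          case False
          then have "?G powr (p - 1) * ?g \<le> ?g powr (p - 1) * ?g"
            using p1 by (intro mult_right_mono powr_mono2) auto
          also have "\<dots> = ?g powr p" using powr_add[of ?g "p - 1" 1] by simp
          finally show ?thesis by (simp add: add_increasing)
        qed
        also have "?g powr p \<le> 2 powr p * (norm (grad (U n) x - G x) powr p + ?G powr p)"
          by (rule norm_powr_le_difference)
        also have "\<dots> \<le> 2 powr p * (D x + ?G powr p)" using elim by simp
        finally show ?case by simp
      qed
    qed measurable
    \<comment> \<open>Weight of D on the bad set u \<le> h / 2 where nevertheless U n > h. There |U
      n - u| is at least h / 2, so 1 \<le> (2 / h)^p * D, and u^(q-1) is at most (h / 2)^(q-1). Off
      this set either u > h / 2, where \<open>int\<close> applies, or \<phi>(U n) is 0.\<close>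
    let ?c = "?L * ((h / 2) powr (q - 1) * (2 / h) powr p)"
    have c0: "?c \<ge> 0" using h by simp
    have lim2: "(\<lambda>n. \<integral>x. u x powr (q - 1) * \<phi> (U n x) \<partial>lborel)
        \<longlonglongrightarrow> (\<integral>x. u x powr (q - 1) * \<phi> (u x) \<partial>lborel)"
    proof (rule integral_dominated_convergence)
      show "integrable lborel (\<lambda>x. ?L * (u x powr (q - 1) * indicator {x. h / 2 < u x} x) + ?c * D x)"
        using int[of "h / 2"] h D(1) by (intro Bochner_Integration.integrable_add integrable_mult_right) auto
      show "AE x in lborel. (\<lambda>n. u x powr (q - 1) * \<phi> (U n x)) \<longlonglongrightarrow> u x powr (q - 1) * \<phi> (u x)"
        using Ulim
      proof eventually_elim
        case (elim x)
        have "(\<lambda>n. \<phi> (U n x)) \<longlonglongrightarrow> \<phi> (u x)"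
          using \<phi>c(1) elim by (auto intro: continuous_on_tendsto_compose)
        then show ?case by (rule tendsto_mult_left)
      qed
      show "AE x in lborel. norm (u x powr (q - 1) * \<phi> (U n x))
          \<le> ?L * (u x powr (q - 1) * indicator {x. h / 2 < u x} x) + ?c * D x" for n
        using UD[of n]
      proof eventually_elim
        case (elim x)
        show ?case
        proof (cases "h / 2 < u x")
          case True
          have "u x powr (q - 1) * \<phi> (U n x) \<le> u x powr (q - 1) * ?L"
            using b by (intro mult_left_mono) auto
          moreover have "0 \<le> ?c * D x" using c0 D(2) by simp
          ultimately show ?thesis using True b by (simp add: abs_mult mult.commute)
        next
          case False
          show ?thesis
          proof (cases "U n x \<le> h")
            case True
            moreover have "0 \<le> ?c * D x" using c0 D(2) by simp
            ultimately show ?thesis using \<phi>0[of "U n x"] False by simp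
          next
            case U: False
            have "(h / 2) powr p \<le> \<bar>U n x - u x\<bar> powr p"
              using U False h p by (intro powr_mono2) auto
            then have "(h / 2) powr p \<le> D x" using elim by simp
            then have "(2 / h) powr p * (h / 2) powr p \<le> (2 / h) powr p * D x"
              by (intro mult_left_mono) auto
            then have 1: "1 \<le> (2 / h) powr p * D x" using h by (simp add: powr_mult[symmetric])
            have "u x powr (q - 1) * \<phi> (U n x) \<le> (h / 2) powr (q - 1) * ?L"
              using False u0 q b by (intro mult_mono powr_mono2) auto
            also have "\<dots> \<le> (h / 2) powr (q - 1) * ?L * ((2 / h) powr p * D x)"
              using mult_left_mono[OF 1, of "(h / 2) powr (q - 1) * ?L"] h by simp
            finally show ?thesis using False b by (simp add: abs_mult mult_ac)
          qed
        qed
      qed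
    qed measurable
    have "energy \<phi> \<le> (\<integral>x. u x powr (q - 1) * \<phi> (u x) \<partial>lborel)"
    proof (rule LIMSEQ_le[OF lim1 lim2])
      show "\<exists>N. \<forall>n\<ge>N. integral\<^sup>L lborel (?f n) \<le> (\<integral>x. u x powr (q - 1) * \<phi> (U n x) \<partial>lborel)"
        using sub[OF vt] b by (auto simp: F_def)
    qed
    also have "\<dots> \<le> (\<integral>x. ?L * (u x powr (q - 1) * indicator {x. h < u x} x) \<partial>lborel)"
    proof (rule integral_mono)
      show i: "integrable lborel (\<lambda>x. ?L * (u x powr (q - 1) * indicator {x. h < u x} x))"
        using int[OF h(1)] by (rule integrable_mult_right)
      show le: "u x powr (q - 1) * \<phi> (u x) \<le> ?L * (u x powr (q - 1) * indicator {x. h < u x} x)" for x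
        using b(2)[of "u x"] \<phi>0[of "u x"] mult_left_mono[OF b(2)[of "u x"], of "u x powr (q - 1)"]
        by (cases "h < u x") (auto simp: mult.commute)
      show "integrable lborel (\<lambda>x. u x powr (q - 1) * \<phi> (u x))"
        by (rule Bochner_Integration.integrable_bound[OF i])
          (use le b h in \<open>auto intro!: AE_I2 simp: abs_mult\<close>)
    qed
    also have "\<dots> = ?L * ?I" by (rule integral_mult_right_zero)
    finally have E: "energy \<phi> \<le> ?L * ?I" .
    have I0: "?I \<ge> 0" by (intro integral_nonneg_AE) auto
    have "\<mu> l * (l - h) powr p \<le> K * \<mu> h powr (p / DIM('a)) * energy \<phi>"
      unfolding K_def by (rule superlevel_energy[OF h sm d \<phi>0 \<phi>1])
    also have "\<dots> \<le> K * \<mu> h powr (p / DIM('a)) * ((l - h) * ?I)"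
    proof (intro mult_left_mono)
      have "?L * ?I \<le> (l - h) * ?I" using h I0 by (intro mult_right_mono) auto
      then show "energy \<phi> \<le> (l - h) * ?I" using E by linarith
    qed (use K in auto)
    finally show ?thesis by (simp add: mult_ac)
  qed
  show thesis by (rule that[OF K main])
qed

end

section \<open>Decay of the distribution function\<close>

lemma half_powr_minus:
  fixes t x :: real
  assumes "t > 0"
  shows "(t / 2) powr - x = 2 powr x * t powr - x"
  using assms by (simp add: powr_divide) (simp add: powr_minus field_simps)

text \<open>The choice h = t / 2, l = t turns a decay rate r into p + \<kappa> r. Iterating from r =
  p yields p times the partial sums of the geometric series.\<close>

lemma decay_bootstrap:
  fixes \<mu> :: "real \<Rightarrow> real" and p \<kappa> :: real
  assumes p: "0 < p" and \<kappa>: "0 \<le> \<kappa>" and \<mu>0: "\<And>t. 0 \<le> \<mu> t" and C: "0 < C"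
    and base: "\<And>t. t > 0 \<Longrightarrow> \<mu> t \<le> A * t powr - p"
    and step: "\<And>h l. 0 < h \<Longrightarrow> h < l \<Longrightarrow> \<mu> l * (l - h) powr p \<le> C * \<mu> h powr \<kappa>"
  shows "\<exists>A>0. \<forall>t>0. \<mu> t \<le> A * t powr - (p * (\<Sum>i\<le>j. \<kappa> ^ i))"
proof (induction j)
  case 0
  have "\<mu> t \<le> max A 1 * t powr - p" if "t > 0" for t
  proof -
    have "A * t powr - p \<le> max A 1 * t powr - p" by (intro mult_right_mono) auto
    then show ?thesis using base[OF that] by linarith
  qed
  then show ?case by (intro exI[of _ "max A 1"]) auto
next
  case (Suc j)
  define r where "r = p * (\<Sum>i\<le>j. \<kappa> ^ i)"
  have r': "p * (\<Sum>i\<le>Suc j. \<kappa> ^ i) = p + \<kappa> * r"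
    by (subst sum.atMost_Suc_shift) (simp add: r_def sum_distrib_left algebra_simps)
  obtain B where B: "B > 0" "\<And>t. t > 0 \<Longrightarrow> \<mu> t \<le> B * t powr - r"
    using Suc by (auto simp: r_def)
  have "\<mu> t \<le> (C * B powr \<kappa> * 2 powr (p + \<kappa> * r)) * t powr - (p + \<kappa> * r)" if t: "t > 0" for t
  proof -
    have "\<mu> t * (t / 2) powr p = \<mu> t * (t - t / 2) powr p" by simp
    also have "\<dots> \<le> C * \<mu> (t / 2) powr \<kappa>" using t by (intro step) auto
    also have "\<dots> \<le> C * (B * (t / 2) powr - r) powr \<kappa>"
      using B(2)[of "t / 2"] t \<mu>0 \<kappa> C by (intro mult_left_mono powr_mono2) auto
    also have "\<dots> = C * B powr \<kappa> * (t / 2) powr - (\<kappa> * r)"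
      using B t by (simp add: powr_mult powr_powr mult.commute)
    finally have "\<mu> t * (t / 2) powr p * (t / 2) powr - p
        \<le> C * B powr \<kappa> * (t / 2) powr - (\<kappa> * r) * (t / 2) powr - p"
      by (intro mult_right_mono) auto
    then have "\<mu> t \<le> C * B powr \<kappa> * (t / 2) powr - (p + \<kappa> * r)"
      using t by (simp add: mult.assoc add.commute flip: powr_add)
    also have "(t / 2) powr - (p + \<kappa> * r) = 2 powr (p + \<kappa> * r) * t powr - (p + \<kappa> * r)"
      by (rule half_powr_minus[OF t])
    finally show ?thesis by (simp add: mult_ac)
  qed
  moreover have "C * B powr \<kappa> * 2 powr (p + \<kappa> * r) > 0" using C B by simp
  ultimately show ?case unfolding r' by blast
qed

text \<open>Every rate below p times the full geometric sum is exceeded after finitely many steps;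
  for \<kappa> = p / N the supremum p / (1 - \<kappa>) is the Sobolev exponent.\<close>

lemma decay_exponent_limit:
  fixes \<kappa> :: real
  assumes "0 < \<kappa>" "\<kappa> < 1" "s < p / (1 - \<kappa>)"
  obtains j where "s < p * (\<Sum>i\<le>j. \<kappa> ^ i)"
proof -
  have "(\<lambda>n. \<Sum>i<n. \<kappa> ^ i) \<longlonglongrightarrow> 1 / (1 - \<kappa>)"
    using geometric_sums[of \<kappa>] assms by (simp add: sums_def)
  then have "(\<lambda>n. \<Sum>i\<le>n. \<kappa> ^ i) \<longlonglongrightarrow> 1 / (1 - \<kappa>)"
    using LIMSEQ_Suc by (fastforce simp: lessThan_Suc_atMost)
  then have "(\<lambda>n. p * (\<Sum>i\<le>n. \<kappa> ^ i)) \<longlonglongrightarrow> p * (1 / (1 - \<kappa>))"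
    by (rule tendsto_mult_left)
  then have "\<forall>\<^sub>F n in sequentially. s < p * (\<Sum>i\<le>n. \<kappa> ^ i)"
    using assms by (intro order_tendstoD(1)) auto
  then show thesis using that by (auto simp: eventually_sequentially)
qed

text \<open>De Giorgi's iteration along the levels \<open>M * (2 - 2 ^ - j)\<close>. Here \<open>I h\<close> plays the role of
  the integral of \<open>u ^ (q - 1)\<close> over \<open>{u > h}\<close>; the gain \<open>\<delta>\<close> below is positive since \<open>q\<close> is subcritical.\<close>

lemma De_Giorgi_iteration:
  fixes \<mu> I :: "real \<Rightarrow> real" and p q \<kappa> r :: real
  assumes p: "1 < p" and \<kappa>: "0 < \<kappa>" and r: "q - 1 < r" "(q - p) / \<kappa> < r" and pq: "p < q"
    and \<mu>0: "\<And>t. 0 \<le> \<mu> t" and I0: "\<And>t. 0 \<le> I t" and C: "0 < C" "0 < c" and A: "0 < A"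
    and base: "\<And>t. t > 0 \<Longrightarrow> \<mu> t \<le> A * t powr - r"
    and tail: "\<And>h a. 0 < h \<Longrightarrow> 0 < a \<Longrightarrow> (\<And>s. h \<le> s \<Longrightarrow> \<mu> s \<le> a * s powr - r) \<Longrightarrow>
      I h \<le> c * a * h powr (q - 1 - r)"
    and step: "\<And>h l. 0 < h \<Longrightarrow> h < l \<Longrightarrow> \<mu> l * (l - h) powr p \<le> C * (l - h) * \<mu> h powr \<kappa> * I h"
  shows "\<exists>M>0. \<mu> M = 0"
proof -
  \<comment> \<open>The surplus of decay: \<open>improve\<close> first produces s^(-r-\<delta>), and
    the excess s^(-\<delta>), bounded by h^(-\<delta>), is what a large level makes small.\<close>
  define \<delta> where "\<delta> = r * \<kappa> - (q - p)"
  have \<delta>: "\<delta> > 0" using r(2) \<kappa> by (simp add: \<delta>_def field_simps)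
  \<comment> \<open>The total decay rate of \<mu> s' powr \<kappa> and I s' together: r \<kappa>
    from the first, r - (q - 1) from the second.\<close>
  define e where "e = r + r * \<kappa> - (q - 1)"
  have e: "e > 0" "e = \<delta> + r + 1 - p" using r(1) \<kappa> p pq by (simp_all add: e_def \<delta>_def algebra_simps)
    (smt (verit) mult_pos_pos)
  define K where "K = C * c * 2 powr e"
  have K: "K > 0" using C by (simp add: K_def)
  have improve: "\<mu> s \<le> K * a powr (1 + \<kappa>) * ((l - h) / l) powr (1 - p) * h powr - \<delta> * s powr - r"
    if h: "0 < h" "h < l" "l \<le> 2 * h" and a: "0 < a" and le: "\<And>s. h \<le> s \<Longrightarrow> \<mu> s \<le> a * s powr - r" and s: "l \<le> s"
    for h l a s
  proof -
    \<comment> \<open>The bound is wanted for every s \<ge> l, so the lower level scales with s: s'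
      / s = h / l preserves the relative gap (l - h) / l, and l \<le> 2 h gives s' \<ge> s /
      2.\<close>
    define s' where "s' = s * h / l"
    have s0: "s > 0" using h s by simp
    have s': "h \<le> s'" "s' < s" "s / 2 \<le> s'"
      using h s by (simp_all add: s'_def field_simps)
    have s'0: "s' > 0" using s' h by simp
    have d: "s - s' = s * ((l - h) / l)" using h by (simp add: s'_def field_simps)
    define d where "d = s - s'"
    have d0: "d > 0" using s' by (simp add: d_def)
    have "I s' \<le> c * a * s' powr (q - 1 - r)"
      using s'0 a le s' by (intro tail) auto
    moreover have "\<mu> s' powr \<kappa> \<le> (a * s' powr - r) powr \<kappa>"
      using le[OF s'(1)] \<mu>0 \<kappa> by (intro powr_mono2) auto
    moreover have "(a * s' powr - r) powr \<kappa> = a powr \<kappa> * s' powr - (r * \<kappa>)"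
      using a s'0 by (simp add: powr_mult powr_powr)
    ultimately have "\<mu> s' powr \<kappa> * I s' \<le> (a powr \<kappa> * s' powr - (r * \<kappa>)) * (c * a * s' powr (q - 1 - r))"
      using C a I0 by (intro mult_mono') auto
    then have "\<mu> s' powr \<kappa> * I s' \<le> c * (a powr \<kappa> * a) * (s' powr - (r * \<kappa>) * s' powr (q - 1 - r))"
      by (simp add: mult_ac)
    also have "a powr \<kappa> * a = a powr (1 + \<kappa>)" using a by (simp add: powr_add mult.commute)
    also have "s' powr - (r * \<kappa>) * s' powr (q - 1 - r) = s' powr - e"
      by (simp add: e_def algebra_simps flip: powr_add)
    also have "s' powr - e \<le> (s / 2) powr - e"
      using s' s0 e by (intro powr_mono2') auto
    finally have X: "\<mu> s' powr \<kappa> * I s' \<le> c * a powr (1 + \<kappa>) * (s / 2) powr - e"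
      using C a by (simp add: mult_left_mono)
    have "\<mu> s * d powr p \<le> C * d * (\<mu> s' powr \<kappa> * I s')"
      using step[OF s'0 s'(2)] by (simp add: d_def mult.assoc)
    also have "\<dots> \<le> C * d * (c * a powr (1 + \<kappa>) * (s / 2) powr - e)"
      using C d0 X by (intro mult_left_mono) auto
    finally have "\<mu> s * d powr p * d powr - p \<le> C * d * (c * a powr (1 + \<kappa>) * (s / 2) powr - e) * d powr - p"
      by (intro mult_right_mono) auto
    then have "\<mu> s \<le> C * (d powr 1 * d powr - p) * (c * a powr (1 + \<kappa>) * (s / 2) powr - e)"
      using d0 by (simp add: mult_ac powr_minus_divide)
    also have "d powr 1 * d powr - p = d powr (1 - p)" by (simp only: powr_add[symmetric]) simp
    also have "d powr (1 - p) = s powr (1 - p) * ((l - h) / l) powr (1 - p)"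
      using s0 h unfolding d_def d by (subst powr_mult) auto
    also have "(s / 2) powr - e = 2 powr e * s powr - e"
      by (rule half_powr_minus[OF s0])
    also have "C * (s powr (1 - p) * ((l - h) / l) powr (1 - p)) * (c * a powr (1 + \<kappa>) * (2 powr e * s powr - e))
        = K * a powr (1 + \<kappa>) * ((l - h) / l) powr (1 - p) * (s powr (1 - p) * s powr - e)"
      by (simp add: K_def mult_ac)
    also have "s powr (1 - p) * s powr - e = s powr - \<delta> * s powr - r"
    proof -
      have "1 - p + - e = - \<delta> + - r" by (simp add: e(2))
      then show ?thesis by (simp only: powr_add[symmetric])
    qed
    also have "K * a powr (1 + \<kappa>) * ((l - h) / l) powr (1 - p) * (s powr - \<delta> * s powr - r)
        \<le> K * a powr (1 + \<kappa>) * ((l - h) / l) powr (1 - p) * (h powr - \<delta> * s powr - r)"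
      using K h s \<delta> by (intro mult_left_mono mult_right_mono powr_mono2') auto
    finally show ?thesis by (simp add: mult.assoc)
  qed
  \<comment> \<open>The relative gap of consecutive levels is at least (1/2)^(j+2). Its power 1 - p
    in \<open>improve\<close> is at most B^(j+2), the price of shrinking gaps.\<close>
  define B where "B = 2 powr (p - 1)"
  have B: "B > 1" using p by (simp add: B_def)
  \<comment> \<open>Chosen so that B * \<theta>^\<kappa> = 1: the constant A * \<theta>^j enters
    \<open>improve\<close> with exponent 1 + \<kappa>, and the extra factor \<theta>^(\<kappa> j)
    cancels the growth B^j.\<close>
  define \<theta> where "\<theta> = B powr - (1 / \<kappa>)"
  have "\<theta> powr \<kappa> = B powr - 1" using \<kappa> by (simp add: \<theta>_def powr_powr)
  then have \<theta>3: "B * \<theta> powr \<kappa> = 1" using B by (simp add: powr_minus)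
  have \<theta>: "0 < \<theta>" "\<theta> < 1"
    using B \<kappa> powr_less_mono[of "- (1 / \<kappa>)" 0 B] by (simp_all add: \<theta>_def)
  obtain M where M: "M > 0" "K * A powr \<kappa> * B\<^sup>2 * M powr - \<delta> \<le> \<theta>"
  proof -
    let ?X = "K * A powr \<kappa> * B\<^sup>2"
    \<comment> \<open>Solves ?X * M^(-\<delta>) = \<theta>, so that what remains after the
      cancellation is exactly one further factor \<theta>.\<close>
    define M where "M = (\<theta> / ?X) powr - (1 / \<delta>)"
    have "M > 0" using \<theta> K A B by (simp add: M_def)
    moreover have "M powr - \<delta> = \<theta> / ?X" using \<theta> K A B \<delta> by (simp add: M_def powr_powr)
    then have "?X * M powr - \<delta> = \<theta>" using K A B by simp
    ultimately show thesis using that by simp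
  qed
  \<comment> \<open>All levels lie in [M, 2 M]: consecutive ones satisfy l \<le> 2 h, as
    \<open>improve\<close> requires, and every bound obtained applies at 2 M, where \<theta>^j tends
    to 0.\<close>
  define k where "k j = M * (2 - (1 / 2) ^ j)" for j
  have k0: "M \<le> k j" "k j \<le> 2 * M" for j
    using M power_le_one[of "1/2::real" j] by (simp_all add: k_def)
  have main: "\<forall>s\<ge>k j. \<mu> s \<le> (A * \<theta> ^ j) * s powr - r" for j
  proof (induction j)
    case 0
    show ?case using base M(1) by (auto simp: k_def)
  next
    case (Suc j)
    show ?case
    proof (intro allI impI)
      fix s assume s: "k (Suc j) \<le> s"
      let ?a = "A * \<theta> ^ j"
      have a: "?a > 0" using A \<theta> by simp
      have dk: "k (Suc j) - k j = M * (1 / 2) ^ (j + 1)" by (simp add: k_def algebra_simps)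
      have lt: "k j < k (Suc j)" using dk M by (smt (verit) mult_pos_pos zero_less_power zero_less_divide_1_iff)
      have kj: "k j > 0" using k0(1)[of j] M by linarith
      have "\<mu> s \<le> K * ?a powr (1 + \<kappa>) * ((k (Suc j) - k j) / k (Suc j)) powr (1 - p) * k j powr - \<delta> * s powr - r"
        using Suc k0(2)[of "Suc j"] k0(1)[of j]
        by (intro improve lt kj a s) (auto intro: order_trans)
      also have "\<dots> \<le> K * ?a powr (1 + \<kappa>) * (B ^ (j + 2)) * M powr - \<delta> * s powr - r"
      proof (intro mult_right_mono mult_mono mult_left_mono)
        have q: "(1 / 2) ^ (j + 2) \<le> (k (Suc j) - k j) / k (Suc j)"
        proof -
          have "(1 / 2) ^ (j + 2) * k (Suc j) \<le> (1 / 2) ^ (j + 2) * (2 * M)"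
            using k0(2) by (intro mult_left_mono) auto
          also have "\<dots> = k (Suc j) - k j" by (simp add: dk)
          finally show ?thesis using lt kj by (simp add: pos_le_divide_eq)
        qed
        have "((k (Suc j) - k j) / k (Suc j)) powr (1 - p) \<le> ((1 / 2) ^ (j + 2)) powr (1 - p)"
          using q p by (intro powr_mono2') auto
        also have "\<dots> = B ^ (j + 2)"
        proof -
          have "((1 / 2) ^ (j + 2)) powr (1 - p) = ((1 / 2) powr real (j + 2)) powr (1 - p)"
            by (subst powr_realpow) auto
          also have "\<dots> = (1 / 2) powr (real (j + 2) * (1 - p))" by (rule powr_powr)
          also have "\<dots> = ((1 / 2) powr (1 - p)) ^ (j + 2)" by (subst powr_power) auto
          also have "(1 / 2) powr (1 - p) = B" by (simp add: B_def powr_divide powr_minus_divide[symmetric])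
          finally show ?thesis .
        qed
        finally show "((k (Suc j) - k j) / k (Suc j)) powr (1 - p) \<le> B ^ (j + 2)" .
        show "k j powr - \<delta> \<le> M powr - \<delta>" using k0(1)[of j] M \<delta> by (intro powr_mono2') auto
      qed (use K B in auto)
      also have "K * ?a powr (1 + \<kappa>) * B ^ (j + 2) * M powr - \<delta>
          = ?a * (B * \<theta> powr \<kappa>) ^ j * (K * A powr \<kappa> * B\<^sup>2 * M powr - \<delta>)"
      proof -
        have "?a powr (1 + \<kappa>) = ?a * ?a powr \<kappa>" using a by (simp add: powr_add)
        also have "?a powr \<kappa> = A powr \<kappa> * (\<theta> powr \<kappa>) ^ j"
          using A \<theta> by (simp add: powr_mult powr_realpow[symmetric] powr_powr mult.commute)
        finally show ?thesis by (simp add: power_mult_distrib power_add power2_eq_square mult_ac)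
      qed
      also have "\<dots> = ?a * (K * A powr \<kappa> * B\<^sup>2 * M powr - \<delta>)" by (simp add: \<theta>3)
      also have "?a * (K * A powr \<kappa> * B\<^sup>2 * M powr - \<delta>) * s powr - r \<le> ?a * \<theta> * s powr - r"
        using M(2) a by (intro mult_right_mono mult_left_mono) auto
      finally show "\<mu> s \<le> (A * \<theta> ^ Suc j) * s powr - r" by (simp add: mult_ac)
    qed
  qed
  have lim: "(\<lambda>j. (A * \<theta> ^ j) * (2 * M) powr - r) \<longlonglongrightarrow> (A * 0) * (2 * M) powr - r"
    using \<theta> by (intro tendsto_intros LIMSEQ_power_zero) auto
  have "\<mu> (2 * M) \<le> (A * \<theta> ^ j) * (2 * M) powr - r" for j using main k0(2) by blast
  then have "\<mu> (2 * M) \<le> (A * 0) * (2 * M) powr - r"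
    by (intro LIMSEQ_le_const[OF lim] exI[of _ 0]) auto
  then show ?thesis using \<mu>0[of "2 * M"] M(1) by (intro exI[of _ "2 * M"]) auto
qed

section \<open>Boundedness\<close>

context sobolev_pair
begin

text \<open>Dyadic layers in place of the layer-cake formula: on {2^i h < u \<le> 2^(i+1) h} the
  integrand is at most (2^(i+1) h)^(q-1), and the decay of \<mu> makes the layers a geometric series
  of ratio 2^(q-1-r), which is less than 1 since r > q - 1.\<close>

lemma superlevel_integral_le:
  assumes u0: "\<And>x. 0 \<le> u x" and q: "1 \<le> q" "q - 1 < r" and h: "0 < h" and a: "0 < a"
    and le: "\<And>s. h \<le> s \<Longrightarrow> \<mu> s \<le> a * s powr - r"
  shows "integrable lborel (\<lambda>x. u x powr (q - 1) * indicator {x. h < u x} x)" (is "integrable _ ?f")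
    and "(\<integral>x. u x powr (q - 1) * indicator {x. h < u x} x \<partial>lborel)
      \<le> 2 powr (q - 1) / (1 - 2 powr (q - 1 - r)) * a * h powr (q - 1 - r)"
proof -
  define \<rho> where "\<rho> = 2 powr (q - 1 - r)"
  have \<rho>: "0 < \<rho>" "\<rho> < 1" using q powr_less_mono[of "q - 1 - r" 0 2] by (simp_all add: \<rho>_def)
  define k where "k i = 2 ^ i * h" for i :: nat
  have k: "k i > 0" "h \<le> k i" for i
    using h one_le_power[of "2::real" i] by (simp_all add: k_def)
  have dyadic: "ennreal (?f x) \<le> (\<Sum>i. ennreal (k (Suc i) powr (q - 1)) * indicator {x. k i < u x} x)" for x
  proof (cases "h < u x")
    case True
    obtain n where "u x / h < 2 ^ n" using real_arch_pow[of 2 "u x / h"] by auto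
    then have ex: "u x \<le> k n" using h by (simp add: k_def field_simps)
    \<comment> \<open>The least such n is positive, and its predecessor i gives the layer k i < u x
      \<le> k (Suc i); the i-th term of the series alone then dominates.\<close>
    define n where "n = (LEAST n. u x \<le> k n)"
    have n: "u x \<le> k n" unfolding n_def by (rule LeastI[of _ n]) (rule LeastI[of "\<lambda>n. u x \<le> k n", OF ex])
    have "n \<noteq> 0"
    proof
      assume "n = 0"
      then have "u x \<le> h" using n unfolding k_def by simp
      then show False using True by simp
    qed
    then obtain i where i: "n = Suc i" by (cases n) auto
    have "\<not> u x \<le> k i" using not_less_Least[of i "\<lambda>n. u x \<le> k n"] i by (simp add: n_def)
    then have "ennreal (?f x) \<le> ennreal (k (Suc i) powr (q - 1)) * indicator {x. k i < u x} x"
      using n i True u0 q by (auto intro!: ennreal_leI powr_mono2)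
    also have "\<dots> \<le> (\<Sum>i. ennreal (k (Suc i) powr (q - 1)) * indicator {x. k i < u x} x)"
    proof -
      have "f i \<le> (\<Sum>i. f i)" for f :: "nat \<Rightarrow> ennreal"
        using sum_le_suminf[of f "{i}"] by (simp add: summableI)
      then show ?thesis .
    qed
    finally show ?thesis .
  qed simp
  have term_le: "k (Suc i) powr (q - 1) * \<mu> (k i) \<le> (2 powr (q - 1) * a * h powr (q - 1 - r)) * \<rho> ^ i" for i
  proof -
    have "k (Suc i) powr (q - 1) * \<mu> (k i) \<le> (2 powr (q - 1) * k i powr (q - 1)) * (a * k i powr - r)"
    proof (intro mult_mono le k)
      have "k (Suc i) = 2 * k i" by (simp add: k_def)
      then show "k (Suc i) powr (q - 1) \<le> 2 powr (q - 1) * k i powr (q - 1)"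
        by (simp add: powr_mult)
    qed (auto simp: \<mu>_nonneg)
    also have "\<dots> = 2 powr (q - 1) * a * (k i powr (q - 1) * k i powr - r)" by (simp add: mult_ac)
    also have "k i powr (q - 1) * k i powr - r = k i powr (q - 1 - r)"
      by (simp only: powr_add[symmetric]) simp
    also have "k i powr (q - 1 - r) = (2 ^ i) powr (q - 1 - r) * h powr (q - 1 - r)"
      by (simp add: k_def powr_mult)
    also have "(2 ^ i) powr (q - 1 - r) = \<rho> ^ i"
    proof -
      have "(2 ^ i) powr (q - 1 - r) = (2 powr real i) powr (q - 1 - r)" by (subst powr_realpow) auto
      also have "\<dots> = 2 powr (real i * (q - 1 - r))" by (rule powr_powr)
      also have "\<dots> = \<rho> ^ i" unfolding \<rho>_def by (subst powr_power) auto
      finally show ?thesis .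
    qed
    finally show ?thesis by (simp add: mult_ac)
  qed
  define c where "c = 2 powr (q - 1) * a * h powr (q - 1 - r)"
  have c0: "c \<ge> 0" using a by (simp add: c_def)
  have sums: "(\<lambda>i. c * \<rho> ^ i) sums (c * (1 / (1 - \<rho>)))"
    using \<rho> by (intro sums_mult geometric_sums) auto
  have "(\<integral>\<^sup>+x. ennreal (?f x) \<partial>lborel)
      \<le> (\<integral>\<^sup>+x. (\<Sum>i. ennreal (k (Suc i) powr (q - 1)) * indicator {x. k i < u x} x) \<partial>lborel)"
    by (intro nn_integral_mono dyadic)
  also have "\<dots> = (\<Sum>i. \<integral>\<^sup>+x. ennreal (k (Suc i) powr (q - 1)) * indicator {x. k i < u x} x \<partial>lborel)"
    by (rule nn_integral_suminf) measurable
  also have "\<dots> = (\<Sum>i. ennreal (k (Suc i) powr (q - 1) * \<mu> (k i)))"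
    using k(1) by (subst nn_integral_cmult_indicator) (auto simp: emeasure_superlevel ennreal_mult \<mu>_nonneg)
  also have "\<dots> \<le> (\<Sum>i. ennreal (c * \<rho> ^ i))"
    using term_le by (intro suminf_le ennreal_leI) (auto simp: c_def)
  also have "\<dots> = ennreal (c * (1 / (1 - \<rho>)))"
    using sums c0 \<rho> by (subst suminf_ennreal2) (auto simp: sums_iff)
  finally have nn: "(\<integral>\<^sup>+x. ennreal (?f x) \<partial>lborel) \<le> ennreal (c * (1 / (1 - \<rho>)))" .
  show i: "integrable lborel ?f"
    using nn by (intro integrableI_nonneg) (auto simp: le_less_trans[OF _ ennreal_less_top] intro: le_less_trans)
  have "ennreal (integral\<^sup>L lborel ?f) \<le> ennreal (c * (1 / (1 - \<rho>)))"
    using nn by (subst nn_integral_eq_integral[OF i, symmetric]) auto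
  then have "integral\<^sup>L lborel ?f \<le> c * (1 / (1 - \<rho>))"
    using c0 \<rho> by (subst (asm) ennreal_le_iff) auto
  then show "integral\<^sup>L lborel ?f \<le> 2 powr (q - 1) / (1 - 2 powr (q - 1 - r)) * a * h powr (q - 1 - r)"
    by (simp add: c_def \<rho>_def mult_ac)
qed

theorem subsolution_bounded:
  assumes p1: "1 < p" "p < DIM('a)" and q: "p < q" "q < sobolev_exponent DIM('a) p"
    and u0: "\<And>x. 0 \<le> u x"
    and sub: "\<And>v. v \<in> test_functions \<Longrightarrow> (\<And>x. 0 \<le> v x) \<Longrightarrow>
      (\<integral>x. (norm (G x) powr (p - 2) *\<^sub>R G x) \<bullet> grad v x \<partial>lborel) \<le> (\<integral>x. u x powr (q - 1) * v x \<partial>lborel)"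
  shows "\<exists>M. AE x in lborel. u x \<le> M"
proof -
  define \<kappa> where "\<kappa> = p / DIM('a)"
  have \<kappa>: "0 < \<kappa>" "\<kappa> < 1" using p1 by (simp_all add: \<kappa>_def)
  have crit: "sobolev_exponent DIM('a) p = p / (1 - \<kappa>)"
    using p1 by (simp add: sobolev_exponent_def \<kappa>_def field_simps)
  obtain C where C: "C > 0" "\<And>h l. 0 < h \<Longrightarrow> h < l \<Longrightarrow> \<mu> l * (l - h) powr p \<le> C * \<mu> h powr \<kappa>"
    using superlevel_decay unfolding \<kappa>_def by blast
  \<comment> \<open>The second bound rearranges to q < p / (1 - \<kappa>), the subcriticality of q;
    the first follows from it.\<close>
  have "max (q - 1) ((q - p) / \<kappa>) < p / (1 - \<kappa>)"
    using q \<kappa> p1 by (simp add: crit field_simps)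
  then obtain j where j: "max (q - 1) ((q - p) / \<kappa>) < p * (\<Sum>i\<le>j. \<kappa> ^ i)"
    using decay_exponent_limit[OF \<kappa>] by metis
  define r where "r = p * (\<Sum>i\<le>j. \<kappa> ^ i)"
  have r: "q - 1 < r" "(q - p) / \<kappa> < r" using j by (simp_all add: r_def)
  have "\<exists>A>0. \<forall>t>0. \<mu> t \<le> A * t powr - r"
    unfolding r_def
    by (rule decay_bootstrap[OF _ _ \<mu>_nonneg C(1) superlevel_finite(2) C(2)]) (use p1 \<kappa> in auto)
  then obtain A where A: "A > 0" "\<And>t. t > 0 \<Longrightarrow> \<mu> t \<le> A * t powr - r" by blast
  have q1: "1 \<le> q" using p1 q by simp
  let ?I = "\<lambda>h. \<integral>x. u x powr (q - 1) * indicator {x. h < u x} x \<partial>lborel"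
  define c where "c = 2 powr (q - 1) / (1 - 2 powr (q - 1 - r))"
  have c: "c > 0" using r powr_less_mono[of "q - 1 - r" 0 2] by (simp add: c_def)
  \<comment> \<open>The bootstrapped decay, with r > q - 1, provides the integrability that testing
    the inequality presupposes.\<close>
  have int: "integrable lborel (\<lambda>x. u x powr (q - 1) * indicator {x. t < u x} x)" if "t > 0" for t
    by (rule superlevel_integral_le(1)[OF u0 q1 r(1) that A(1)]) (use A that in auto)
  obtain C' where C': "C' > 0" "\<And>h l. 0 < h \<Longrightarrow> h < l \<Longrightarrow>
      \<mu> l * (l - h) powr p \<le> C' * (l - h) * \<mu> h powr \<kappa> * ?I h"
    using superlevel_decay_subsolution[OF p1(1) q1 u0 sub int] unfolding \<kappa>_def by blast
  have "\<exists>M>0. \<mu> M = 0"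
  proof (rule De_Giorgi_iteration[OF p1(1) \<kappa>(1) r q(1) \<mu>_nonneg _ C'(1) c A(1) A(2) _ C'(2)])
    show "0 \<le> ?I t" for t by (intro integral_nonneg_AE) auto
    show "?I h \<le> c * a * h powr (q - 1 - r)"
      if "0 < h" "0 < a" "\<And>s. h \<le> s \<Longrightarrow> \<mu> s \<le> a * s powr - r" for h a
      unfolding c_def by (rule superlevel_integral_le(2)[OF u0 q1 r(1) that])
  qed
  then obtain M where M: "M > 0" "\<mu> M = 0" by blast
  then have "emeasure lborel {x. M < u x} = 0" by (simp add: emeasure_superlevel)
  then have "AE x in lborel. x \<notin> {x. M < u x}"
    by (intro AE_not_in) (auto simp: null_sets_def)
  then have "AE x in lborel. u x \<le> M" by eventually_elim auto
  then show ?thesis by blast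
qed

end

section \<open>Passage to Borel representatives\<close>

text \<open>\<open>lebesgue\<close> is the completion of \<open>lborel\<close>, so a function that
  agrees a.e. with a Borel function is measurable there and has the same integral.\<close>

lemma lebesgue_lborel_transfer:
  fixes f g :: "'a::euclidean_space \<Rightarrow> real"
  assumes g: "g \<in> borel_measurable borel" and ae: "AE x in lborel. f x = g x"
  shows "integrable lebesgue f \<longleftrightarrow> integrable lborel g"
    and "integral\<^sup>L lebesgue f = integral\<^sup>L lborel g"
proof -
  have gl: "g \<in> borel_measurable lebesgue" using g by (simp add: measurable_completion)
  have ae': "AE x in lebesgue. f x = g x" using ae by (rule AE_completion)
  then have "AE x in lebesgue. g x = f x" by eventually_elim simp
  then have fl: "f \<in> borel_measurable lebesgue" by (rule borel_measurable_AE[OF gl])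
  show "integrable lebesgue f \<longleftrightarrow> integrable lborel g"
    using integrable_cong_AE[OF fl gl ae'] integrable_completion[of g lborel] g by simp
  show "integral\<^sup>L lebesgue f = integral\<^sup>L lborel g"
    using integral_cong_AE[OF fl gl ae'] integral_completion[of g lborel] g by simp
qed

lemma lebesgue_measurable_ex_borel:
  fixes f :: "'a::euclidean_space \<Rightarrow> 'b::euclidean_space"
  assumes "f \<in> borel_measurable lebesgue"
  obtains g where "g \<in> borel_measurable borel" "AE x in lborel. f x = g x"
proof -
  have "\<exists>g\<in>borel_measurable lborel. AE x in lborel. f x \<bullet> b = g x" for b
    by (intro completion_ex_borel_measurable_real borel_measurable_inner assms borel_measurable_const)
  then obtain g where g: "\<And>b. g b \<in> borel_measurable borel" "\<And>b. AE x in lborel. f x \<bullet> b = g b x"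
    by (metis measurable_lborel2)
  show thesis
  proof
    show "(\<lambda>x. \<Sum>b\<in>Basis. g b x *\<^sub>R b) \<in> borel_measurable borel" using g(1) by measurable
    have "AE x in lborel. \<forall>b\<in>Basis. f x \<bullet> b = g b x"
      using g(2) by (intro AE_finite_allI) auto
    then show "AE x in lborel. f x = (\<Sum>b\<in>Basis. g b x *\<^sub>R b)"
    proof eventually_elim
      case (elim x)
      have "f x = (\<Sum>b\<in>Basis. (f x \<bullet> b) *\<^sub>R b)" by (simp add: euclidean_representation)
      also have "\<dots> = (\<Sum>b\<in>Basis. g b x *\<^sub>R b)" using elim by (intro sum.cong) auto
      finally show ?case .
    qed
  qed
qed

theorem theorem1p5:
  fixes p q :: real and u :: "real ^ 'n \<Rightarrow> real"
  assumes "CARD('n) \<ge> 3"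
    and "1 < p" and "p < real CARD('n)"
    and "p < q" and "q < sobolev_exponent (real CARD('n)) p"
    and "u \<in> W1p p"
    and "weak_subsolution p q u"
    and "AE x in lebesgue. 0 \<le> u x"
  shows "u \<in> Linfty_fun"
proof -
  define H where "H = weak_grad u"
  have um: "u \<in> borel_measurable lebesgue" and ui: "integrable lebesgue (\<lambda>x. norm (u x) powr p)"
    and Hm: "H \<in> borel_measurable lebesgue" and Hi: "integrable lebesgue (\<lambda>x. norm (H x) powr p)"
    and wg: "has_weak_grad u H"
    using assms(6) has_weak_grad_weak_grad by (auto simp: W1p_def Lp_fun_def H_def)
  obtain w where w: "w \<in> borel_measurable borel" "AE x in lborel. u x = w x"
    using lebesgue_measurable_ex_borel[OF um] by blast
  obtain G where G: "G \<in> borel_measurable borel" "AE x in lborel. H x = G x"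
    using lebesgue_measurable_ex_borel[OF Hm] by blast
  \<comment> \<open>\<open>subsolution_bounded\<close> needs nonnegativity at every point, whereas u
    is nonnegative only a.e.; the positive part of a Borel representative provides it without
    leaving the class of u.\<close>
  define f where "f x = max 0 (w x)" for x
  have [measurable]: "G \<in> borel_measurable borel" "f \<in> borel_measurable borel"
    using G(1) w(1) by (auto simp: f_def[abs_def])
  have "AE x in lborel. 0 \<le> u x" using assms(8) by (simp add: AE_completion_iff)
  with w(2) have uf: "AE x in lborel. u x = f x"
    by eventually_elim (simp add: f_def)
  interpret sobolev_pair p f G
  proof
    show "integrable lborel (\<lambda>x. \<bar>f x\<bar> powr p)"
    proof -
      have "AE x in lborel. norm (u x) powr p = \<bar>f x\<bar> powr p" using uf by eventually_elim simp
      then show ?thesis using ui by (subst (asm) lebesgue_lborel_transfer(1)) auto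
    qed
    show "integrable lborel (\<lambda>x. norm (G x) powr p)"
    proof -
      have "AE x in lborel. norm (H x) powr p = norm (G x) powr p" using G(2) by eventually_elim simp
      then show ?thesis using Hi by (subst (asm) lebesgue_lborel_transfer(1)) auto
    qed
    fix v :: "real ^ 'n \<Rightarrow> real" and b :: "real ^ 'n" assume vb: "v \<in> test_functions" "b \<in> Basis"
    note [measurable] = test_function_borel[OF vb(1)]
      test_function_borel[OF partial_deriv_test_function[OF vb]]
    have "integral\<^sup>L lebesgue (\<lambda>x. u x * partial_deriv b v x) = (\<integral>x. f x * partial_deriv b v x \<partial>lborel)"
      by (rule lebesgue_lborel_transfer(2)) (use uf in \<open>auto elim: eventually_mono\<close>)
    moreover have "integral\<^sup>L lebesgue (\<lambda>x. (H x \<bullet> b) * v x) = (\<integral>x. (G x \<bullet> b) * v x \<partial>lborel)"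
      by (rule lebesgue_lborel_transfer(2)) (use G(2) in \<open>auto elim: eventually_mono\<close>)
    ultimately show "(\<integral>x. f x * partial_deriv b v x \<partial>lborel) = - (\<integral>x. (G x \<bullet> b) * v x \<partial>lborel)"
      using wg vb by (simp add: has_weak_grad_def)
  qed (use assms(2) in auto)
  have "\<exists>M. AE x in lborel. f x \<le> M"
  proof (rule subsolution_bounded)
    fix v :: "real ^ 'n \<Rightarrow> real" assume v: "v \<in> test_functions" "\<And>x. 0 \<le> v x"
    have [measurable]: "grad v \<in> borel_measurable borel" "v \<in> borel_measurable borel"
      using continuous_grad[OF test_function_smooth[OF v(1)]] test_function_borel[OF v(1)]
      by (auto intro: borel_measurable_continuous_onI)
    have flux: "integral\<^sup>L lebesgue (\<lambda>x. p_laplace_flux p u x \<bullet> grad v x)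
        = (\<integral>x. (norm (G x) powr (p - 2) *\<^sub>R G x) \<bullet> grad v x \<partial>lborel)"
      unfolding p_laplace_flux_def H_def[symmetric]
      by (rule lebesgue_lborel_transfer(2)) (use G(2) in \<open>auto elim: eventually_mono\<close>)
    have source: "integral\<^sup>L lebesgue (\<lambda>x. u x powr (q - 1) * v x) = (\<integral>x. f x powr (q - 1) * v x \<partial>lborel)"
      by (rule lebesgue_lborel_transfer(2)) (use uf in \<open>auto elim: eventually_mono\<close>)
    show "(\<integral>x. (norm (G x) powr (p - 2) *\<^sub>R G x) \<bullet> grad v x \<partial>lborel)
        \<le> (\<integral>x. f x powr (q - 1) * v x \<partial>lborel)"
      unfolding flux[symmetric] source[symmetric]
      using assms(7) v unfolding weak_subsolution_def by blast
  qed (use assms in \<open>auto simp: f_def\<close>)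
  then obtain M where "AE x in lborel. f x \<le> M" by blast
  with uf have "AE x in lborel. norm (u x) \<le> M"
    by eventually_elim (simp add: f_def)
  then have "AE x in lebesgue. norm (u x) \<le> M" by (rule AE_completion)
  then show ?thesis using um by (auto simp: Linfty_fun_def)
qed

end
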